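(* Let $\mathbf{D}\in\mathbb{R}^{d\times d}$ be a positive definite matrix and let $\mathbf{C}\in\mathbb{R}^{d\times d}$ be a positive stable matrix (all eigenvalues of $\mathbf{C}$ have positive real part). Let $$\mu:=\min\{\mathrm{Re}(\lambda)\;|\;\lambda\text{ is an eigenvalue of }\mathbf{C}\}$$ and let $n$ be the maximal defect of the eigenvalues $\lambda$ of $\mathbf{C}$ with $\mathrm{Re}(\lambda)=\mu$. (1) For every $p\in(1,2]$ and every $\epsilon>0$ there exists an explicit constant $\mathcal{C}_{p,\epsilon}>0$, independent of the initial datum $f_0$ (but which may become unbounded as $\epsilon\to0$), such that for every $f_0\in L^1_+(\mathbb{R}^d)$ with unit mass and $e_p(f_0|f_\infty)<\infty$, the solution $f(t)$ of the Fokker-Planck equation $\partial_t f=\mathrm{div}(\mathbf{D}\nabla f+\mathbf{C}xf)$ with initial datum $f_0$ satisfies, for all $t\ge 0$, $$e_p(f(t)|f_\infty)\le \mathcal{C}_{p,\epsilon}\max\Big(e_p(f_0|f_\infty),\ \big[p(p-1)e_p(f_0|f_\infty)+1\big]^{\frac{2}{p}(1+\epsilon(2-p))}\Big)\,(1+t^{2n})\,e^{-2\mu t}.$$ (2) There exists a fixed constant $\mathcal{C}_2>0$, independent of $f_0$, such that for every unit mass $f_0\in L^1_+(\mathbb{R}^d)$ with $e_2(f_0|f_\infty)<\infty$ the solution $f(t)$ with initial datum $f_0$ satisfies $$e_2(f(t)|f_\infty)\le \mathcal{C}_2\, e_2(f_0|f_\infty)\,(1+t^{2n})\,e^{-2\mu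 t},\qquad t\ge 0.$$
   Context: The Fokker-Planck equation is $\partial_t f(t,x)=\mathrm{div}(\mathbf{D}\nabla f(t,x)+\mathbf{C}x f(t,x))$, $t>0$, $x\in\mathbb{R}^d$, with constant real matrices $\mathbf{D}$ (diffusion; positive definite includes symmetric) and $\mathbf{C}$ (drift). Its solution with initial datum $f_0\in L^1(\mathbb{R}^d)$ is the unique classical one, given for $t>0$ by $$f(t,x)=\frac{1}{(2\pi)^{d/2}\sqrt{\det\mathbf{W}(t)}}\int_{\mathbb{R}^d}e^{-\frac12(x-e^{-\mathbf{C}t}y)^T\mathbf{W}(t)^{-1}(x-e^{-\mathbf{C}t}y)}f_0(y)\,dy,\qquad \mathbf{W}(t):=2\int_0^t e^{-\mathbf{C}s}\mathbf{D}e^{-\mathbf{C}^Ts}\,ds .$$ The unique unit-mass equilibrium is $f_\infty(x)=c_{\mathbf{K}}e^{-\frac12x^T\mathbf{K}^{-1}x}$, where $\mathbf{K}$ is the unique positive definite solution of $2\mathbf{D}=\mathbf{C}\mathbf{K}+\mathbf{K}\mathbf{C}^T$ and $c_{\mathbf{K}}$ is the normalisation constant. $L^1_+(\mathbb{R}^d)$ denotes the non-negative functions in $L^1(\mathbb{R}^d)$; "unit mass" means $\int_{\mathbb{R}^d}f_0\,dx=1$. For $1<p\le2$, $\psi_p(y):=\frac{y^p-p(y-1)-1}{p(p-1)}$ and the $p$-entropy is $e_p(f|f_\infty):=\int_{\mathbb{R}^d}\psi_p\big(\frac{f(x)}{f_\infty(x)}\big)f_\infty(x)\,dx$. The defect of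 an eigenvalue is its algebraic multiplicity minus its geometric multiplicity. *)

theory Defs
  imports "HOL-Analysis.Analysis" "HOL-Computational_Algebra.Polynomial"
begin

section \<open>Matrices\<close>

definition pos_def_matrix :: "real^'d^'d \<Rightarrow> bool" where
  "pos_def_matrix A \<longleftrightarrow> transpose A = A \<and> (\<forall>x. x \<noteq> 0 \<longrightarrow> 0 < x \<bullet> (A *v x))"

definition complex_matrix :: "real^'d^'d \<Rightarrow> complex^'d^'d" where
  "complex_matrix A = (\<chi> i j. complex_of_real (A $ i $ j))"

definition eigenvalues :: "real^'d^'d \<Rightarrow> complex set" where
  "eigenvalues A = {z. \<exists>v. v \<noteq> 0 \<and> complex_matrix A *v v = z *s v}"

definition char_poly_matrix :: "real^'d^'d \<Rightarrow> complex poly" where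
  "char_poly_matrix A =
     det (\<chi> i j. (if i = j then [:0, 1:] else 0) - [:complex_matrix A $ i $ j:])"

definition algebraic_multiplicity :: "real^'d^'d \<Rightarrow> complex \<Rightarrow> nat" where
  "algebraic_multiplicity A z = order z (char_poly_matrix A)"

(* vec.dim is the dimension over the complex field; plain dim would be the real dimension *)
definition geometric_multiplicity :: "real^'d^'d \<Rightarrow> complex \<Rightarrow> nat" where
  "geometric_multiplicity A z = vec.dim {v. complex_matrix A *v v = z *s v}"

(* the subtraction on nat never truncates: geometric multiplicity \<le> algebraic multiplicity *)
definition defect :: "real^'d^'d \<Rightarrow> complex \<Rightarrow> nat" where
  "defect A z = algebraic_multiplicity A z - geometric_multiplicity A z"

definition positive_stable :: "real^'d^'d \<Rightarrow> bool" where
  "positive_stable C \<longleftrightarrow> (\<forall>z \<in> eigenvalues C. 0 < Re z)"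

(* Min and Max below range over finite, nonempty sets of eigenvalues *)
definition min_real_part :: "real^'d^'d \<Rightarrow> real" where
  "min_real_part C = Min (Re ` eigenvalues C)"

definition max_defect :: "real^'d^'d \<Rightarrow> nat" where
  "max_defect C = Max (defect C ` {z \<in> eigenvalues C. Re z = min_real_part C})"

definition matrix_power :: "real^'d^'d \<Rightarrow> nat \<Rightarrow> real^'d^'d" where
  "matrix_power A k = (((**) A) ^^ k) (mat 1)"

(* the library's exp needs a Banach algebra; real^'d^'d with ** is not an instance *)
definition matrix_exp :: "real^'d^'d \<Rightarrow> real^'d^'d" where
  "matrix_exp A = (\<Sum>k. (1 / fact k) *\<^sub>R matrix_power A k)"


section \<open>The Fokker-Planck equation\<close>

definition fp_W :: "real^'d^'d \<Rightarrow> real^'d^'d \<Rightarrow> real \<Rightarrow> real^'d^'d" where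
  "fp_W D C t = 2 *\<^sub>R integral {0..t}
     (\<lambda>s. matrix_exp ((- s) *\<^sub>R C) ** D ** matrix_exp ((- s) *\<^sub>R transpose C))"

(* The unique classical solution of
     d/dt f = div (D grad f + C x f)   on (0, infinity) x R^d
   with initial datum f0 in L^1, by its explicit formula for t > 0; for t = 0 it is f0. *)
definition fp_solution ::
  "real^'d^'d \<Rightarrow> real^'d^'d \<Rightarrow> (real^'d \<Rightarrow> real) \<Rightarrow> real \<Rightarrow> real^'d \<Rightarrow> real" where
  "fp_solution D C f0 t x =
     (if t \<le> 0 then f0 x
      else 1 / ((2 * pi) powr (real CARD('d) / 2) * sqrt (det (fp_W D C t))) *
        (\<integral>y. exp (- (1/2) *
                 ((x - matrix_exp ((- t) *\<^sub>R C) *v y) \<bullet>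
                  (matrix_inv (fp_W D C t) *v (x - matrix_exp ((- t) *\<^sub>R C) *v y)))) * f0 y
         \<partial>lebesgue))"

definition fp_K :: "real^'d^'d \<Rightarrow> real^'d^'d \<Rightarrow> real^'d^'d" where
  "fp_K D C = (THE K. pos_def_matrix K \<and> 2 *\<^sub>R D = C ** K + K ** transpose C)"

definition gaussian_weight :: "real^'d^'d \<Rightarrow> real^'d \<Rightarrow> real" where
  "gaussian_weight K x = exp (- (1/2) * (x \<bullet> (matrix_inv K *v x)))"

definition fp_equilibrium :: "real^'d^'d \<Rightarrow> real^'d^'d \<Rightarrow> real^'d \<Rightarrow> real" where
  "fp_equilibrium D C x =
     1 / (\<integral>y. gaussian_weight (fp_K D C) y \<partial>lebesgue) * gaussian_weight (fp_K D C) x"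


section \<open>Relative entropies\<close>

definition L1_plus :: "(real^'d \<Rightarrow> real) set" where
  "L1_plus = {f. integrable lebesgue f \<and> (AE x in lebesgue. 0 \<le> f x)}"

definition unit_mass :: "(real^'d \<Rightarrow> real) \<Rightarrow> bool" where
  "unit_mass f \<longleftrightarrow> (\<integral>x. f x \<partial>lebesgue) = 1"

definition psi :: "real \<Rightarrow> real \<Rightarrow> real" where
  "psi p y = (y powr p - p * (y - 1) - 1) / (p * (p - 1))"

(* Valued in [0, infinity], so that finiteness is part of any upper bound.
   psi p is nonnegative on [0, infinity), so ennreal does not clip the integrand
   when f is nonnegative almost everywhere. *)
definition p_entropy ::
  "real \<Rightarrow> (real^'d \<Rightarrow> real) \<Rightarrow> (real^'d \<Rightarrow> real) \<Rightarrow> ennreal" where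
  "p_entropy p f g = (\<integral>\<^sup>+x. ennreal (psi p (f x / g x) * g x) \<partial>lebesgue)"

end

theory Submission
  imports Defs "HOL-Computational_Algebra.Fundamental_Theorem_Algebra" "HOL-Probability.Distributions"
begin

text \<open>Write \<open>E(t) = exp(-t C)\<close> and \<open>h(t) = f(t) / f\<^sub>\<infinity>\<close>. Since \<open>W(t) = K - E(t) K E(t)\<^sup>T\<close>, the solution
  operator is a Gaussian kernel that preserves \<open>f\<^sub>\<infinity>\<close>, so Jensen's inequality gives
  \<open>e\<^sub>p(f(t)) \<le> e\<^sub>p(f\<^sub>0)\<close>, which settles short times. For large \<open>t\<close> its density \<open>k(x, y)\<close> relative to
  \<open>f\<^sub>\<infinity>\<close> is so close to 1 that
  \<open>\<bar>k(x, y) - 1\<bar> \<le> A \<parallel>E(t)\<parallel> exp(\<delta>\<bar>x\<bar>\<^sup>2 + \<delta>\<bar>y\<bar>\<^sup>2)\<close> with a small \<open>\<delta>\<close>. As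
  \<open>h(t) - 1 = \<integral>(k - 1) h\<^sub>0 f\<^sub>\<infinity> = \<integral>(k - 1) (h\<^sub>0 - 1) f\<^sub>\<infinity>\<close>, Hoelder's inequality bounds \<open>h(t) - 1\<close> in
  \<open>L\<^sup>2(f\<^sub>\<infinity>)\<close> by \<open>\<parallel>E(t)\<parallel>\<close> times the \<open>L\<^sup>p(f\<^sub>\<infinity>)\<close> norm of \<open>h\<^sub>0\<close> (or, for \<open>p = 2\<close>, of \<open>h\<^sub>0 - 1\<close>),
  and \<open>e\<^sub>p\<close> is dominated by the squared \<open>L\<^sup>2(f\<^sub>\<infinity>)\<close> distance. No hypercontractivity is needed, because
  the constant is allowed to be large.

  The decay of \<open>E(t)\<close> follows from a primary decomposition in which the nilpotency index at an
  eigenvalue with algebraic and geometric multiplicities \<open>m\<close> and \<open>g\<close> is at most \<open>m - g + 1\<close>.\<close>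

section \<open>Matrices acting as polynomials\<close>

text \<open>The logarithm of k(x, y) is, up to a constant, a quadratic form in (x, y) with
  coefficients of order ||E(t)||. It is unbounded, which is why k - 1 needs a Gaussian weight
  exp(\<delta>|x|^2 + \<delta>|y|^2). Hoelder raises the weight to the conjugate exponent p/(p-1),
  and the result has to stay integrable against the equilibrium; this limits \<delta> to a multiple
  of (p-1)/p. The time t0 from which the estimate holds depends on \<delta>, hence on p, and earlier
  times cost a factor exp(2 \<mu> t0). The p-th power of the L^p norm of h0 is p(p-1) e_p(f0) + 1,
  because both densities have mass 1. This is the bracket in the claim, and Hoelder leaves it with
  the exponent 2/p; since it is at least 1, a larger exponent only enlarges the bound. The plain
  e_p(f0) in the maximum serves the short times. The factor t^(2n) demands the exact power t^n in
  the bound for E(t). In place of a Jordan normal form, a factorization of z I - M over the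
  polynomial ring provides an annihilating polynomial with a zero of order m - g + 1.\<close>

definition poly_act :: "complex^'n^'n \<Rightarrow> complex poly \<Rightarrow> complex^'n \<Rightarrow> complex^'n" where
  "poly_act M p v = fold_coeffs (\<lambda>a w. a *s v + M *v w) p 0"

lemma poly_act_0 [simp]: "poly_act M 0 v = 0"
  by (simp add: poly_act_def)

lemma poly_act_pCons [simp]: "poly_act M (pCons a p) v = a *s v + M *v poly_act M p v"
  by (cases "a = 0 \<and> p = 0") (auto simp: poly_act_def)

lemma poly_act_add: "poly_act M (p + q) v = poly_act M p v + poly_act M q v"
  by (induction p q rule: poly_induct2)
     (simp_all add: matrix_vector_right_distrib vector_sadd_rdistrib algebra_simps)

lemma poly_act_smult: "poly_act M (smult c p) v = c *s poly_act M p v"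
  by (induction p) (simp_all add: vector_scalar_commute vec.scale_right_distrib)

lemma poly_act_add_right: "poly_act M p (v + w) = poly_act M p v + poly_act M p w"
  by (induction p) (simp_all add: matrix_vector_right_distrib vec.scale_right_distrib)

lemma poly_act_scale_right: "poly_act M p (c *s v) = c *s poly_act M p v"
  by (induction p) (simp_all add: vector_scalar_commute vec.scale_right_distrib mult.commute)

lemma poly_act_0_right [simp]: "poly_act M p 0 = 0"
  by (induction p) simp_all

lemma poly_act_sum: "poly_act M (\<Sum>i\<in>S. p i) v = (\<Sum>i\<in>S. poly_act M (p i) v)"
  by (induction S rule: infinite_finite_induct) (simp_all add: poly_act_add)

lemma poly_act_sum_right: "poly_act M p (\<Sum>i\<in>S. v i) = (\<Sum>i\<in>S. poly_act M p (v i))"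
  by (induction S rule: infinite_finite_induct) (simp_all add: poly_act_add_right)

lemma poly_act_mult: "poly_act M (p * q) v = poly_act M p (poly_act M q v)"
  by (induction p) (simp_all add: poly_act_add poly_act_smult)

lemma poly_act_mult_commute: "poly_act M p (poly_act M q v) = poly_act M q (poly_act M p v)"
  by (metis poly_act_mult mult.commute)

lemma poly_act_1 [simp]: "poly_act M 1 v = v"
  by (simp add: one_pCons)

lemma poly_act_matrix: "poly_act M p (M *v v) = M *v poly_act M p v"
  using poly_act_mult_commute[of M p "[:0, 1:]" v] by simp

section \<open>The characteristic matrix over the polynomial ring\<close>

definition char_matrix :: "complex^'n^'n \<Rightarrow> complex poly^'n^'n" where
  "char_matrix M = (\<chi> i j. (if i = j then [:0, 1:] else 0) - [:M $ i $ j:])"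

lemma char_matrix_mult_nth:
  "(char_matrix M *v r) $ i = [:0, 1:] * r $ i - (\<Sum>j\<in>UNIV. smult (M $ i $ j) (r $ j))"
  by (simp add: char_matrix_def matrix_vector_mult_def left_diff_distrib sum_subtractf
      if_distrib[of "\<lambda>x. x * _"] cong: if_cong)

lemma matrix_vector_mult_axis: "A *v axis k (1 :: 'a::semiring_1) = column k A"
  by (simp add: vec_eq_iff matrix_vector_mult_def column_def axis_def if_distrib[of "\<lambda>x. _ * x"]
      cong: if_cong)

lemma smult_axis_sum: "(\<Sum>i\<in>UNIV. (x $ i) *s axis i (1::complex)) = x"
  by (rule basis_expansion)

text \<open>The \<open>\<complex>[z]\<close>-linear map from \<open>\<complex>[z]\<^sup>n\<close> to \<open>\<complex>\<^sup>n\<close> that sends the j-th unit vector to itself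
  (\<open>z\<close> acts as \<open>M\<close>) kills the columns of \<open>z I - M\<close>.\<close>

lemma poly_act_char_matrix:
  "(\<Sum>i\<in>UNIV. poly_act M ((char_matrix M *v r) $ i) (axis i 1)) = 0"
proof -
  have "(\<Sum>i\<in>UNIV. poly_act M (\<Sum>j\<in>UNIV. smult (M $ i $ j) (r $ j)) (axis i 1))
      = (\<Sum>i\<in>UNIV. \<Sum>j\<in>UNIV. poly_act M (r $ j) ((M $ i $ j) *s axis i 1))"
    by (simp add: poly_act_sum poly_act_smult poly_act_scale_right)
  also have "\<dots> = (\<Sum>j\<in>UNIV. poly_act M (r $ j) (\<Sum>i\<in>UNIV. (M $ i $ j) *s axis i 1))"
    by (subst sum.swap) (simp add: poly_act_sum_right)
  also have "\<dots> = (\<Sum>j\<in>UNIV. poly_act M (r $ j) (M *v axis j 1))"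
  proof -
    have "(\<Sum>i\<in>UNIV. (M $ i $ j) *s axis i 1) = M *v axis j 1" for j
      using smult_axis_sum[of "column j M"]
      by (simp add: matrix_vector_mult_axis column_def)
    then show ?thesis by simp
  qed
  finally have *: "(\<Sum>i\<in>UNIV. poly_act M (\<Sum>j\<in>UNIV. smult (M $ i $ j) (r $ j)) (axis i 1))
      = (\<Sum>j\<in>UNIV. M *v poly_act M (r $ j) (axis j 1))"
    by (simp add: poly_act_matrix)
  have "poly_act M ((char_matrix M *v r) $ i) (axis i 1)
      = M *v poly_act M (r $ i) (axis i 1)
        - poly_act M (\<Sum>j\<in>UNIV. smult (M $ i $ j) (r $ j)) (axis i 1)" for i
    using poly_act_add[of M "(char_matrix M *v r) $ i" "\<Sum>j\<in>UNIV. smult (M $ i $ j) (r $ j)" "axis i 1"]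
    by (simp add: char_matrix_mult_nth)
  then show ?thesis
    by (simp add: sum_subtractf *)
qed

text \<open>Column k of \<open>char_matrix M ** R\<close> is q e_k, which the map above sends to
  q(M) e_k; as a combination of columns of z I - M it is also sent to 0. With the adjugate for R
  this is Cayley-Hamilton; better factorizations give q of lower order at an eigenvalue.\<close>

lemma poly_act_eq_0_if_char_matrix_factor:
  assumes "char_matrix M ** R = mat q"
  shows "poly_act M q v = 0"
proof -
  have "poly_act M q (axis k 1) = 0" for k
  proof -
    have "char_matrix M *v column k R = column k (mat q)"
      using assms by (metis matrix_vector_mul_assoc matrix_vector_mult_axis)
    then have "(char_matrix M *v column k R) $ i = (if i = k then q else 0)" for i
      by (simp add: column_def mat_def)
    then have "(\<Sum>i\<in>UNIV. poly_act M (if i = k then q else 0) (axis i 1)) = 0"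
      using poly_act_char_matrix[of M "column k R"] by simp
    moreover have "(\<Sum>i\<in>UNIV. poly_act M (if i = k then q else 0) (axis i 1))
        = (\<Sum>i\<in>UNIV. if i = k then poly_act M q (axis k 1) else 0)"
      by (intro sum.cong) auto
    ultimately show ?thesis by simp
  qed
  then have "(\<Sum>i\<in>UNIV. poly_act M q ((v $ i) *s axis i 1)) = 0"
    by (simp add: poly_act_scale_right)
  then show ?thesis
    by (simp only: poly_act_sum_right[symmetric] smult_axis_sum)
qed

section \<open>The adjugate and the characteristic determinant\<close>

definition adjugate :: "'a::comm_ring_1^'n^'n \<Rightarrow> 'a^'n^'n" where
  "adjugate A = (\<chi> j k. det (\<chi> i. if i = k then axis j 1 else A $ i))"

text \<open>Each cofactor is a full-size determinant with row k replaced by a unit vector. By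
  linearity in that row, entry (i, k) of the product is the determinant of A with row k replaced by
  row i: this is det A for i = k and has two equal rows otherwise.\<close>

lemma matrix_mult_adjugate: "A ** adjugate A = mat (det A)"
proof -
  have "(A ** adjugate A) $ i $ k = (if i = k then det A else 0)" for i k
  proof -
    have "(A ** adjugate A) $ i $ k
        = (\<Sum>j\<in>UNIV. A $ i $ j * det (\<chi> l. if l = k then axis j 1 else A $ l))"
      by (simp add: matrix_matrix_mult_def adjugate_def)
    also have "\<dots> = (\<Sum>j\<in>UNIV. det (\<chi> l. if l = k then (A $ i $ j) *s axis j 1 else A $ l))"
      by (simp add: det_row_mul)
    also have "\<dots> = det (\<chi> l. if l = k then (\<Sum>j\<in>UNIV. (A $ i $ j) *s axis j 1) else A $ l)"
      by (simp add: det_linear_row_sum)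
    also have "(\<Sum>j\<in>UNIV. (A $ i $ j) *s axis j 1) = A $ i"
      by (simp add: basis_expansion)
    also have "det (\<chi> l. if l = k then A $ i else A $ l) = (if i = k then det A else 0)"
    proof (cases "i = k")
      case True
      then have "(\<chi> l. if l = k then A $ i else A $ l) = A"
        by (simp add: vec_eq_iff)
      then show ?thesis using True by simp
    next
      case False
      then have "row i (\<chi> l. if l = k then A $ i else A $ l) = row k (\<chi> l. if l = k then A $ i else A $ l)"
        by (simp add: row_def)
      with False show ?thesis
        by (simp add: det_identical_rows)
    qed
    finally show ?thesis .
  qed
  then show ?thesis
    by (simp add: vec_eq_iff mat_def)
qed

lemma poly_det: "poly (det A) z = det (\<chi> i j. poly (A $ i $ j) z)"
proof -
  have "poly (of_int k) z = of_int k" for k :: int and z :: 'a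
    by (simp add: of_int_poly)
  then show ?thesis
    by (simp add: det_def poly_sum poly_prod)
qed

lemma poly_det_char_matrix: "poly (det (char_matrix M)) z = det (mat z - M)"
proof -
  have "(\<chi> i j. poly (char_matrix M $ i $ j) z) = mat z - M"
    by (simp add: char_matrix_def vec_eq_iff mat_def)
  then show ?thesis
    by (simp add: poly_det)
qed

lemma det_eq_0_iff_kernel:
  fixes A :: "'a::field^'n^'n"
  shows "det A = 0 \<longleftrightarrow> (\<exists>v. v \<noteq> 0 \<and> A *v v = 0)"
  by (metis invertible_det_nz invertible_left_inverse matrix_left_invertible_ker)

lemma mat_diff_mult: "(mat z - M) *v v = z *s v - M *v v" for M :: "complex^'n^'n"
proof -
  have "mat z *v v = z *s v"
    by (simp add: vec_eq_iff matrix_vector_mult_def mat_def if_distrib[of "\<lambda>x. x * _"] cong: if_cong)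
  then show ?thesis
    by (simp add: matrix_vector_mult_diff_rdistrib)
qed

lemma poly_det_char_matrix_eq_0_iff:
  "poly (det (char_matrix M)) z = 0 \<longleftrightarrow> (\<exists>v. v \<noteq> 0 \<and> M *v v = z *s v)"
  by (auto simp: poly_det_char_matrix det_eq_0_iff_kernel mat_diff_mult)

text \<open>If the determinant vanished identically, every complex number would be an eigenvalue,
  even one beyond a bound for the operator norm.\<close>

lemma det_char_matrix_neq_0: "det (char_matrix M) \<noteq> 0"
proof
  assume "det (char_matrix M) = 0"
  then have ev: "\<exists>v. v \<noteq> 0 \<and> M *v v = z *s v" for z
    using poly_det_char_matrix_eq_0_iff[of M z] by simp
  have lin: "bounded_linear ((*v) M)"
  proof (rule linear_conv_bounded_linear[THEN iffD1])
    show "linear ((*v) M)"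
      by (rule linearI)
         (simp_all add: matrix_vector_right_distrib vec_eq_iff matrix_vector_mult_def scaleR_sum_right
           ring_distribs sum.distrib)
  qed
  obtain b where b: "\<And>v. norm (M *v v) \<le> norm v * b"
    using bounded_linear.bounded[OF lin] by blast
  obtain v where v: "v \<noteq> 0" "M *v v = complex_of_real (\<bar>b\<bar> + 1) *s v"
    using ev by blast
  have "complex_of_real (\<bar>b\<bar> + 1) *s v = (\<bar>b\<bar> + 1) *\<^sub>R v"
    by (simp add: vec_eq_iff scaleR_conv_of_real[where 'a = complex] ring_distribs)
  then have "norm (M *v v) = (\<bar>b\<bar> + 1) * norm v"
    using v by (simp del: of_real_add)
  then have "(\<bar>b\<bar> + 1) * norm v \<le> norm v * b"
    using b by metis
  then have "(\<bar>b\<bar> + 1 - b) * norm v \<le> 0"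
    by (simp add: algebra_simps)
  then show False
    using v(1) by (smt (verit) mult_pos_pos zero_less_norm_iff)
qed

text \<open>A basis of E is extended to one of the whole space, and a bijection from the index type
  enumerates it as the columns of P; S collects the indices that land in the basis of E.\<close>

lemma exists_adapted_basis:
  fixes E :: "(complex^'n) set"
  assumes E: "vec.subspace E"
  obtains S :: "'n set" and P :: "complex^'n^'n"
  where "card S = vec.dim E" "det P \<noteq> 0" "\<And>j. j \<in> S \<Longrightarrow> column j P \<in> E"
proof -
  obtain B where B: "B \<subseteq> E" "vec.independent B" "E \<subseteq> vec.span B" "card B = vec.dim E"
    using vec.basis_exists[of E] by blast
  define B' where "B' = vec.extend_basis B"
  have B': "B \<subseteq> B'" "vec.independent B'" "vec.span B' = UNIV"
    using vec.extend_basis_superset[OF B(2)] vec.independent_extend_basis[OF B(2)]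
      vec.span_extend_basis[OF B(2)] by (auto simp: B'_def)
  have finB': "finite B'"
    using B'(2) vec.finiteI_independent by blast
  have "card B' = CARD('n)"
    using B'(2,3) by (metis vec.dim_eq_card_independent vec.dim_span vec_dim_card)
  then obtain b where b: "bij_betw b (UNIV :: 'n set) B'"
    using finB' by (metis finite_class.finite_UNIV finite_same_card_bij)
  define P :: "complex^'n^'n" where "P = (\<chi> i j. b j $ i)"
  have col: "column j P = b j" for j
    by (simp add: P_def column_def)
  have "columns P = B'"
    using b by (auto simp: columns_def col bij_betw_def)
  then have "\<exists>Q. P ** Q = mat 1"
    using B'(3) by (simp add: matrix_right_invertible_span_columns)
  then have "det P \<noteq> 0"
    by (simp add: invertible_det_nz[symmetric] invertible_right_inverse)
  moreover define S where "S = b -` B"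
  have "card S = card B"
  proof -
    have "bij_betw b S B"
      using b B'(1) by (auto simp: S_def bij_betw_def inj_on_def)
    then show ?thesis by (rule bij_betw_same_card)
  qed
  ultimately show ?thesis
    using that[of S P] B col by (auto simp: S_def)
qed

text \<open>In a basis that extends one of the eigenspace of \<open>l\<close>, the matrix \<open>z I - M\<close> has \<open>g\<close> columns
  divisible by \<open>z - l\<close>; pulling these factors out before taking the adjugate saves all but one
  of them in the Cayley--Hamilton argument.\<close>

lemma reduced_char_poly_annihilates:
  fixes M :: "complex^'n^'n" and l :: complex
  defines "g \<equiv> vec.dim {v. M *v v = l *s v}"
  obtains q where "q * [:-l, 1:] ^ g = det (char_matrix M) * [:-l, 1:]"
    "\<And>v. poly_act M q v = 0"
proof -
  let ?X = "char_matrix M"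
  have "vec.subspace {v. M *v v = l *s v}"
    by (rule vec.subspaceI)
       (auto simp: matrix_vector_right_distrib vec.scale_right_distrib vector_scalar_commute mult.commute)
  then obtain S :: "'n set" and P where S: "card S = g" and P: "det P \<noteq> 0"
    and PS: "\<And>j. j \<in> S \<Longrightarrow> column j P \<in> {v. M *v v = l *s v}"
    unfolding g_def by (rule exists_adapted_basis) blast
  define Q where "Q = (\<chi> i j. [:P $ i $ j:])"
  have detQ: "det Q = [:det P:]"
    by (rule poly_eq_poly_eq_iff[THEN iffD1]) (simp add: fun_eq_iff poly_det Q_def)
  \<comment> \<open>For j in S, z I - M sends column j of P to z - l times that column. N keeps the
    constant column, D carries the factor z - l, and D' completes D to the scalar matrix z -
    l.\<close>
  define N where "N = (\<chi> i j. if j \<in> S then [:P $ i $ j:] else (?X ** Q) $ i $ j)"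
  define D where "D = (\<chi> i j. if i = j then (if j \<in> S then [:-l, 1:] else 1) else (0 :: complex poly))"
  define D' where "D' = (\<chi> i j. if i = j then (if j \<in> S then 1 else [:-l, 1:]) else (0 :: complex poly))"
  have diag: "(A ** (\<chi> i j. if i = j then d j else 0)) $ i $ j = A $ i $ j * d j"
    for A :: "complex poly^'n^'n" and d i j
    by (simp add: matrix_matrix_mult_def if_distrib[of "\<lambda>x. _ * x"] cong: if_cong)
  have XQ: "?X ** Q = N ** D"
  proof -
    have "(?X ** Q) $ i $ j = N $ i $ j * (if j \<in> S then [:-l, 1:] else 1)" for i j
    proof (cases "j \<in> S")
      case True
      have "(?X ** Q) $ i $ j = (?X *v column j Q) $ i"
        by (simp add: matrix_matrix_mult_def matrix_vector_mult_def column_def)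
      also have "\<dots> = [:0, P $ i $ j:] - [:(M *v column j P) $ i:]"
      proof -
        have "(\<Sum>k\<in>UNIV. [:M $ i $ k * P $ k $ j:]) = [:\<Sum>k\<in>UNIV. M $ i $ k * P $ k $ j:]"
          by (rule poly_eq_poly_eq_iff[THEN iffD1]) (simp add: fun_eq_iff poly_sum)
        moreover have "(?X *v column j Q) $ i
            = [:0, 1:] * [:P $ i $ j:] - (\<Sum>k\<in>UNIV. smult (M $ i $ k) [:P $ k $ j:])"
          by (simp only: char_matrix_mult_nth) (simp add: column_def Q_def)
        moreover have "(M *v column j P) $ i = (\<Sum>k\<in>UNIV. M $ i $ k * P $ k $ j)"
          by (simp add: column_def matrix_vector_mult_def)
        ultimately show ?thesis
          by simp
      qed
      also have "M *v column j P = l *s column j P"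
        using PS[OF True] by simp
      also have "[:0, P $ i $ j:] - [:(l *s column j P) $ i:] = [:P $ i $ j:] * [:-l, 1:]"
        by (simp add: column_def)
      finally show ?thesis
        using True by (simp add: N_def)
    qed (simp add: N_def)
    then show ?thesis
      by (simp add: vec_eq_iff D_def diag)
  qed
  have detD: "det D = [:-l, 1:] ^ g"
  proof -
    have "det D = (\<Prod>i\<in>UNIV. D $ i $ i)"
      by (rule det_diagonal) (simp add: D_def)
    also have "\<dots> = (\<Prod>i\<in>UNIV. if i \<in> S then [:-l, 1:] else 1)"
      by (simp add: D_def)
    also have "\<dots> = [:-l, 1:] ^ card S"
      by (subst prod.If_cases) simp_all
    finally show ?thesis by (simp add: S)
  qed
  have "det ?X * [:det P:] = det N * [:-l, 1:] ^ g"
    using arg_cong[OF XQ, of det] by (simp add: det_mul detQ detD)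
  then have eq: "smult (1 / det P) ([:-l, 1:] * det N) * [:-l, 1:] ^ g = det ?X * [:-l, 1:]"
  proof -
    assume *: "det ?X * [:det P:] = det N * [:-l, 1:] ^ g"
    have "smult (1 / det P) ([:-l, 1:] * det N) * [:-l, 1:] ^ g
        = smult (1 / det P) ([:-l, 1:] * (det N * [:-l, 1:] ^ g))"
      by (simp only: mult_smult_left mult.assoc)
    also have "\<dots> = smult (1 / det P) ([:-l, 1:] * (det ?X * [:det P:]))"
      by (simp only: *)
    also have "\<dots> = smult (1 / det P * det P) (det ?X * [:-l, 1:])"
      by (simp add: mult.commute)
    finally show ?thesis using P by simp
  qed
  have DD': "D ** D' = mat [:-l, 1:]"
    by (simp add: vec_eq_iff D'_def diag) (simp add: D_def mat_def)
  \<comment> \<open>D' costs a single factor z - l, whereas det N has lost g of them against the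
    characteristic polynomial. So (z - l) det N annihilates M and has order m - g + 1 at l.\<close>
  have "?X ** (Q ** (D' ** adjugate N)) = N ** (D ** D') ** adjugate N"
    by (simp add: matrix_mul_assoc XQ)
  also have "\<dots> = mat ([:-l, 1:] * det N)"
  proof -
    have "N ** mat [:-l, 1:] = mat [:-l, 1:] ** N"
      by (simp add: vec_eq_iff matrix_matrix_mult_def mat_def if_distrib[of "\<lambda>x. _ * x"]
          if_distrib[of "\<lambda>x. x * _"] cong: if_cong)
    then have "N ** (D ** D') ** adjugate N = mat [:-l, 1:] ** mat (det N)"
      by (simp add: DD' matrix_mul_assoc[symmetric] matrix_mult_adjugate)
    then show ?thesis
      by (simp add: vec_eq_iff matrix_matrix_mult_def mat_def if_distrib[of "\<lambda>x. _ * x"]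
          if_distrib[of "\<lambda>x. x * _"] cong: if_cong)
  qed
  finally have "poly_act M ([:-l, 1:] * det N) v = 0" for v
    by (rule poly_act_eq_0_if_char_matrix_factor)
  then show ?thesis
    using that[OF eq] by (simp add: poly_act_smult)
qed

section \<open>Coprime factors and the primary decomposition\<close>

lemma Cayley_Hamilton: "poly_act M (det (char_matrix M)) v = 0"
  by (rule poly_act_eq_0_if_char_matrix_factor[OF matrix_mult_adjugate])

text \<open>Division of r by X - z leaves the nonzero constant r(z), which settles m = 1 explicitly;
  multiplying the relation for m by that one gives m + 1.\<close>

lemma Bezout_linear_power:
  fixes r :: "complex poly"
  assumes "poly r z \<noteq> 0"
  obtains u s where "u * [:-z, 1:] ^ m + s * r = 1"
proof -
  have "\<exists>u s. u * [:-z, 1:] ^ m + s * r = 1"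
  proof (induction m)
    case 0
    show ?case by (rule exI[of _ 1], rule exI[of _ 0]) simp
  next
    case (Suc m)
    then obtain u s where us: "u * [:-z, 1:] ^ m + s * r = 1" by blast
    obtain k where k: "r = [:-z, 1:] * k + [:poly r z:]"
      using synthetic_div_correct'[of z r] by metis
    define b where "b = smult (- 1 / poly r z) k"
    define a where "a = [:1 / poly r z:]"
    have "b * [:-z, 1:] + a * r = 1"
    proof -
      have "b * [:-z, 1:] + a * r = smult (1 / poly r z) (r - [:-z, 1:] * k)"
        by (simp add: a_def b_def smult_diff_right mult.commute)
      also have "r - [:-z, 1:] * k = [:poly r z:]"
        using k by (metis add_diff_cancel_left')
      finally show ?thesis using assms by (simp add: one_pCons)
    qed
    then have "(u * [:-z, 1:] ^ m + s * r) * (b * [:-z, 1:] + a * r) = 1"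
      using us by simp
    moreover have "(u * X + s * r) * (b * L + a * r) = (u * b) * (L * X) + (u * X * a + s * b * L + s * r * a) * r"
      for X L :: "complex poly"
      by (simp add: algebra_simps)
    ultimately have "(u * b) * [:-z, 1:] ^ Suc m + (u * [:-z, 1:] ^ m * a + s * b * [:-z, 1:] + s * r * a) * r = 1"
      by (metis power_Suc)
    then show ?case by blast
  qed
  then show ?thesis using that by blast
qed

text \<open>Induction on the number of roots. A root z splits p into a power of X - z and a cofactor
  r, and a Bezout relation between these splits v into a part killed by the power and a part killed
  by r, which has the remaining roots with unchanged orders. A nonzero polynomial without roots is a
  constant, which forces v = 0.\<close>

lemma primary_decomposition:
  assumes "p \<noteq> 0" "poly_act M p v = 0"
  shows "\<exists>w. v = (\<Sum>z | poly p z = 0. w z) \<and>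
    (\<forall>z. poly p z = 0 \<longrightarrow> poly_act M ([:-z, 1:] ^ order z p) (w z) = 0)"
  using assms
proof (induction "card {z. poly p z = 0}" arbitrary: p v rule: less_induct)
  case less
  show ?case
  proof (cases "\<exists>z. poly p z = 0")
    case False
    then obtain c where c: "p = [:c:]"
      using fundamental_theorem_of_algebra constant_degree degree_eq_zeroE by metis
    with less.prems have "v = 0" by auto
    with False show ?thesis by auto
  next
    case True
    then obtain z where z: "poly p z = 0" by blast
    obtain r where r: "p = [:-z, 1:] ^ order z p * r" "\<not> [:-z, 1:] dvd r"
      using order_decomp[OF less.prems(1)] by blast
    have rz: "poly r z \<noteq> 0" using r(2) by (simp add: poly_eq_0_iff_dvd)
    have r0: "r \<noteq> 0" using rz by auto
    let ?L = "[:-z, 1:] ^ order z p"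
    have ord: "order z p > 0" using z less.prems(1) order_root by blast
    have "poly p y = 0 \<longleftrightarrow> y = z \<or> poly r y = 0" for y
      by (subst r(1)) (use ord in \<open>auto simp: poly_power\<close>)
    then have roots: "{y. poly p y = 0} = insert z {y. poly r y = 0}" by auto
    have fin: "finite {y. poly r y = 0}" using r0 by (rule poly_roots_finite)
    have zn: "z \<notin> {y. poly r y = 0}" using rz by simp
    have ordr: "order y r = order y p" if "y \<noteq> z" for y
    proof -
      have "order y p = order y ?L + order y r"
        using less.prems(1) r(1) by (metis order_mult)
      moreover have "order y ?L = 0"
        using that by (intro order_0I) (simp add: poly_power)
      ultimately show ?thesis by simp
    qed
    obtain u s where us: "u * ?L + s * r = 1"
      using Bezout_linear_power[OF rz] by blast
    define v1 where "v1 = poly_act M (s * r) v"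
    define v2 where "v2 = poly_act M (u * ?L) v"
    have v: "v = v1 + v2"
      using poly_act_add[of M "u * ?L" "s * r" v] us by (simp add: v1_def v2_def add.commute)
    have pr: "p = r * ?L" using r(1) by (simp only: mult.commute)
    have v1: "poly_act M ?L v1 = 0"
    proof -
      have "poly_act M ?L v1 = poly_act M (s * (r * ?L)) v"
        unfolding v1_def poly_act_mult[symmetric] by (simp only: ac_simps)
      then show ?thesis using less.prems(2) pr by (metis poly_act_mult poly_act_0_right)
    qed
    have v2: "poly_act M r v2 = 0"
    proof -
      have "poly_act M r v2 = poly_act M (u * (r * ?L)) v"
        unfolding v2_def poly_act_mult[symmetric] by (simp only: ac_simps)
      then show ?thesis using less.prems(2) pr by (metis poly_act_mult poly_act_0_right)
    qed
    have "card {y. poly r y = 0} < card {y. poly p y = 0}"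
      using roots fin zn by simp
    from less.hyps[OF this r0 v2] obtain w where w: "v2 = (\<Sum>z | poly r z = 0. w z)"
      "\<And>z. poly r z = 0 \<Longrightarrow> poly_act M ([:-z, 1:] ^ order z r) (w z) = 0" by blast
    have "v = (\<Sum>y | poly p y = 0. (w(z := v1)) y)"
    proof -
      have "(\<Sum>y | poly r y = 0. (w(z := v1)) y) = (\<Sum>y | poly r y = 0. w y)"
        using zn by (intro sum.cong) auto
      then show ?thesis
        using fin zn by (simp add: roots v w(1))
    qed
    moreover have "poly_act M ([:-y, 1:] ^ order y p) ((w(z := v1)) y) = 0" if "poly p y = 0" for y
    proof (cases "y = z")
      case False
      then have "poly r y = 0" using that roots by auto
      then show ?thesis using w(2)[of y] ordr[OF False] False by simp
    qed (simp add: v1)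
    ultimately show ?thesis by blast
  qed
qed

text \<open>Up to a factor prime to X - z, q is a power of X - z; a Bezout relation for that factor
  and (X - z)^m makes this power a combination of (X - z)^m and q.\<close>

lemma poly_act_power_reduce:
  assumes "poly_act M ([:-z, 1:] ^ m) w = 0" "poly_act M q w = 0" "q \<noteq> 0"
  shows "poly_act M ([:-z, 1:] ^ order z q) w = 0"
proof -
  obtain r where r: "q = [:-z, 1:] ^ order z q * r" "\<not> [:-z, 1:] dvd r"
    using order_decomp[OF assms(3)] by blast
  have rz: "poly r z \<noteq> 0" using r(2) by (simp add: poly_eq_0_iff_dvd)
  obtain u s where us: "u * [:-z, 1:] ^ m + s * r = 1"
    using Bezout_linear_power[OF rz] by blast
  let ?L = "[:-z, 1:] ^ order z q"
  have "?L = (?L * u) * [:-z, 1:] ^ m + s * q"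
  proof -
    have "?L = ?L * (u * [:-z, 1:] ^ m + s * r)" using us by simp
    also have "\<dots> = (?L * u) * [:-z, 1:] ^ m + s * (?L * r)"
      by (simp only: ring_distribs ac_simps)
    finally show ?thesis using r(1) by simp
  qed
  then have "poly_act M ?L w = poly_act M ((?L * u) * [:-z, 1:] ^ m + s * q) w" by simp
  also have "\<dots> = 0"
    by (simp only: poly_act_add poly_act_mult assms(1,2) poly_act_0_right add_0)
  finally show ?thesis .
qed

section \<open>Spectral decomposition with the defect as a bound on nilpotency\<close>

lemma char_poly_matrix_eq: "char_poly_matrix A = det (char_matrix (complex_matrix A))"
  by (simp add: char_poly_matrix_def char_matrix_def)

lemma eigenvalues_eq_roots: "eigenvalues A = {z. poly (char_poly_matrix A) z = 0}"
  by (simp add: eigenvalues_def char_poly_matrix_eq poly_det_char_matrix_eq_0_iff)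

lemma finite_eigenvalues: "finite (eigenvalues A)"
  by (simp add: eigenvalues_eq_roots char_poly_matrix_eq det_char_matrix_neq_0 poly_roots_finite)

text \<open>Without roots the characteristic polynomial is a nonzero constant c, and Cayley-Hamilton
  reads c v = 0 for every v.\<close>

lemma eigenvalues_nonempty: "eigenvalues A \<noteq> {}"
proof
  assume "eigenvalues A = {}"
  then obtain c where c: "char_poly_matrix A = [:c:]"
    using fundamental_theorem_of_algebra constant_degree degree_eq_zeroE
    by (metis (mono_tags) empty_Collect_eq eigenvalues_eq_roots)
  then have "c \<noteq> 0"
    using det_char_matrix_neq_0[of "complex_matrix A"] by (auto simp: char_poly_matrix_eq)
  moreover have "c *s v = 0" for v :: "complex^'a"
    using Cayley_Hamilton[of "complex_matrix A" v] c by (simp add: char_poly_matrix_eq[symmetric])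
  from this[of "axis undefined 1"] have "c = 0"
    by (simp add: axis_eq_0_iff)
  ultimately show False by simp
qed

text \<open>The primary components are first killed by (X - z)^m with the algebraic multiplicity m.
  They are also killed by a polynomial of order m - g + 1 at z, so the exponent drops to that value,
  which is one more than the defect.\<close>

lemma spectral_decomposition:
  fixes A :: "real^'n^'n"
  obtains w where "v = (\<Sum>z\<in>eigenvalues A. w z)"
    "\<And>z. z \<in> eigenvalues A \<Longrightarrow> poly_act (complex_matrix A) ([:-z, 1:] ^ Suc (defect A z)) (w z) = 0"
proof -
  let ?M = "complex_matrix A" and ?p = "char_poly_matrix A"
  have p0: "?p \<noteq> 0" by (simp add: char_poly_matrix_eq det_char_matrix_neq_0)
  have "poly_act ?M ?p v = 0" by (simp add: char_poly_matrix_eq Cayley_Hamilton)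
  from primary_decomposition[OF p0 this] obtain w where w: "v = (\<Sum>z\<in>eigenvalues A. w z)"
    "\<And>z. z \<in> eigenvalues A \<Longrightarrow> poly_act ?M ([:-z, 1:] ^ order z ?p) (w z) = 0"
    by (auto simp: eigenvalues_eq_roots)
  have "poly_act ?M ([:-z, 1:] ^ Suc (defect A z)) (w z) = 0" if z: "z \<in> eigenvalues A" for z
  proof -
    obtain q where q: "q * [:-z, 1:] ^ geometric_multiplicity A z = ?p * [:-z, 1:]"
      "\<And>v. poly_act ?M q v = 0"
      using reduced_char_poly_annihilates[where M = ?M and l = z]
      unfolding geometric_multiplicity_def char_poly_matrix_eq by blast
    have nz: "?p * [:-z, 1:] \<noteq> 0" using p0 by (simp only: mult_eq_0_iff pCons_eq_0_iff) simp
    then have q0: "q \<noteq> 0" using q(1) by (metis mult_zero_left)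
    have o1: "order z [:-z, 1:] = 1"
      using order_power_n_n[of z 1] by simp
    have "order z q + geometric_multiplicity A z = Suc (order z ?p)"
    proof -
      have "order z (q * [:-z, 1:] ^ geometric_multiplicity A z) = order z q + geometric_multiplicity A z"
        using nz by (subst order_mult) (simp_all only: q(1) order_power_n_n not_False_eq_True)
      moreover have "order z (?p * [:-z, 1:]) = order z ?p + 1"
        by (simp only: order_mult[OF nz] o1)
      ultimately show ?thesis
        by (simp only: q(1))
    qed
    then have "order z q \<le> Suc (defect A z)"
      by (simp add: defect_def algebraic_multiplicity_def)
    then obtain k where k: "Suc (defect A z) = k + order z q"
      by (metis add.commute le_Suc_ex)
    have "poly_act ?M ([:-z, 1:] ^ order z q) (w z) = 0"
      by (rule poly_act_power_reduce[OF w(2)[OF z] q(2) q0])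
    then show ?thesis
      by (simp only: k power_add poly_act_mult poly_act_0_right)
  qed
  with w(1) show ?thesis using that by blast
qed

section \<open>The matrix exponential\<close>

lemma matrix_mult_scaleR_left: "(c *\<^sub>R A) ** B = c *\<^sub>R (A ** B)"
  for A :: "real^'n^'m"
  by (simp add: vec_eq_iff matrix_matrix_mult_def sum_distrib_left mult_ac)

lemma matrix_mult_scaleR_right: "A ** (c *\<^sub>R B) = c *\<^sub>R (A ** B)"
  for A :: "real^'n^'m"
  by (simp add: vec_eq_iff matrix_matrix_mult_def sum_distrib_left mult_ac)

lemma matrix_add_rdistrib: "(A + B) ** C = A ** C + B ** C"
  by (simp add: vec_eq_iff matrix_matrix_mult_def distrib_right sum.distrib)

lemma matrix_power_0 [simp]: "matrix_power A 0 = mat 1"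
  by (simp add: matrix_power_def)

lemma matrix_power_Suc: "matrix_power A (Suc k) = A ** matrix_power A k"
  by (simp add: matrix_power_def)

lemma matrix_power_commute: "A ** matrix_power A k = matrix_power A k ** A"
proof (induction k)
  case (Suc k)
  have "A ** (A ** matrix_power A k) = A ** (matrix_power A k ** A)"
    by (simp only: Suc)
  then show ?case
    by (simp only: matrix_power_Suc matrix_mul_assoc)
qed simp

lemma matrix_power_scaleR: "matrix_power (c *\<^sub>R A) k = c ^ k *\<^sub>R matrix_power A k"
  by (induction k) (simp_all add: matrix_power_Suc matrix_mult_scaleR_left matrix_mult_scaleR_right)

lemma matrix_power_transpose: "matrix_power (transpose A) k = transpose (matrix_power A k)"
proof (induction k)
  case (Suc k)
  have "matrix_power (transpose A) (Suc k) = transpose (matrix_power A k ** A)"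
    by (simp add: matrix_power_Suc Suc matrix_transpose_mul)
  then show ?case
    by (simp only: matrix_power_Suc matrix_power_commute)
qed simp

lemma matrix_power_entry_le:
  fixes A :: "real^'n^'n"
  obtains b where "b > 0" "\<And>k i j. \<bar>matrix_power A k $ i $ j\<bar> \<le> b ^ k"
proof -
  obtain b where b: "b > 0" "\<And>x. norm (A *v x) \<le> norm x * b"
    using bounded_linear.pos_bounded[OF matrix_vector_mul_bounded_linear[of A]] by blast
  have "norm (matrix_power A k *v x) \<le> b ^ k * norm x" for k x
  proof (induction k)
    case (Suc k)
    have "norm (matrix_power A (Suc k) *v x) \<le> norm (matrix_power A k *v x) * b"
      using b(2) by (simp add: matrix_power_Suc matrix_vector_mul_assoc[symmetric])
    also have "\<dots> \<le> (b ^ k * norm x) * b"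
      using Suc b(1) by (intro mult_right_mono) auto
    finally show ?case by (simp add: ac_simps)
  qed simp
  then have "norm (matrix_power A k *v axis j 1) \<le> b ^ k" for k j
    by (metis mult.right_neutral norm_axis_1)
  then have "\<bar>matrix_power A k $ i $ j\<bar> \<le> b ^ k" for k i j
    using component_le_norm_cart[of "matrix_power A k *v axis j 1" i]
    by (simp add: matrix_vector_mult_basis column_def) (meson order_trans)
  with b(1) show ?thesis using that by blast
qed

lemma summable_matrix_exp_entry:
  fixes A :: "real^'n^'n"
  shows "summable (\<lambda>k. matrix_power A k $ i $ j / fact k * t ^ k)"
proof -
  obtain b where b: "b > 0" "\<And>k i j. \<bar>matrix_power A k $ i $ j\<bar> \<le> b ^ k"
    using matrix_power_entry_le by blast
  have "norm (matrix_power A k $ i $ j / fact k * t ^ k) \<le> inverse (fact k) * (b * \<bar>t\<bar>) ^ k" for k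
    using mult_right_mono[OF b(2)[of k i j], of "\<bar>t\<bar> ^ k / fact k"]
    by (simp add: abs_mult power_abs power_mult_distrib field_simps)
  then show ?thesis
    by (intro summable_comparison_test'[OF summable_exp[of "b * \<bar>t\<bar>"], of 0]) auto
qed

text \<open>Each entry is a scalar power series in t with coefficients independent of t; in this
  form termwise differentiation applies to \<open>matrix_exp\<close>.\<close>

lemma matrix_exp_entry:
  fixes A :: "real^'n^'n"
  shows "matrix_exp (t *\<^sub>R A) $ i $ j = (\<Sum>k. matrix_power A k $ i $ j / fact k * t ^ k)"
proof -
  let ?E = "\<chi> i j. (\<Sum>k. matrix_power A k $ i $ j / fact k * t ^ k)"
  have "(\<lambda>k. (1 / fact k) *\<^sub>R matrix_power (t *\<^sub>R A) k) sums ?E"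
    unfolding sums_def
  proof (intro vec_tendstoI)
    fix i j
    have "(\<lambda>n. \<Sum>k<n. matrix_power A k $ i $ j / fact k * t ^ k) \<longlonglongrightarrow> ?E $ i $ j"
      using summable_LIMSEQ[OF summable_matrix_exp_entry[of A i j t]] by simp
    then show "(\<lambda>n. (\<Sum>k<n. (1 / fact k) *\<^sub>R matrix_power (t *\<^sub>R A) k) $ i $ j) \<longlonglongrightarrow> ?E $ i $ j"
      by (simp add: matrix_power_scaleR sum_component mult_ac)
  qed
  then show ?thesis
    by (simp add: matrix_exp_def sums_unique[symmetric])
qed

lemma matrix_mult_matrix_exp_entry:
  fixes A :: "real^'n^'n"
  shows "(X ** matrix_exp (t *\<^sub>R A)) $ i $ j = (\<Sum>k. (X ** matrix_power A k) $ i $ j / fact k * t ^ k)"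
proof -
  have "(\<lambda>k. \<Sum>l\<in>UNIV. X $ i $ l * (matrix_power A k $ l $ j / fact k * t ^ k)) sums
      (\<Sum>l\<in>UNIV. X $ i $ l * matrix_exp (t *\<^sub>R A) $ l $ j)"
    unfolding matrix_exp_entry
    by (intro sums_sum sums_mult summable_sums summable_matrix_exp_entry)
  then show ?thesis
    by (intro sums_unique)
       (simp add: matrix_matrix_mult_def divide_inverse sum_distrib_left mult_ac)
qed

lemma matrix_exp_mult_entry:
  fixes A :: "real^'n^'n"
  shows "(matrix_exp (t *\<^sub>R A) ** X) $ i $ j = (\<Sum>k. (matrix_power A k ** X) $ i $ j / fact k * t ^ k)"
proof -
  have "(\<lambda>k. \<Sum>l\<in>UNIV. (matrix_power A k $ i $ l / fact k * t ^ k) * X $ l $ j) sums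
      (\<Sum>l\<in>UNIV. matrix_exp (t *\<^sub>R A) $ i $ l * X $ l $ j)"
    unfolding matrix_exp_entry
    by (intro sums_sum sums_mult2 summable_sums summable_matrix_exp_entry)
  then show ?thesis
    by (intro sums_unique)
       (simp add: matrix_matrix_mult_def divide_inverse sum_distrib_left mult_ac)
qed

lemma matrix_exp_0 [simp]: "matrix_exp (0 :: real^'n^'n) = mat 1"
proof -
  have "matrix_exp (0 *\<^sub>R (0 :: real^'n^'n)) $ i $ j = mat 1 $ i $ j" for i j
  proof -
    have "(\<Sum>k. matrix_power 0 k $ i $ j / fact k * (0 :: real) ^ k) = matrix_power (0 :: real^'n^'n) 0 $ i $ j / fact 0"
      by (rule powser_zero)
    then show ?thesis
      by (subst matrix_exp_entry) simp
  qed
  then show ?thesis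
    by (simp add: vec_eq_iff)
qed

lemma matrix_exp_commute: "A ** matrix_exp (t *\<^sub>R A) = matrix_exp (t *\<^sub>R A) ** A"
  for A :: "real^'n^'n"
  unfolding vec_eq_iff matrix_mult_matrix_exp_entry matrix_exp_mult_entry
  by (simp add: matrix_power_commute)

lemma matrix_exp_transpose: "matrix_exp (t *\<^sub>R transpose A) = transpose (matrix_exp (t *\<^sub>R A))"
  for A :: "real^'n^'n"
proof -
  have tr: "transpose X $ i $ j = X $ j $ i" for X :: "real^'n^'n" and i j
    by (simp add: transpose_def)
  have "matrix_exp (t *\<^sub>R transpose A) $ i $ j = transpose (matrix_exp (t *\<^sub>R A)) $ i $ j" for i j
    by (simp only: matrix_exp_entry matrix_power_transpose tr)
  then show ?thesis
    by (simp only: vec_eq_iff) blast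
qed

section \<open>Differentiation in t and uniqueness for linear systems\<close>

lemma has_vector_derivative_vec:
  fixes f :: "real \<Rightarrow> 'b::euclidean_space^'a"
  assumes "\<And>i. ((\<lambda>t. f t $ i) has_vector_derivative f' $ i) (at s within S)"
  shows "(f has_vector_derivative f') (at s within S)"
  unfolding has_vector_derivative_def
proof (rule has_derivative_componentwise_within[THEN iffD2], rule ballI)
  fix b :: "'b^'a" assume "b \<in> Basis"
  then obtain i u where b: "b = axis i u" by (auto simp: Basis_vec_def)
  have "((\<lambda>t. f t $ i \<bullet> u) has_derivative (\<lambda>x. (x *\<^sub>R f' $ i) \<bullet> u)) (at s within S)"
    using assms[of i] unfolding has_vector_derivative_def by (rule has_derivative_inner_left)
  then show "((\<lambda>t. f t \<bullet> b) has_derivative (\<lambda>x. (x *\<^sub>R f') \<bullet> b)) (at s within S)"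
    by (simp add: b inner_axis)
qed

lemma matrix_exp_has_vector_derivative:
  fixes A :: "real^'n^'n"
  shows "((\<lambda>t. matrix_exp (t *\<^sub>R A)) has_vector_derivative (A ** matrix_exp (t *\<^sub>R A))) (at t within S)"
proof (intro has_vector_derivative_vec)
  fix i j
  have "((\<lambda>t. \<Sum>k. matrix_power A k $ i $ j / fact k * t ^ k) has_field_derivative
      (\<Sum>k. diffs (\<lambda>k. matrix_power A k $ i $ j / fact k) k * t ^ k)) (at t)"
    by (rule termdiffs_strong_converges_everywhere) (rule summable_matrix_exp_entry)
  moreover have "(\<Sum>k. diffs (\<lambda>k. matrix_power A k $ i $ j / fact k) k * t ^ k)
      = (A ** matrix_exp (t *\<^sub>R A)) $ i $ j"
  proof -
    \<comment> \<open>\<open>diffs\<close> shifts the coefficients and multiplies by k + 1, which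
      cancels against the factorial and leaves one extra factor A.\<close>
    have "diffs (\<lambda>k. matrix_power A k $ i $ j / fact k) = (\<lambda>k. (A ** matrix_power A k) $ i $ j / fact k)"
      by (rule ext) (simp add: diffs_def matrix_power_Suc field_simps del: of_nat_Suc)
    then show ?thesis
      by (simp only: matrix_mult_matrix_exp_entry)
  qed
  ultimately show "((\<lambda>t. matrix_exp (t *\<^sub>R A) $ i $ j) has_vector_derivative
      (A ** matrix_exp (t *\<^sub>R A)) $ i $ j) (at t within S)"
    by (simp add: matrix_exp_entry has_real_derivative_iff_has_vector_derivative[symmetric]
        has_field_derivative_at_within)
qed

lemma bounded_bilinear_matrix_vector_mult:
  "bounded_bilinear ((*v) :: real^'n^'m \<Rightarrow> real^'n \<Rightarrow> real^'m)"
  unfolding bilinear_conv_bounded_bilinear[symmetric] bilinear_def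
  by (auto intro!: linearI simp: matrix_vector_right_distrib matrix_vector_mult_add_rdistrib
      vec_eq_iff matrix_vector_mult_def sum_distrib_left sum.distrib distrib_left mult_ac)

lemma bounded_bilinear_matrix_mult:
  "bounded_bilinear ((**) :: real^'n^'m \<Rightarrow> real^'k^'n \<Rightarrow> real^'k^'m)"
  unfolding bilinear_conv_bounded_bilinear[symmetric] bilinear_def
  by (auto intro!: linearI simp: matrix_add_ldistrib matrix_add_rdistrib
      matrix_mult_scaleR_left matrix_mult_scaleR_right)

lemma zero_vector_derivative_imp_const:
  fixes f :: "real \<Rightarrow> 'a::real_normed_vector"
  assumes "\<And>t. (f has_vector_derivative 0) (at t)"
  shows "f s = f t"
proof -
  have "\<exists>c. \<forall>x\<in>UNIV. f x = c"
    using assms by (intro has_derivative_zero_constant) (auto simp: has_vector_derivative_def)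
  then show ?thesis by auto
qed

text \<open>The function s |-> exp((t - s) A) r(s) has derivative 0, because A commutes with its
  exponential; comparing s = t with s = 0 gives the formula.\<close>

lemma linear_ode_solution_eq:
  fixes A :: "real^'n^'n"
  assumes r: "\<And>t. (r has_vector_derivative (A *v r t)) (at t)"
  shows "r t = matrix_exp (t *\<^sub>R A) *v r 0"
proof -
  have "((\<lambda>s. matrix_exp ((t - s) *\<^sub>R A) *v r s) has_vector_derivative 0) (at s)" for s
  proof -
    have "((\<lambda>s. matrix_exp ((t - s) *\<^sub>R A)) has_vector_derivative
        (- 1) *\<^sub>R (A ** matrix_exp ((t - s) *\<^sub>R A))) (at s)"
    proof -
      have "((\<lambda>s. t - s) has_vector_derivative (- 1)) (at s)"
        by (auto intro!: derivative_eq_intros)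
      from vector_diff_chain_at[OF this matrix_exp_has_vector_derivative[of A "t - s" UNIV]]
      show ?thesis by (simp add: o_def)
    qed
    from bounded_bilinear.has_vector_derivative[OF bounded_bilinear_matrix_vector_mult this r]
    show ?thesis
      by (simp add: matrix_exp_commute matrix_vector_mul_assoc[symmetric]
          bounded_bilinear.minus_left[OF bounded_bilinear_matrix_vector_mult])
  qed
  from zero_vector_derivative_imp_const[OF this, of t 0] show ?thesis by simp
qed

section \<open>Exponential polynomials and the decay rate\<close>

lemma power_le_fact_mult_exp: "0 \<le> (x :: real) \<Longrightarrow> x ^ k \<le> fact k * exp x"
proof -
  assume x: "0 \<le> x"
  have "(\<Sum>j\<in>{k}. inverse (fact j) * x ^ j) \<le> (\<Sum>j. inverse (fact j) * x ^ j)"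
    using x summable_exp[of x] by (intro sum_le_suminf) auto
  then show ?thesis
    by (simp add: exp_def field_simps)
qed

lemma power_mult_exp_le:
  fixes \<delta> :: real
  assumes "\<delta> > 0"
  obtains K where "K > 0" "\<And>t. t \<ge> 0 \<Longrightarrow> t ^ j * exp (- \<delta> * t) \<le> K"
proof
  show "fact j / \<delta> ^ j > (0 :: real)" using assms by simp
  show "t ^ j * exp (- \<delta> * t) \<le> fact j / \<delta> ^ j" if "t \<ge> 0" for t
    using power_le_fact_mult_exp[of "\<delta> * t" j] that assms
    by (simp add: exp_minus field_simps power_mult_distrib)
qed

text \<open>The coefficient of (M - z)^j in exp(-t M) = exp(-z t) exp(-t (M - z)).\<close>

definition exp_poly_coeff :: "complex \<Rightarrow> nat \<Rightarrow> real \<Rightarrow> complex" where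
  "exp_poly_coeff z j t = exp (- z * of_real t) * (- of_real t) ^ j / fact j"

lemma exp_poly_coeff_0_arg: "exp_poly_coeff z j 0 = (if j = 0 then 1 else 0)"
  by (simp add: exp_poly_coeff_def)

lemma exp_poly_coeff_has_vector_derivative:
  "(exp_poly_coeff z j has_vector_derivative
     (- z * exp_poly_coeff z j t - (case j of 0 \<Rightarrow> 0 | Suc i \<Rightarrow> exp_poly_coeff z i t))) (at t)"
proof -
  have "((\<lambda>t. exp (- z * t) * (- t) ^ j / fact j) has_field_derivative
     (- z * exp_poly_coeff z j t - (case j of 0 \<Rightarrow> 0 | Suc i \<Rightarrow> exp_poly_coeff z i t)))
     (at (complex_of_real t))"
  proof (cases j)
    case 0
    then show ?thesis
      by (auto intro!: derivative_eq_intros simp: exp_poly_coeff_def)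
  next
    case (Suc i)
    have "(fact (Suc i) :: complex) = of_nat (Suc i) * fact i" by (rule fact_Suc)
    moreover have "of_nat (Suc i) \<noteq> (0 :: complex)" by (rule of_nat_neq_0)
    ultimately show ?thesis
      by (auto intro!: derivative_eq_intros simp: exp_poly_coeff_def Suc divide_simps
          simp del: fact_Suc of_nat_Suc) (simp add: algebra_simps, cases i, simp_all)
  qed
  then show ?thesis
    unfolding exp_poly_coeff_def[abs_def] by (rule has_vector_derivative_real_field)
qed

lemma cmod_exp_poly_coeff_le:
  assumes "t \<ge> 0"
  shows "cmod (exp_poly_coeff z j t) \<le> t ^ j * exp (- Re z * t)"
proof -
  have "cmod (exp_poly_coeff z j t) = t ^ j * exp (- Re z * t) / fact j"
    using assms by (simp add: exp_poly_coeff_def norm_mult norm_divide norm_power mult.commute)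
  also have "\<dots> \<le> t ^ j * exp (- Re z * t) / 1"
    using assms by (intro divide_left_mono) (auto simp: fact_ge_1)
  finally show ?thesis by simp
qed

definition complex_vector :: "real^'n \<Rightarrow> complex^'n" where
  "complex_vector v = (\<chi> i. of_real (v $ i))"

definition Jordan_chain :: "complex^'n^'n \<Rightarrow> complex \<Rightarrow> nat \<Rightarrow> complex^'n \<Rightarrow> complex^'n" where
  "Jordan_chain M z j w = poly_act M ([:-z, 1:] ^ j) w"

lemma matrix_mult_Jordan_chain:
  "M *v Jordan_chain M z j w = z *s Jordan_chain M z j w + Jordan_chain M z (Suc j) w"
  by (simp only: Jordan_chain_def power_Suc poly_act_mult) simp

text \<open>This is exp(-t M) w as soon as (M - z)^(s+1) kills w: the series of exp(-t (M - z)) then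
  stops at j = s.\<close>

definition exp_poly_sum :: "complex^'n^'n \<Rightarrow> complex \<Rightarrow> nat \<Rightarrow> complex^'n \<Rightarrow> real \<Rightarrow> complex^'n" where
  "exp_poly_sum M z s w t = (\<Sum>j<Suc s. exp_poly_coeff z j t *s Jordan_chain M z j w)"

lemma exp_poly_sum_0_arg: "exp_poly_sum M z s w 0 = w"
proof -
  have "exp_poly_sum M z s w 0 = (\<Sum>j<Suc s. if j = 0 then w else 0)"
    unfolding exp_poly_sum_def
    by (intro sum.cong) (auto simp: exp_poly_coeff_0_arg Jordan_chain_def)
  then show ?thesis by simp
qed

lemma exp_poly_sum_has_vector_derivative:
  fixes M :: "complex^'n^'n"
  assumes "Jordan_chain M z (Suc s) w = 0"
  shows "((\<lambda>t. exp_poly_sum M z s w t $ i) has_vector_derivative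
           - ((M *v exp_poly_sum M z s w t) $ i)) (at t)"
proof -
  let ?a = "\<lambda>j. Jordan_chain M z j w" and ?c = "\<lambda>j. exp_poly_coeff z j t"
  let ?c' = "\<lambda>j. - z * ?c j - (case j of 0 \<Rightarrow> 0 | Suc i \<Rightarrow> ?c i)"
  have "((\<lambda>t. \<Sum>j<Suc s. exp_poly_coeff z j t * ?a j $ i) has_vector_derivative
      (\<Sum>j<Suc s. ?c' j * ?a j $ i)) (at t)"
    by (intro has_vector_derivative_sum has_vector_derivative_mult_left
        exp_poly_coeff_has_vector_derivative)
  moreover have "(\<Sum>j<Suc s. ?c' j * ?a j $ i) = - ((M *v exp_poly_sum M z s w t) $ i)"
  proof -
    have "M *v exp_poly_sum M z s w t = (\<Sum>j<Suc s. ?c j *s (z *s ?a j + ?a (Suc j)))"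
      by (simp add: exp_poly_sum_def vec.sum vec.scale matrix_mult_Jordan_chain del: sum.lessThan_Suc)
    then have "(M *v exp_poly_sum M z s w t) $ i
        = (\<Sum>j<Suc s. z * ?c j * ?a j $ i) + (\<Sum>j<Suc s. ?c j * ?a (Suc j) $ i)"
      by (simp add: sum_component sum.distrib[symmetric] algebra_simps del: sum.lessThan_Suc)
    \<comment> \<open>The end of the chain removes the top term; with the index shifted, the rest
      matches the second half of the derivative of the coefficients.\<close>
    also have "(\<Sum>j<Suc s. ?c j * ?a (Suc j) $ i) = (\<Sum>j<s. ?c j * ?a (Suc j) $ i)"
      using assms by simp
    also have "\<dots> = (\<Sum>j<Suc s. (case j of 0 \<Rightarrow> 0 | Suc i \<Rightarrow> ?c i) * ?a j $ i)"
      by (simp add: sum.lessThan_Suc_shift del: sum.lessThan_Suc)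
    finally show ?thesis
      by (simp add: left_diff_distrib sum_subtractf sum_negf del: sum.lessThan_Suc)
  qed
  ultimately show ?thesis
    by (simp add: exp_poly_sum_def sum_component del: sum.lessThan_Suc)
qed

text \<open>After complexification, the components from the spectral decomposition evolve as
  exponential polynomials, and their sum u satisfies u' = -M u. Since C is real, the real part r
  solves r' = -C r with r(0) = v, and uniqueness identifies it.\<close>

lemma matrix_exp_vector_expansion:
  fixes C :: "real^'n^'n"
  obtains w where
    "\<And>t. matrix_exp ((- t) *\<^sub>R C) *v v
       = (\<chi> i. Re (\<Sum>z\<in>eigenvalues C. exp_poly_sum (complex_matrix C) z (defect C z) (w z) t $ i))"
proof -
  let ?M = "complex_matrix C"
  obtain w where w: "complex_vector v = (\<Sum>z\<in>eigenvalues C. w z)"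
    "\<And>z. z \<in> eigenvalues C \<Longrightarrow> poly_act ?M ([:-z, 1:] ^ Suc (defect C z)) (w z) = 0"
    using spectral_decomposition[of "complex_vector v" C] by blast
  define u where "u t = (\<Sum>z\<in>eigenvalues C. exp_poly_sum ?M z (defect C z) (w z) t)" for t
  define r where "r t = (\<chi> i. Re (u t $ i))" for t
  have u: "((\<lambda>t. u t $ i) has_vector_derivative - ((?M *v u t) $ i)) (at t)" for i t
  proof -
    have "((\<lambda>t. \<Sum>z\<in>eigenvalues C. exp_poly_sum ?M z (defect C z) (w z) t $ i) has_vector_derivative
       (\<Sum>z\<in>eigenvalues C. - ((?M *v exp_poly_sum ?M z (defect C z) (w z) t) $ i))) (at t)"
      using w(2) by (intro has_vector_derivative_sum exp_poly_sum_has_vector_derivative)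
        (simp add: Jordan_chain_def)
    then show ?thesis
      by (simp add: u_def vec.sum sum_negf sum_component)
  qed
  have r: "(r has_vector_derivative ((- C) *v r t)) (at t)" for t
  proof (rule has_vector_derivative_vec)
    fix i
    have "((\<lambda>t. Re (u t $ i)) has_vector_derivative Re (- ((?M *v u t) $ i))) (at t)"
      by (rule bounded_linear.has_vector_derivative[OF bounded_linear_Re u])
    moreover have "Re (- ((?M *v u t) $ i)) = ((- C) *v r t) $ i"
      by (simp add: matrix_vector_mult_def complex_matrix_def r_def sum_negf)
    ultimately show "((\<lambda>t. r t $ i) has_vector_derivative ((- C) *v r t) $ i) (at t)"
      by (simp add: r_def)
  qed
  have "u 0 = complex_vector v"
    using w(1) by (simp add: u_def exp_poly_sum_0_arg)
  then have "r 0 = v"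
    by (simp add: r_def complex_vector_def vec_eq_iff)
  then have "matrix_exp ((- t) *\<^sub>R C) *v v = r t" for t
    using linear_ode_solution_eq[OF r, of t] by simp
  then show ?thesis
    using that[of w] by (simp add: r_def u_def sum_component)
qed

text \<open>Eigenvalues of minimal real part contribute powers t^j with j at most their defect,
  hence at most n; for the others the surplus exponential decay absorbs every power of t. The
  constant still depends on v.\<close>

lemma matrix_exp_vector_decay:
  fixes C :: "real^'n^'n"
  shows "\<exists>K. \<forall>t\<ge>0. norm (matrix_exp ((- t) *\<^sub>R C) *v v)
     \<le> K * ((1 + t ^ max_defect C) * exp (- min_real_part C * t))"
proof -
  let ?M = "complex_matrix C" and ?b = "\<lambda>t. (1 + t ^ max_defect C) * exp (- min_real_part C * t)"
  obtain w where w: "\<And>t. matrix_exp ((- t) *\<^sub>R C) *v v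
       = (\<chi> i. Re (\<Sum>z\<in>eigenvalues C. exp_poly_sum ?M z (defect C z) (w z) t $ i))"
    using matrix_exp_vector_expansion[of C v] by blast
  have "\<exists>K. \<forall>t\<ge>0. cmod (exp_poly_coeff z j t) \<le> K * ?b t"
    if z: "z \<in> eigenvalues C" and j: "j \<le> defect C z" for z j
  proof (cases "Re z = min_real_part C")
    case True
    have "defect C z \<le> max_defect C"
      unfolding max_defect_def using z True finite_eigenvalues[of C] by (intro Max_ge) auto
    then have jn: "j \<le> max_defect C" using j by simp
    \<comment> \<open>The 1 covers t \<le> 1, where a lower power may exceed the top one.\<close>
    have "t ^ j \<le> 1 + t ^ max_defect C" if "t \<ge> 0" for t :: real
    proof (cases "t \<le> 1")
      case True
      then have "t ^ j \<le> 1" using that by (simp add: power_le_one)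
      then show ?thesis using that by (simp add: add_increasing2)
    next
      case False
      then have "t ^ j \<le> t ^ max_defect C" using jn by (intro power_increasing) auto
      then show ?thesis by simp
    qed
    then have "cmod (exp_poly_coeff z j t) \<le> 1 * ?b t" if "t \<ge> 0" for t
      using cmod_exp_poly_coeff_le[OF that, of z j] that True
      by (smt (verit, best) mult_right_mono exp_ge_zero mult_cancel_right1)
    then show ?thesis by blast
  next
    case False
    have "min_real_part C \<le> Re z"
      unfolding min_real_part_def using z finite_eigenvalues[of C] by (intro Min_le) auto
    with False have d: "Re z - min_real_part C > 0" by simp
    obtain K where K: "K > 0" "\<And>t. t \<ge> 0 \<Longrightarrow> t ^ j * exp (- (Re z - min_real_part C) * t) \<le> K"
      using power_mult_exp_le[OF d, of j] by blast
    have "cmod (exp_poly_coeff z j t) \<le> K * ?b t" if t: "t \<ge> 0" for t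
    proof -
      have "cmod (exp_poly_coeff z j t) \<le> t ^ j * exp (- Re z * t)"
        by (rule cmod_exp_poly_coeff_le[OF t])
      also have "exp (- Re z * t) = exp (- (Re z - min_real_part C) * t) * exp (- min_real_part C * t)"
        by (simp add: exp_add[symmetric] algebra_simps)
      also have "t ^ j * (exp (- (Re z - min_real_part C) * t) * exp (- min_real_part C * t))
          \<le> K * exp (- min_real_part C * t)"
        using mult_right_mono[OF K(2)[OF t], of "exp (- min_real_part C * t)"] by (simp add: mult.assoc)
      also have "\<dots> \<le> K * ?b t"
        using K(1) t by (intro mult_left_mono) (auto simp: distrib_right)
      finally show ?thesis .
    qed
    then show ?thesis by blast
  qed
  then obtain K where K: "\<And>z j t. z \<in> eigenvalues C \<Longrightarrow> j \<le> defect C z \<Longrightarrow> t \<ge> 0 \<Longrightarrow>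
      cmod (exp_poly_coeff z j t) \<le> K z j * ?b t"
    by metis
  define L where "L i = (\<Sum>z\<in>eigenvalues C. \<Sum>j<Suc (defect C z). K z j * cmod (Jordan_chain ?M z j (w z) $ i))" for i
  have "norm (matrix_exp ((- t) *\<^sub>R C) *v v) \<le> (\<Sum>i\<in>UNIV. L i) * ?b t" if t: "t \<ge> 0" for t
  proof -
    have "\<bar>(matrix_exp ((- t) *\<^sub>R C) *v v) $ i\<bar> \<le> L i * ?b t" for i
    proof -
      have "\<bar>(matrix_exp ((- t) *\<^sub>R C) *v v) $ i\<bar>
          \<le> cmod (\<Sum>z\<in>eigenvalues C. exp_poly_sum ?M z (defect C z) (w z) t $ i)"
        by (simp only: w vec_lambda_beta abs_Re_le_cmod)
      also have "\<dots> \<le> (\<Sum>z\<in>eigenvalues C. \<Sum>j<Suc (defect C z).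
          cmod (exp_poly_coeff z j t * Jordan_chain ?M z j (w z) $ i))"
        by (intro norm_sum[THEN order_trans] sum_mono)
           (simp add: exp_poly_sum_def sum_component norm_sum del: sum.lessThan_Suc)
      also have "\<dots> \<le> (\<Sum>z\<in>eigenvalues C. \<Sum>j<Suc (defect C z).
          (K z j * ?b t) * cmod (Jordan_chain ?M z j (w z) $ i))"
        unfolding norm_mult using K t by (intro sum_mono mult_right_mono) auto
      also have "\<dots> = L i * ?b t"
        unfolding L_def sum_distrib_right by (simp only: mult_ac)
      finally show ?thesis .
    qed
    then have "(\<Sum>i\<in>UNIV. \<bar>(matrix_exp ((- t) *\<^sub>R C) *v v) $ i\<bar>) \<le> (\<Sum>i\<in>UNIV. L i * ?b t)"
      by (rule sum_mono)
    then show ?thesis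
      using norm_le_l1_cart[of "matrix_exp ((- t) *\<^sub>R C) *v v"] by (simp add: sum_distrib_right)
  qed
  then show ?thesis by blast
qed

text \<open>Expanding v in unit vectors makes the constant uniform in v; the additional 1 in L keeps
  it positive.\<close>

lemma matrix_exp_decay:
  fixes C :: "real^'n^'n"
  obtains K where "K > 0" "\<And>t v. t \<ge> 0 \<Longrightarrow> norm (matrix_exp ((- t) *\<^sub>R C) *v v)
     \<le> K * ((1 + t ^ max_defect C) * exp (- min_real_part C * t)) * norm v"
proof -
  let ?b = "\<lambda>t. (1 + t ^ max_defect C) * exp (- min_real_part C * t)"
  obtain K where K: "\<And>v t. t \<ge> 0 \<Longrightarrow> norm (matrix_exp ((- t) *\<^sub>R C) *v v) \<le> K v * ?b t"
    using matrix_exp_vector_decay[of C] by metis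
  define L where "L = (\<Sum>i\<in>UNIV. \<bar>K (axis i 1)\<bar>) + 1"
  have "norm (matrix_exp ((- t) *\<^sub>R C) *v v) \<le> L * ?b t * norm v" if t: "t \<ge> 0" for t v
  proof -
    have b: "?b t \<ge> 0" using t by simp
    let ?E = "matrix_exp ((- t) *\<^sub>R C)"
    have "?E *v v = (\<Sum>i\<in>UNIV. (v $ i) *s (?E *v axis i 1))"
      by (subst basis_expansion[of v, symmetric]) (simp only: vec.sum vec.scale)
    then have "norm (?E *v v) \<le> (\<Sum>i\<in>UNIV. norm ((v $ i) *s (?E *v axis i 1)))"
      by (simp add: norm_sum)
    also have "\<dots> \<le> (\<Sum>i\<in>UNIV. norm v * (\<bar>K (axis i 1)\<bar> * ?b t))"
    proof (rule sum_mono)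
      fix i
      have "norm (?E *v axis i 1) \<le> \<bar>K (axis i 1)\<bar> * ?b t"
        using K[OF t, of "axis i 1"] mult_right_mono[OF abs_ge_self b, of "K (axis i 1)"] by linarith
      then show "norm ((v $ i) *s (?E *v axis i 1)) \<le> norm v * (\<bar>K (axis i 1)\<bar> * ?b t)"
        by (simp only: scalar_mult_eq_scaleR norm_scaleR)
           (intro mult_mono, auto simp: component_le_norm_cart)
    qed
    also have "\<dots> = (\<Sum>i\<in>UNIV. \<bar>K (axis i 1)\<bar>) * ?b t * norm v"
      by (simp add: sum_distrib_left sum_distrib_right mult_ac)
    also have "\<dots> \<le> L * ?b t * norm v"
      using b by (intro mult_right_mono) (auto simp: L_def)
    finally show ?thesis .
  qed
  moreover have "L > 0" by (auto simp: L_def intro!: add_nonneg_pos sum_nonneg)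
  ultimately show ?thesis using that by blast
qed

section \<open>The Lyapunov equation\<close>

lemma inner_matrix_vector_mult: "x \<bullet> (A *v y) = (transpose A *v x) \<bullet> y" for A :: "real^'n^'m"
  by (simp add: dot_lmul_matrix)

lemma norm_transpose_mult_le:
  fixes A :: "real^'n^'m"
  assumes "\<And>x. norm (A *v x) \<le> b * norm x" "b \<ge> 0"
  shows "norm (transpose A *v x) \<le> b * norm x"
proof (cases "transpose A *v x = 0")
  case False
  let ?y = "transpose A *v x"
  have "norm ?y * norm ?y = ?y \<bullet> ?y"
    by (simp only: power2_norm_eq_inner[symmetric] power2_eq_square)
  also have "\<dots> = x \<bullet> (A *v ?y)"
    by (simp only: inner_matrix_vector_mult)
  also have "\<dots> \<le> norm x * (b * norm ?y)"
    using norm_cauchy_schwarz[of x "A *v ?y"] mult_left_mono[OF assms(1)[of ?y] norm_ge_zero[of x]]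
    by linarith
  finally have "norm ?y * norm ?y \<le> (b * norm x) * norm ?y"
    by (simp add: mult_ac)
  then show ?thesis
    using False by simp
qed (use assms(2) in simp)

lemma matrix_eqI_inner:
  fixes A B :: "real^'n^'m"
  assumes "\<And>x y. x \<bullet> (A *v y) = x \<bullet> (B *v y)"
  shows "A = B"
  by (metis assms matrix_eq vector_eq_ldot)

lemma pos_def_matrix_inner_commute:
  "pos_def_matrix A \<Longrightarrow> x \<bullet> (A *v y) = y \<bullet> (A *v x)"
  by (metis inner_commute inner_matrix_vector_mult pos_def_matrix_def)

lemma pos_def_matrix_nonneg: "pos_def_matrix A \<Longrightarrow> 0 \<le> x \<bullet> (A *v x)"
  by (cases "x = 0") (auto simp: pos_def_matrix_def intro: less_imp_le)


locale fokker_planck =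
  fixes D C :: "real^'d^'d"
  assumes D: "pos_def_matrix D" and C: "positive_stable C"
begin

definition E :: "real \<Rightarrow> real^'d^'d" where
  "E t = matrix_exp ((- t) *\<^sub>R C)"

lemma E_0 [simp]: "E 0 = mat 1"
  by (simp add: E_def)

lemma min_real_part_pos: "min_real_part C > 0"
proof -
  have "min_real_part C \<in> Re ` eigenvalues C"
    unfolding min_real_part_def using finite_eigenvalues eigenvalues_nonempty by (intro Min_in) auto
  then show ?thesis
    using C by (auto simp: positive_stable_def)
qed

text \<open>The bound for ||E(t)|| up to a constant; entropies at large times are quadratic in the
  deviation of the kernel and decay like its square.\<close>

definition rate :: "real \<Rightarrow> real" where
  "rate t = (1 + t ^ max_defect C) * exp (- min_real_part C * t)"

lemma rate_nonneg: "t \<ge> 0 \<Longrightarrow> rate t \<ge> 0"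
  by (simp add: rate_def)

lemma rate_tendsto_0: "(rate \<longlongrightarrow> 0) at_top"
proof -
  have "((\<lambda>t. t ^ k * exp (- min_real_part C * t)) \<longlongrightarrow> 0) at_top" for k
  proof -
    have "((\<lambda>t. (1 / min_real_part C) ^ k * ((min_real_part C * t) ^ k / exp (min_real_part C * t))) \<longlongrightarrow>
        (1 / min_real_part C) ^ k * 0) at_top"
      using min_real_part_pos
      by (intro tendsto_mult tendsto_const filterlim_compose[OF tendsto_power_div_exp_0]
          filterlim_tendsto_pos_mult_at_top[OF tendsto_const] filterlim_ident) auto
    then show ?thesis
      using min_real_part_pos by (simp add: exp_minus field_simps power_mult_distrib)
  qed
  from tendsto_add[OF this[of 0] this[of "max_defect C"]] show ?thesis
    by (simp add: rate_def[abs_def] distrib_right)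
qed

lemma E_decay:
  "\<exists>c>0. \<forall>t\<ge>0. \<forall>v. norm (E t *v v) \<le> c * rate t * norm v \<and>
     norm (transpose (E t) *v v) \<le> c * rate t * norm v"
proof -
  obtain c where c: "c > 0" "\<And>t v. t \<ge> 0 \<Longrightarrow> norm (E t *v v) \<le> c * rate t * norm v"
    using matrix_exp_decay[of C] unfolding E_def rate_def by blast
  have "norm (transpose (E t) *v v) \<le> c * rate t * norm v" if "t \<ge> 0" for t v
    using c that by (intro norm_transpose_mult_le mult_nonneg_nonneg rate_nonneg) auto
  with c show ?thesis by blast
qed

lemma E_has_vector_derivative: "(E has_vector_derivative - (E t ** C)) (at t within S)"
proof -
  have "((\<lambda>t. matrix_exp (t *\<^sub>R (- C))) has_vector_derivative (- C) ** matrix_exp (t *\<^sub>R (- C))) (at t within S)"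
    by (rule matrix_exp_has_vector_derivative)
  moreover have "matrix_exp (t *\<^sub>R (- C)) = E t" for t
    by (simp add: E_def)
  moreover have "(- C) ** matrix_exp (t *\<^sub>R (- C)) = - (E t ** C)"
    using matrix_exp_commute[of "- C" t] matrix_mult_scaleR_right[of "E t" "-1" C] by (simp add: E_def)
  ultimately show ?thesis
    by (simp add: fun_eq_iff[symmetric] ext)
qed

lemma conjugate_has_vector_derivative:
  "((\<lambda>t. E t ** X ** transpose (E t)) has_vector_derivative
     - (E t ** (C ** X + X ** transpose C) ** transpose (E t))) (at t within S)"
proof -
  have bl: "bounded_linear (transpose :: real^'d^'d \<Rightarrow> _)"
    by (intro linear_conv_bounded_linear[THEN iffD1] linearI)
       (simp_all add: transpose_def vec_eq_iff)
  have neg: "- A ** B = - (A ** B)" "A ** - B = - (A ** B)" "transpose (- A) = - transpose A"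
    for A B :: "real^'d^'d"
    using matrix_mult_scaleR_left[of "-1" A B] matrix_mult_scaleR_right[of A "-1" B]
    by (simp_all add: transpose_def vec_eq_iff)
  have 1: "((\<lambda>t. E t ** X) has_vector_derivative - (E t ** C ** X)) (at t within S)"
    using bounded_bilinear.has_vector_derivative[OF bounded_bilinear_matrix_mult
        E_has_vector_derivative has_vector_derivative_const[of X], of t S]
    by (simp add: neg)
  have 2: "((\<lambda>t. transpose (E t)) has_vector_derivative - (transpose C ** transpose (E t))) (at t within S)"
    using bounded_linear.has_vector_derivative[OF bl E_has_vector_derivative[of t S]]
    by (simp add: neg matrix_transpose_mul)
  show ?thesis
    using bounded_bilinear.has_vector_derivative[OF bounded_bilinear_matrix_mult 1 2]
    by (simp add: neg matrix_add_ldistrib matrix_add_rdistrib matrix_mul_assoc algebra_simps)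
qed

lemma inner_conjugate: "x \<bullet> ((E t ** X ** transpose (E t)) *v y)
    = (transpose (E t) *v x) \<bullet> (X *v (transpose (E t) *v y))"
proof -
  have "(E t ** X ** transpose (E t)) *v y = E t *v (X *v (transpose (E t) *v y))"
    by (simp only: matrix_vector_mul_assoc matrix_mul_assoc)
  then show ?thesis
    by (simp only: inner_matrix_vector_mult[of x "E t"])
qed

lemma conjugate_tendsto_0: "((\<lambda>t. x \<bullet> ((E t ** X ** transpose (E t)) *v y)) \<longlongrightarrow> 0) at_top"
proof -
  obtain c where c: "\<forall>t\<ge>0. \<forall>v. norm (transpose (E t) *v v) \<le> c * rate t * norm v"
    using E_decay by blast
  have lim: "((\<lambda>t. transpose (E t) *v v) \<longlongrightarrow> 0) at_top" for v
  proof (rule Lim_null_comparison)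
    show "\<forall>\<^sub>F t in at_top. norm (transpose (E t) *v v) \<le> c * rate t * norm v"
      using eventually_ge_at_top[of 0] by eventually_elim (use c in blast)
    show "((\<lambda>t. c * rate t * norm v) \<longlongrightarrow> 0) at_top"
      by (intro tendsto_mult_left_zero tendsto_mult_right_zero rate_tendsto_0)
  qed
  have "((\<lambda>t. X *v (transpose (E t) *v y)) \<longlongrightarrow> X *v 0) at_top"
    by (intro bounded_linear.tendsto[OF matrix_vector_mul_bounded_linear] lim)
  then have "((\<lambda>t. (transpose (E t) *v x) \<bullet> (X *v (transpose (E t) *v y))) \<longlongrightarrow> 0 \<bullet> (X *v 0)) at_top"
    by (intro tendsto_inner lim)
  then show ?thesis by (simp add: inner_conjugate)
qed

text \<open>E X E^T has derivative -E (C X + X C^T) E^T = 0, so it keeps its value X from t = 0; on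
  the other hand it tends to 0.\<close>

lemma Lyapunov_kernel:
  assumes "C ** X + X ** transpose C = 0"
  shows "X = 0"
proof (rule matrix_eqI_inner)
  fix x y
  have "((\<lambda>t. E t ** X ** transpose (E t)) has_vector_derivative 0) (at t)" for t
    using conjugate_has_vector_derivative[of X t UNIV] assms by simp
  from zero_vector_derivative_imp_const[OF this, of _ 0]
  have "E t ** X ** transpose (E t) = X" for t
    by (simp add: transpose_mat)
  then have "((\<lambda>t. x \<bullet> (X *v y)) \<longlongrightarrow> 0) (at_top :: real filter)"
    using conjugate_tendsto_0[of x X y] by simp
  then show "x \<bullet> (X *v y) = x \<bullet> (0 *v y)"
    by (simp add: tendsto_const_iff)
qed

lemma Lyapunov_unique:
  assumes "C ** X + X ** transpose C = C ** Y + Y ** transpose C"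
  shows "X = Y"
proof -
  have "C ** (X - Y) + (X - Y) ** transpose C = 0"
    using assms matrix_add_ldistrib[of C "X - Y" Y] matrix_add_rdistrib[of "X - Y" Y "transpose C"]
    by (simp add: algebra_simps)
  then show ?thesis using Lyapunov_kernel[of "X - Y"] by simp
qed

text \<open>An injective linear endomorphism of a finite-dimensional space is onto. For Y = 2 D the
  solution is the classical improper integral of 2 E(s) D E(s)^T over s \<ge> 0.\<close>

lemma Lyapunov_solvable: "\<exists>X. C ** X + X ** transpose C = Y"
proof -
  let ?L = "\<lambda>X. C ** X + X ** transpose C"
  have lin: "linear ?L"
    by (rule linearI) (simp_all add: matrix_add_ldistrib matrix_add_rdistrib
        matrix_mult_scaleR_left matrix_mult_scaleR_right algebra_simps)
  have "inj ?L"
    using Lyapunov_unique by (intro injI)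
  then have "surj ?L"
    using lin by (simp add: linear_injective_imp_surjective)
  then obtain X where "Y = ?L X" by (rule surjE)
  then show ?thesis by (intro exI[of _ X]) (rule sym)
qed

text \<open>At first just some solution; symmetry, positivity and the identity with
  \<open>fp_K D C\<close> are then derived from the equation and its uniqueness.\<close>

definition K :: "real^'d^'d" where
  "K = (SOME X. C ** X + X ** transpose C = 2 *\<^sub>R D)"

lemma K_Lyapunov: "C ** K + K ** transpose C = 2 *\<^sub>R D"
  unfolding K_def by (rule someI_ex[OF Lyapunov_solvable])

text \<open>The transpose solves the same equation because D is symmetric.\<close>

lemma transpose_K: "transpose K = K"
proof (rule Lyapunov_unique)
  have tr: "transpose (A + B) = transpose A + transpose B" "transpose (c *\<^sub>R A) = c *\<^sub>R transpose A"
    for A B :: "real^'d^'d" and c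
    by (simp_all add: transpose_def vec_eq_iff)
  have "C ** transpose K + transpose K ** transpose C = transpose (C ** K + K ** transpose C)"
    by (simp add: tr(1) matrix_transpose_mul add.commute)
  also have "\<dots> = C ** K + K ** transpose C"
    using D by (simp add: K_Lyapunov tr(2) pos_def_matrix_def)
  finally show "C ** transpose K + transpose K ** transpose C = C ** K + K ** transpose C" .
qed

lemma K_form_has_derivative:
  "((\<lambda>t. x \<bullet> ((E t ** K ** transpose (E t)) *v x)) has_real_derivative
     - 2 * ((transpose (E t) *v x) \<bullet> (D *v (transpose (E t) *v x)))) (at t)"
proof -
  have bl: "bounded_linear (\<lambda>A :: real^'d^'d. x \<bullet> (A *v x))"
    by (intro bounded_linear_inner_right_comp
        bounded_bilinear.bounded_linear_left[OF bounded_bilinear_matrix_vector_mult])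
  have "x \<bullet> (- (E t ** (2 *\<^sub>R D) ** transpose (E t)) *v x)
      = - 2 * (x \<bullet> ((E t ** D ** transpose (E t)) *v x))"
    by (simp add: matrix_mult_scaleR_left matrix_mult_scaleR_right
        bounded_bilinear.minus_left[OF bounded_bilinear_matrix_vector_mult]
        bounded_bilinear.scaleR_left[OF bounded_bilinear_matrix_vector_mult])
  then show ?thesis
    using bounded_linear.has_vector_derivative[OF bl conjugate_has_vector_derivative[of K t UNIV]]
    by (simp add: K_Lyapunov inner_conjugate has_real_derivative_iff_has_vector_derivative)
qed

lemma K_form_antimono:
  "s \<le> t \<Longrightarrow> x \<bullet> ((E t ** K ** transpose (E t)) *v x) \<le> x \<bullet> ((E s ** K ** transpose (E s)) *v x)"
proof (rule DERIV_nonpos_imp_nonincreasing[of s t "\<lambda>t. x \<bullet> ((E t ** K ** transpose (E t)) *v x)"])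
  fix u
  show "\<exists>y. ((\<lambda>t. x \<bullet> ((E t ** K ** transpose (E t)) *v x)) has_real_derivative y) (at u) \<and> y \<le> 0"
    using K_form_has_derivative pos_def_matrix_nonneg[OF D] by force
qed

text \<open>The form is nonincreasing in t, and its derivative at 0 is -2 x . D x < 0; the strict
  drop right after 0 persists for all later times.\<close>

lemma K_form_strict:
  assumes "x \<noteq> 0" "t > 0"
  shows "x \<bullet> ((E t ** K ** transpose (E t)) *v x) < x \<bullet> (K *v x)"
proof -
  let ?h = "\<lambda>t. x \<bullet> ((E t ** K ** transpose (E t)) *v x)"
  have "- 2 * (x \<bullet> (D *v x)) < 0"
    using D assms(1) by (auto simp: pos_def_matrix_def)
  moreover have "(?h has_real_derivative - 2 * (x \<bullet> (D *v x))) (at 0)"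
    using K_form_has_derivative[of x 0] by (simp add: transpose_mat)
  ultimately obtain d where d: "d > 0" "\<And>h. h > 0 \<Longrightarrow> h < d \<Longrightarrow> ?h (0 + h) < ?h 0"
    using DERIV_neg_dec_right by blast
  have "?h t \<le> ?h (min t (d / 2))"
    by (rule K_form_antimono) simp
  also have "?h (min t (d / 2)) < ?h 0"
    using d(2)[of "min t (d / 2)"] d(1) assms(2) by simp
  finally show ?thesis by (simp add: transpose_mat)
qed

text \<open>The form of E(t) K E(t)^T decreases to 0, so it is nonnegative at t = 1, and its value
  at t = 0, the form of K, lies strictly above.\<close>

lemma K_pos_def: "pos_def_matrix K"
  unfolding pos_def_matrix_def
proof (intro conjI allI impI transpose_K)
  fix x :: "real^'d" assume x: "x \<noteq> 0"
  let ?h = "\<lambda>t. x \<bullet> ((E t ** K ** transpose (E t)) *v x)"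
  have "0 \<le> ?h 1"
  proof (rule tendsto_le[OF _ tendsto_const conjugate_tendsto_0[of x K x]])
    show "\<forall>\<^sub>F t in at_top. ?h t \<le> ?h 1"
      using eventually_ge_at_top[of "1 :: real"] by eventually_elim (rule K_form_antimono)
  qed simp
  also have "?h 1 < x \<bullet> (K *v x)"
    using x by (intro K_form_strict) auto
  finally show "0 < x \<bullet> (K *v x)" .
qed

section \<open>Covariances of the equilibrium and of the transition\<close>

lemma fp_K_eq: "fp_K D C = K"
  unfolding fp_K_def
proof (rule the_equality)
  show "pos_def_matrix K \<and> 2 *\<^sub>R D = C ** K + K ** transpose C"
    using K_pos_def K_Lyapunov by simp
  fix X assume "pos_def_matrix X \<and> 2 *\<^sub>R D = C ** X + X ** transpose C"
  then have "C ** X + X ** transpose C = C ** K + K ** transpose C"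
    using K_Lyapunov by simp
  then show "X = K" by (rule Lyapunov_unique)
qed

text \<open>By the Lyapunov equation, -(1/2) E K E^T is an antiderivative of the integrand E D
  E^T.\<close>

lemma fp_W_eq:
  assumes "t \<ge> 0"
  shows "fp_W D C t = K - E t ** K ** transpose (E t)"
proof -
  let ?F = "\<lambda>t. (- 1 / 2) *\<^sub>R (E t ** K ** transpose (E t))"
  have der: "(?F has_vector_derivative E s ** D ** transpose (E s)) (at s within S)" for s S
    using bounded_linear.has_vector_derivative[OF bounded_linear_scaleR_right
        conjugate_has_vector_derivative[of K s S], of "- 1 / 2"]
    by (simp add: K_Lyapunov matrix_mult_scaleR_left matrix_mult_scaleR_right)
  have "((\<lambda>s. E s ** D ** transpose (E s)) has_integral ?F t - ?F 0) {0..t}"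
    using assms der by (intro fundamental_theorem_of_calculus) auto
  then have "integral {0..t} (\<lambda>s. E s ** D ** transpose (E s)) = ?F t - ?F 0"
    by (rule integral_unique)
  moreover have "matrix_exp ((- s) *\<^sub>R C) ** D ** matrix_exp ((- s) *\<^sub>R transpose C)
      = E s ** D ** transpose (E s)" for s
    by (simp only: matrix_exp_transpose E_def)
  ultimately have "fp_W D C t = 2 *\<^sub>R (?F t - ?F 0)"
    unfolding fp_W_def by (simp only:)
  then show ?thesis
    by (simp add: scaleR_diff_right transpose_mat)
qed

lemma fp_W_pos_def:
  assumes "t > 0"
  shows "pos_def_matrix (fp_W D C t)"
proof -
  have "transpose (K - E t ** K ** transpose (E t)) = K - E t ** K ** transpose (E t)"
  proof -
    have "transpose (A - B) = transpose A - transpose B" for A B :: "real^'d^'d"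
      by (simp add: transpose_def vec_eq_iff)
    then show ?thesis
      by (simp add: matrix_transpose_mul transpose_K matrix_mul_assoc)
  qed
  then show ?thesis
    using K_form_strict assms
    by (simp add: pos_def_matrix_def fp_W_eq matrix_vector_mult_diff_rdistrib inner_diff_right)
qed

end

section \<open>Gaussian integrals\<close>

lemma nn_integral_lborel_add:
  fixes f :: "'a::euclidean_space \<Rightarrow> ennreal"
  assumes [measurable]: "f \<in> borel_measurable borel"
  shows "(\<integral>\<^sup>+x. f (x + c) \<partial>lborel) = (\<integral>\<^sup>+x. f x \<partial>lborel)"
proof -
  have "(\<integral>\<^sup>+x. f x \<partial>lborel) = (\<integral>\<^sup>+x. f x \<partial>distr lborel borel ((+) c))"
    by (simp add: lborel_distr_plus)
  also have "\<dots> = (\<integral>\<^sup>+x. f (x + c) \<partial>lborel)"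
    by (subst nn_integral_distr) (simp_all add: add.commute)
  finally show ?thesis ..
qed

text \<open>Averaging over translations by \<open>s e\<close> turns the shear into a translation, so that only Fubini
  is needed. (The change of variables theorems of the library require a well-ordered index type.)\<close>

lemma nn_integral_lborel_shear:
  fixes f :: "'a::euclidean_space \<Rightarrow> ennreal" and a :: "'a \<Rightarrow> real"
  assumes f [measurable]: "f \<in> borel_measurable borel"
    and a [measurable]: "a \<in> borel_measurable borel"
    and inv: "\<And>x s. a (x + s *\<^sub>R e) = a x"
  shows "(\<integral>\<^sup>+x. f (x + a x *\<^sub>R e) \<partial>lborel) = (\<integral>\<^sup>+x. f x \<partial>lborel)"
proof -
  let ?\<phi> = "indicator {0..1} :: real \<Rightarrow> ennreal"
  have \<phi>: "(\<integral>\<^sup>+s. ?\<phi> s \<partial>lborel) = 1" by simp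
  have [measurable]: "?\<phi> \<in> borel_measurable borel" by simp
  let ?I = "\<integral>\<^sup>+x. f (x + a x *\<^sub>R e) \<partial>lborel"
  have shift: "(\<integral>\<^sup>+x. f (x + (s + a x) *\<^sub>R e) \<partial>lborel) = ?I" for s
  proof -
    have "(\<integral>\<^sup>+x. f (x + a x *\<^sub>R e) \<partial>lborel) = (\<integral>\<^sup>+x. f ((x + s *\<^sub>R e) + a (x + s *\<^sub>R e) *\<^sub>R e) \<partial>lborel)"
      by (rule nn_integral_lborel_add[symmetric]) measurable
    then show ?thesis by (simp add: inv algebra_simps)
  qed
  have "?I = (\<integral>\<^sup>+s. ?\<phi> s * (\<integral>\<^sup>+x. f (x + (s + a x) *\<^sub>R e) \<partial>lborel) \<partial>lborel)"
    by (simp only: shift) (simp add: nn_integral_multc \<phi>)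
  also have "\<dots> = (\<integral>\<^sup>+s. \<integral>\<^sup>+x. ?\<phi> s * f (x + (s + a x) *\<^sub>R e) \<partial>lborel \<partial>lborel)"
    by (intro nn_integral_cong nn_integral_cmult[symmetric]) measurable
  also have "\<dots> = (\<integral>\<^sup>+x. \<integral>\<^sup>+s. ?\<phi> s * f (x + (s + a x) *\<^sub>R e) \<partial>lborel \<partial>lborel)"
    by (rule lborel_pair.Fubini') measurable
  also have "\<dots> = (\<integral>\<^sup>+x. \<integral>\<^sup>+s. ?\<phi> (s - a x) * f (x + s *\<^sub>R e) \<partial>lborel \<partial>lborel)"
  proof (rule nn_integral_cong)
    fix x
    show "(\<integral>\<^sup>+s. ?\<phi> s * f (x + (s + a x) *\<^sub>R e) \<partial>lborel) = (\<integral>\<^sup>+s. ?\<phi> (s - a x) * f (x + s *\<^sub>R e) \<partial>lborel)"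
      by (subst nn_integral_lborel_add[of "\<lambda>s. ?\<phi> (s - a x) * f (x + s *\<^sub>R e)" "a x", symmetric]) simp_all
  qed
  also have "\<dots> = (\<integral>\<^sup>+s. \<integral>\<^sup>+x. ?\<phi> (s - a x) * f (x + s *\<^sub>R e) \<partial>lborel \<partial>lborel)"
    by (rule lborel_pair.Fubini') measurable
  also have "\<dots> = (\<integral>\<^sup>+s. \<integral>\<^sup>+x. ?\<phi> (s - a x) * f x \<partial>lborel \<partial>lborel)"
  proof (rule nn_integral_cong)
    fix s
    show "(\<integral>\<^sup>+x. ?\<phi> (s - a x) * f (x + s *\<^sub>R e) \<partial>lborel) = (\<integral>\<^sup>+x. ?\<phi> (s - a x) * f x \<partial>lborel)"
      by (subst nn_integral_lborel_add[of "\<lambda>x. ?\<phi> (s - a x) * f x" "s *\<^sub>R e", symmetric])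
         (simp_all add: inv)
  qed
  also have "\<dots> = (\<integral>\<^sup>+x. \<integral>\<^sup>+s. ?\<phi> (s - a x) * f x \<partial>lborel \<partial>lborel)"
    by (rule lborel_pair.Fubini') measurable
  also have "\<dots> = (\<integral>\<^sup>+x. f x \<partial>lborel)"
  proof (rule nn_integral_cong)
    fix x
    have "(\<integral>\<^sup>+s. ?\<phi> (s - a x) * f x \<partial>lborel) = (\<integral>\<^sup>+s. ?\<phi> (s - a x) \<partial>lborel) * f x"
      by (rule nn_integral_multc) measurable
    also have "(\<integral>\<^sup>+s. ?\<phi> (s - a x) \<partial>lborel) = 1"
      using nn_integral_lborel_add[of ?\<phi> "- a x"] by (simp add: \<phi>)
    finally show "(\<integral>\<^sup>+s. ?\<phi> (s - a x) * f x \<partial>lborel) = f x" by simp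
  qed
  finally show ?thesis .
qed

lemma Basis_cart: "Basis = range (\<lambda>i. axis i 1 :: real^'n)"
  by (auto simp: Basis_vec_def)

lemma sum_Basis_cart: "(\<Sum>b\<in>Basis. f b) = (\<Sum>i\<in>UNIV. f (axis i 1 :: real^'n))"
  unfolding Basis_cart by (subst sum.reindex) (auto simp: inj_on_def axis_eq_axis)

lemma prod_Basis_cart: "(\<Prod>b\<in>Basis. f b) = (\<Prod>i\<in>UNIV. f (axis i 1 :: real^'n))"
  unfolding Basis_cart by (subst prod.reindex) (auto simp: inj_on_def axis_eq_axis)

text \<open>Boxes determine Lebesgue measure, and the preimage of a box under a permutation of
  coordinates is a box with the same side lengths in another order.\<close>

lemma lborel_distr_permute:
  fixes \<sigma> :: "'n::finite \<Rightarrow> 'n"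
  assumes "bij \<sigma>"
  shows "distr lborel borel (\<lambda>x :: real^'n. \<chi> i. x $ \<sigma> i) = lborel"
proof (rule lborel_eqI[symmetric])
  fix l u :: "real^'n"
  assume lu: "\<And>b. b \<in> Basis \<Longrightarrow> l \<bullet> b \<le> u \<bullet> b"
  let ?T = "\<lambda>x :: real^'n. \<chi> i. x $ \<sigma> i" and ?l = "\<chi> i. l $ inv \<sigma> i" and ?u = "\<chi> i. u $ inv \<sigma> i"
  have le: "l $ i \<le> u $ i" for i
    using lu[of "axis i 1"] by (simp add: inner_axis axis_in_Basis_iff)
  have "?T -` box l u = box ?l ?u"
  proof (rule set_eqI)
    fix x
    have "(\<forall>i. Q (\<sigma> i)) \<longleftrightarrow> (\<forall>i. Q i)" for Q
      using assms by (metis bij_pointE)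
    from this[of "\<lambda>i. l $ inv \<sigma> i < x $ i \<and> x $ i < u $ inv \<sigma> i"]
    show "x \<in> ?T -` box l u \<longleftrightarrow> x \<in> box ?l ?u"
      using assms by (simp add: mem_box_cart bij_is_inj)
  qed
  moreover have [measurable]: "?T \<in> borel_measurable borel"
    by (intro borel_measurable_continuous_onI continuous_intros)
  ultimately have "emeasure (distr lborel borel ?T) (box l u) = emeasure lborel (box ?l ?u)"
    by (simp add: emeasure_distr)
  also have "\<dots> = (\<Prod>b\<in>Basis. (?u - ?l) \<bullet> b)"
    using le by (intro emeasure_lborel_box) (auto simp: Basis_vec_def inner_axis)
  also have "(\<Prod>b\<in>Basis. (?u - ?l) \<bullet> b) = (\<Prod>i\<in>UNIV. u $ inv \<sigma> i - l $ inv \<sigma> i)"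
    by (simp add: prod_Basis_cart inner_axis)
  also have "\<dots> = (\<Prod>i\<in>UNIV. u $ i - l $ i)"
    by (rule prod.reindex_bij_betw[OF bij_imp_bij_inv[OF assms]])
  also have "\<dots> = (\<Prod>b\<in>Basis. (u - l) \<bullet> b)"
    by (simp add: prod_Basis_cart inner_axis)
  finally show "emeasure (distr lborel borel ?T) (box l u) = (\<Prod>b\<in>Basis. (u - l) \<bullet> b)" .
qed simp

lemma borel_measurable_matrix_vector_mult [measurable]:
  "((*v) A :: real^'n \<Rightarrow> real^'m) \<in> borel_measurable borel"
  by (intro borel_measurable_continuous_onI linear_continuous_on matrix_vector_mul_bounded_linear)

text \<open>Induction over products of elementary matrices: a zero row contradicts det A \<noteq> 0,
  diagonal matrices scale, swaps permute coordinates, and adding a multiple of one coordinate to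
  another is a shear. The determinant condition and the quantifier over f belong to the induction
  predicate, since the product case uses the hypothesis for B with x |-> f (A x).\<close>

lemma nn_integral_lborel_matrix:
  fixes A :: "real^'n^'n"
  shows "det A \<noteq> 0 \<longrightarrow> (\<forall>f \<in> borel_measurable borel.
    ennreal \<bar>det A\<bar> * (\<integral>\<^sup>+x. f (A *v x) \<partial>lborel) = (\<integral>\<^sup>+x. f x \<partial>lborel))"
proof (rule induct_matrix_elementary[where A = A], goal_cases mult zero_row diagonal swap1 idplus)
  case (mult A B)
  show ?case
  proof (intro impI ballI)
    fix f :: "real^'n \<Rightarrow> ennreal"
    assume det: "det (A ** B) \<noteq> 0" and f [measurable]: "f \<in> borel_measurable borel"
    have fA: "(\<lambda>x. f (A *v x)) \<in> borel_measurable borel" by measurable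
    have "ennreal \<bar>det B\<bar> * (\<integral>\<^sup>+x. f (A *v (B *v x)) \<partial>lborel) = (\<integral>\<^sup>+x. f (A *v x) \<partial>lborel)"
    proof -
      have "\<forall>f \<in> borel_measurable borel. ennreal \<bar>det B\<bar> * (\<integral>\<^sup>+x. f (B *v x) \<partial>lborel) = (\<integral>\<^sup>+x. f x \<partial>lborel)"
        using mult(2) det by (simp add: det_mul)
      from bspec[OF this fA] show ?thesis .
    qed
    moreover have "ennreal \<bar>det A\<bar> * (\<integral>\<^sup>+x. f (A *v x) \<partial>lborel) = (\<integral>\<^sup>+x. f x \<partial>lborel)"
      using mult(1) det f by (simp add: det_mul)
    ultimately show "ennreal \<bar>det (A ** B)\<bar> * (\<integral>\<^sup>+x. f ((A ** B) *v x) \<partial>lborel) = (\<integral>\<^sup>+x. f x \<partial>lborel)"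
      by (simp add: det_mul abs_mult ennreal_mult' matrix_vector_mul_assoc[symmetric] mult.assoc)
  qed
next
  case (zero_row A i)
  then show ?case by (simp add: det_zero_row)
next
  case (diagonal A)
  show ?case
  proof (intro impI ballI)
    fix f :: "real^'n \<Rightarrow> ennreal"
    assume det: "det A \<noteq> 0" and f [measurable]: "f \<in> borel_measurable borel"
    have detA: "det A = (\<Prod>i\<in>UNIV. A $ i $ i)"
      using diagonal by (rule det_diagonal)
    have Ax: "(A *v x) $ i = A $ i $ i * x $ i" for x i
    proof -
      have "(A *v x) $ i = (\<Sum>j\<in>UNIV. if j = i then A $ i $ i * x $ i else 0)"
        unfolding matrix_vector_mult_def vec_lambda_beta using diagonal
        by (intro sum.cong) auto
      then show ?thesis by simp
    qed
    define c where "c b = b \<bullet> (A *v b)" for b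
    have c: "c (axis i 1) = A $ i $ i" for i
      by (simp add: c_def inner_axis' Ax)
    have T: "(\<Sum>j\<in>Basis. (c j * (x \<bullet> j)) *\<^sub>R j) = A *v x" for x
    proof -
      have "(\<Sum>j\<in>Basis. (c j * (x \<bullet> j)) *\<^sub>R j) = (\<Sum>i\<in>UNIV. ((A *v x) $ i) *s axis i 1)"
        by (simp only: sum_Basis_cart c Ax scalar_mult_eq_scaleR) (simp add: inner_axis)
      then show ?thesis by (simp only: basis_expansion)
    qed
    have "lborel = density (distr lborel borel (\<lambda>x. 0 + (\<Sum>j\<in>Basis. (c j * (x \<bullet> j)) *\<^sub>R j)))
        (\<lambda>_. (\<Prod>j\<in>Basis. \<bar>c j\<bar>))"
      using det by (intro lborel_affine_euclidean) (auto simp: Basis_cart c detA)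
    moreover have "(\<Prod>j\<in>Basis. \<bar>c j\<bar>) = \<bar>det A\<bar>"
      by (simp add: prod_Basis_cart c detA abs_prod)
    ultimately have "lborel = density (distr lborel borel ((*v) A)) (\<lambda>_. ennreal \<bar>det A\<bar>)"
      by (simp add: T)
    then have "(\<integral>\<^sup>+x. f x \<partial>lborel) = (\<integral>\<^sup>+x. f x \<partial>density (distr lborel borel ((*v) A)) (\<lambda>_. ennreal \<bar>det A\<bar>))"
      by simp
    also have "\<dots> = ennreal \<bar>det A\<bar> * (\<integral>\<^sup>+x. f (A *v x) \<partial>lborel)"
      by (simp add: nn_integral_density nn_integral_distr nn_integral_cmult)
    finally show "ennreal \<bar>det A\<bar> * (\<integral>\<^sup>+x. f (A *v x) \<partial>lborel) = (\<integral>\<^sup>+x. f x \<partial>lborel)" ..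
  qed
next
  case (swap1 m n)
  let ?\<sigma> = "Transposition.transpose m n" and ?A = "\<chi> i j. (mat 1 :: real^'n^'n) $ i $ Transposition.transpose m n j"
  have \<sigma>: "?\<sigma> permutes UNIV" by (rule permutes_swap_id) auto
  have "\<bar>det ?A\<bar> = 1"
    using det_permute_columns[OF \<sigma>, of "mat 1 :: real^'n^'n"] by (auto simp: sign_def)
  moreover have "(?A *v x) = (\<chi> i. x $ ?\<sigma> i)" for x :: "real^'n"
  proof -
    have "(?A *v x) $ i = (\<Sum>j\<in>UNIV. if j = ?\<sigma> i then x $ j else 0)" for i
      unfolding matrix_vector_mult_def vec_lambda_beta
      by (intro sum.cong) (auto simp: mat_def)
    then show ?thesis by (simp add: vec_eq_iff)
  qed
  moreover have "(\<integral>\<^sup>+x. f (\<chi> i. x $ ?\<sigma> i) \<partial>lborel) = (\<integral>\<^sup>+x. f x \<partial>lborel)"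
    if [measurable]: "f \<in> borel_measurable borel" for f :: "real^'n \<Rightarrow> ennreal"
  proof -
    have [measurable]: "(\<lambda>x :: real^'n. \<chi> i. x $ ?\<sigma> i) \<in> borel_measurable borel"
      by (intro borel_measurable_continuous_onI continuous_intros)
    have "(\<integral>\<^sup>+x. f x \<partial>lborel) = (\<integral>\<^sup>+x. f x \<partial>distr lborel borel (\<lambda>x. \<chi> i. x $ ?\<sigma> i))"
      by (simp add: lborel_distr_permute)
    then show ?thesis by (simp add: nn_integral_distr)
  qed
  ultimately show ?case by simp
next
  case (idplus m n c)
  let ?A = "(\<chi> i j. if i = m \<and> j = n then c else of_bool (i = j)) :: real^'n^'n"
  have A: "?A *v x = x + (c * x $ n) *\<^sub>R axis m 1" for x
  proof -
    have "(?A *v x) $ i = x $ i + (if i = m then c * x $ n else 0)" for i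
    proof (cases "i = m")
      case True
      have "(?A *v x) $ i = (\<Sum>j\<in>UNIV. (if j = n then c * x $ n else 0) + (if j = m then x $ m else 0))"
        unfolding matrix_vector_mult_def vec_lambda_beta using True idplus
        by (intro sum.cong) auto
      then show ?thesis using True by (simp add: sum.distrib)
    next
      case False
      have "(?A *v x) $ i = (\<Sum>j\<in>UNIV. if j = i then x $ i else 0)"
        unfolding matrix_vector_mult_def vec_lambda_beta using False
        by (intro sum.cong) auto
      then show ?thesis using False by simp
    qed
    then show ?thesis by (simp add: vec_eq_iff axis_def)
  qed
  have "det ?A = 1"
  proof -
    have "?A = (\<chi> k. if k = m then row m (mat 1) + c *s row n (mat 1) else row k (mat 1))"
      using idplus by (auto simp: vec_eq_iff row_def mat_def)
    then show ?thesis using det_row_operation[OF idplus, of "mat 1" c] by simp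
  qed
  moreover have "(\<integral>\<^sup>+x. f (x + (c * x $ n) *\<^sub>R axis m 1) \<partial>lborel) = (\<integral>\<^sup>+x. f x \<partial>lborel)"
    if "f \<in> borel_measurable borel" for f :: "real^'n \<Rightarrow> ennreal"
  proof (rule nn_integral_lborel_shear[OF that])
    show "(\<lambda>x :: real^'n. c * x $ n) \<in> borel_measurable borel"
      by (intro borel_measurable_continuous_onI continuous_intros)
  qed (use idplus in \<open>auto simp: axis_def\<close>)
  ultimately show ?case by (simp add: A)
qed

section \<open>Gaussian integrals and their normalisation\<close>

lemma nn_integral_std_gaussian_1d:
  "(\<integral>\<^sup>+x. ennreal (exp (- (1/2) * x\<^sup>2)) \<partial>lborel) = ennreal (sqrt (2 * pi))"
proof -
  interpret prob_space "density lborel std_normal_density"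
    by (rule prob_space_normal_density) simp
  have "(\<integral>\<^sup>+x. ennreal (std_normal_density x) \<partial>lborel) = 1"
    using emeasure_space_1 by (simp add: emeasure_density)
  then have "ennreal (sqrt (2 * pi)) * (\<integral>\<^sup>+x. ennreal (std_normal_density x) \<partial>lborel) = ennreal (sqrt (2 * pi))"
    by simp
  then have "(\<integral>\<^sup>+x. ennreal (sqrt (2 * pi)) * ennreal (std_normal_density x) \<partial>lborel) = ennreal (sqrt (2 * pi))"
    by (simp add: nn_integral_cmult)
  moreover have "ennreal (sqrt (2 * pi)) * ennreal (std_normal_density x) = ennreal (exp (- (1/2) * x\<^sup>2))" for x
    by (simp add: ennreal_mult'[symmetric] std_normal_density_def)
  ultimately show ?thesis by simp
qed

lemma nn_integral_std_gaussian:
  "(\<integral>\<^sup>+x. ennreal (exp (- (1/2) * (x \<bullet> x))) \<partial>(lborel :: (real^'n) measure))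
     = ennreal ((2 * pi) powr (real CARD('n) / 2))"
proof -
  have "(\<integral>\<^sup>+x. ennreal (exp (- (1/2) * (x \<bullet> x))) \<partial>(lborel :: (real^'n) measure))
      = (\<integral>\<^sup>+x. (\<Prod>b\<in>Basis. ennreal (exp (- (1/2) * (x \<bullet> b)\<^sup>2))) \<partial>(lborel :: (real^'n) measure))"
  proof (intro nn_integral_cong)
    fix x :: "real^'n"
    have "x \<bullet> x = (\<Sum>b\<in>Basis. (x \<bullet> b)\<^sup>2)"
      by (subst euclidean_inner) (simp add: power2_eq_square)
    then show "ennreal (exp (- (1/2) * (x \<bullet> x))) = (\<Prod>b\<in>Basis. ennreal (exp (- (1/2) * (x \<bullet> b)\<^sup>2)))"
      by (simp only: sum_distrib_left) (simp add: exp_sum prod_ennreal)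
  qed
  also have "\<dots> = (\<Prod>b\<in>(Basis :: (real^'n) set). ennreal (sqrt (2 * pi)))"
    by (subst nn_integral_lborel_prod) (simp_all add: nn_integral_std_gaussian_1d[simplified])
  also have "\<dots> = ennreal (sqrt (2 * pi) ^ CARD('n))"
    by (simp add: ennreal_power)
  also have "sqrt (2 * pi) ^ CARD('n) = (2 * pi) powr (real CARD('n) / 2)"
    by (simp add: powr_half_sqrt[symmetric] powr_realpow[symmetric] powr_powr)
  finally show ?thesis .
qed

text \<open>The columns form an orthonormal basis for the inner product x . A y. It is taken as an
  orthonormal set of largest size: such sets are independent, which bounds their size, and a vector
  outside the span would yield one more element by a Gram-Schmidt step.\<close>

lemma pos_def_matrix_orthonormal_columns:
  fixes A :: "real^'n^'n"
  assumes A: "pos_def_matrix A"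
  obtains P :: "real^'n^'n" where "transpose P ** A ** P = mat 1"
proof -
  define Q where "Q S \<longleftrightarrow> finite S \<and> (\<forall>u\<in>S. \<forall>v\<in>S. u \<bullet> (A *v v) = (if u = v then 1 else 0))"
    for S :: "(real^'n) set"
  have comm: "u \<bullet> (A *v v) = v \<bullet> (A *v u)" for u v
    using A by (rule pos_def_matrix_inner_commute)
  have indep: "independent S" if S: "Q S" for S
  proof (rule independent_if_scalars_zero)
    show "finite S" using S by (simp add: Q_def)
    fix f v assume eq: "(\<Sum>x\<in>S. f x *\<^sub>R x) = 0" and v: "v \<in> S"
    have "0 = v \<bullet> (A *v (\<Sum>x\<in>S. f x *\<^sub>R x))" by (simp add: eq)
    also have "\<dots> = (\<Sum>x\<in>S. f x * (v \<bullet> (A *v x)))"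
      by (simp add: linear_sum[OF matrix_vector_mul_linear] matrix_vector_mult_scaleR inner_sum_right)
    also have "\<dots> = (\<Sum>x\<in>S. if x = v then f v else 0)"
      using S v by (intro sum.cong) (auto simp: Q_def)
    finally show "f v = 0" using S v by (simp add: Q_def)
  qed
  have "Q {}" by (simp add: Q_def)
  moreover have "\<forall>S. Q S \<longrightarrow> card S \<le> CARD('n)"
    using independent_bound[OF indep] by simp
  ultimately obtain S where S: "Q S" and max: "\<And>T. Q T \<Longrightarrow> card T \<le> card S"
    using ex_has_greatest_nat[of Q "{}" card "Suc CARD('n)"] by (auto simp: less_Suc_eq_le)
  have "span S = UNIV"
  proof (rule ccontr)
    assume "span S \<noteq> UNIV"
    then obtain v where v: "v \<notin> span S" by blast
    define w where "w = v - (\<Sum>u\<in>S. (u \<bullet> (A *v v)) *\<^sub>R u)"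
    define e where "e = (1 / sqrt (w \<bullet> (A *v w))) *\<^sub>R w"
    have "(\<Sum>u\<in>S. (u \<bullet> (A *v v)) *\<^sub>R u) \<in> span S"
      by (intro span_sum span_scale span_base)
    then have "w \<noteq> 0" using v by (auto simp: w_def)
    then have pos: "w \<bullet> (A *v w) > 0" using A by (simp add: pos_def_matrix_def)
    have orth: "u \<bullet> (A *v w) = 0" if u: "u \<in> S" for u
    proof -
      have "u \<bullet> (A *v w) = u \<bullet> (A *v v) - (\<Sum>x\<in>S. (x \<bullet> (A *v v)) * (u \<bullet> (A *v x)))"
        by (simp add: w_def matrix_vector_mult_diff_distrib inner_diff_right
            linear_sum[OF matrix_vector_mul_linear] matrix_vector_mult_scaleR inner_sum_right)
      also have "(\<Sum>x\<in>S. (x \<bullet> (A *v v)) * (u \<bullet> (A *v x))) = (\<Sum>x\<in>S. if x = u then u \<bullet> (A *v v) else 0)"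
        using S u by (intro sum.cong) (auto simp: Q_def)
      finally show ?thesis using S u by (simp add: Q_def)
    qed
    have e1: "e \<bullet> (A *v e) = 1"
      using pos by (simp add: e_def matrix_vector_mult_scaleR)
    have e2: "u \<bullet> (A *v e) = 0" "e \<bullet> (A *v u) = 0" if "u \<in> S" for u
      using orth[OF that] comm[of u e] by (simp_all add: e_def matrix_vector_mult_scaleR)
    have "e \<notin> S" using e1 e2 by force
    moreover have "Q (insert e S)"
      using S e1 e2 \<open>e \<notin> S\<close> by (auto simp: Q_def)
    ultimately show False using max[of "insert e S"] S by (simp add: Q_def)
  qed
  then have "card S = CARD('n)"
    using indep[OF S] by (metis dim_eq_card_independent dim_span dim_UNIV DIM_cart DIM_real mult.right_neutral)
  then obtain b where b: "bij_betw b (UNIV :: 'n set) S"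
    using S by (metis Q_def finite_class.finite_UNIV finite_same_card_bij)
  define P :: "real^'n^'n" where "P = (\<chi> i j. b j $ i)"
  have "(transpose P ** A ** P) $ i $ j = mat 1 $ i $ j" for i j
  proof -
    have P: "P *v axis j 1 = b j" for j
      by (simp add: matrix_vector_mult_basis column_def P_def)
    have "(transpose P ** A ** P) $ i $ j = axis i 1 \<bullet> ((transpose P ** A ** P) *v axis j 1)"
      by (simp add: matrix_vector_mult_basis inner_axis' column_def)
    also have "(transpose P ** A ** P) *v axis j 1 = transpose P *v (A *v (P *v axis j 1))"
      by (simp only: matrix_vector_mul_assoc matrix_mul_assoc)
    also have "axis i 1 \<bullet> \<dots> = b i \<bullet> (A *v b j)"
      by (simp only: inner_matrix_vector_mult[of _ "transpose P"] transpose_transpose P)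
    also have "\<dots> = (if i = j then 1 else 0)"
      using S b by (auto simp: Q_def bij_betw_def inj_on_def)
    finally show ?thesis by (simp add: mat_def)
  qed
  then have "transpose P ** A ** P = mat 1" by (simp add: vec_eq_iff)
  then show ?thesis using that by blast
qed

text \<open>Substituting P x with P^T A P = I turns the form into x . x, and det(P)^2 det A = 1
  gives both the sign of det A and the Jacobian.\<close>

lemma nn_integral_gaussian:
  fixes A :: "real^'n^'n"
  assumes A: "pos_def_matrix A"
  shows "det A > 0" and
    "(\<integral>\<^sup>+x. ennreal (exp (- (1/2) * (x \<bullet> (A *v x)))) \<partial>lborel)
       = ennreal ((2 * pi) powr (real CARD('n) / 2) / sqrt (det A))"
proof -
  obtain P :: "real^'n^'n" where P: "transpose P ** A ** P = mat 1"
    using pos_def_matrix_orthonormal_columns[OF A] by blast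
  have "det (transpose P ** A ** P) = 1" by (simp add: P)
  then have detP: "(det P)\<^sup>2 * det A = 1" by (simp add: det_mul power2_eq_square mult_ac)
  then have P0: "det P \<noteq> 0" by auto
  show det: "det A > 0"
    using detP P0 by (metis zero_less_mult_pos zero_less_one zero_less_power2)
  have absP: "\<bar>det P\<bar> = 1 / sqrt (det A)"
  proof -
    have "(det P)\<^sup>2 = 1 / det A" using detP det by (simp add: field_simps)
    then have "sqrt ((det P)\<^sup>2) = sqrt (1 / det A)" by simp
    then show ?thesis by (simp add: real_sqrt_divide)
  qed
  have form: "(P *v x) \<bullet> (A *v (P *v x)) = x \<bullet> x" for x
  proof -
    have "x \<bullet> x = x \<bullet> ((transpose P ** A ** P) *v x)" by (simp add: P)
    also have "(transpose P ** A ** P) *v x = transpose P *v (A *v (P *v x))"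
      by (simp only: matrix_vector_mul_assoc matrix_mul_assoc)
    finally show ?thesis
      by (simp only: inner_matrix_vector_mult[of x "transpose P"] transpose_transpose)
  qed
  have "(\<integral>\<^sup>+x. ennreal (exp (- (1/2) * (x \<bullet> (A *v x)))) \<partial>lborel)
      = ennreal \<bar>det P\<bar> * (\<integral>\<^sup>+x. ennreal (exp (- (1/2) * ((P *v x) \<bullet> (A *v (P *v x))))) \<partial>lborel)"
  proof -
    have "(\<lambda>x. ennreal (exp (- (1/2) * (x \<bullet> (A *v x))))) \<in> borel_measurable borel" by measurable
    from bspec[OF mp[OF nn_integral_lborel_matrix P0] this] show ?thesis ..
  qed
  also have "\<dots> = ennreal (1 / sqrt (det A)) * ennreal ((2 * pi) powr (real CARD('n) / 2))"
    by (simp only: form nn_integral_std_gaussian absP)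
  also have "\<dots> = ennreal ((2 * pi) powr (real CARD('n) / 2) / sqrt (det A))"
    using det by (simp add: ennreal_mult'[symmetric])
  finally show "(\<integral>\<^sup>+x. ennreal (exp (- (1/2) * (x \<bullet> (A *v x)))) \<partial>lborel)
       = ennreal ((2 * pi) powr (real CARD('n) / 2) / sqrt (det A))" .
qed

lemma pos_def_matrix_inverse:
  fixes W :: "real^'n^'n"
  assumes W: "pos_def_matrix W"
  shows "W ** matrix_inv W = mat 1" "matrix_inv W ** W = mat 1" "pos_def_matrix (matrix_inv W)"
    "det (matrix_inv W) = 1 / det W"
proof -
  have inv: "invertible W"
    using nn_integral_gaussian(1)[OF W] by (simp add: invertible_det_nz)
  show 1: "W ** matrix_inv W = mat 1" and 2: "matrix_inv W ** W = mat 1"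
    using someI_ex[OF inv[unfolded invertible_def]] by (simp_all add: matrix_inv_def)
  have sym: "transpose W = W" using W by (simp add: pos_def_matrix_def)
  have "transpose (matrix_inv W) ** W = mat 1"
    using arg_cong[OF 1, of transpose] by (simp add: matrix_transpose_mul sym transpose_mat)
  then have "transpose (matrix_inv W) = matrix_inv W"
    by (metis 1 matrix_mul_assoc matrix_mul_lid matrix_mul_rid)
  moreover have "0 < x \<bullet> (matrix_inv W *v x)" if "x \<noteq> 0" for x
  proof -
    let ?y = "matrix_inv W *v x"
    have x: "W *v ?y = x" by (simp add: matrix_vector_mul_assoc 1)
    then have "?y \<noteq> 0" using that by auto
    then have "0 < ?y \<bullet> (W *v ?y)" using W by (simp add: pos_def_matrix_def)
    then show ?thesis by (simp only: x) (simp add: inner_commute)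
  qed
  ultimately show "pos_def_matrix (matrix_inv W)" by (simp add: pos_def_matrix_def)
  have "det W * det (matrix_inv W) = 1"
    using arg_cong[OF 1, of det] by (simp add: det_mul)
  then show "det (matrix_inv W) = 1 / det W"
    by (metis mult_zero_left nonzero_eq_divide_eq mult.commute zero_neq_one)
qed

lemma nn_integral_gaussian_weight:
  fixes W :: "real^'n^'n"
  assumes W: "pos_def_matrix W"
  shows "(\<integral>\<^sup>+x. ennreal (gaussian_weight W x) \<partial>lborel)
     = ennreal ((2 * pi) powr (real CARD('n) / 2) * sqrt (det W))"
  unfolding gaussian_weight_def
  using nn_integral_gaussian(2)[OF pos_def_matrix_inverse(3)[OF W]]
  by (simp add: pos_def_matrix_inverse(4)[OF W] real_sqrt_divide)

section \<open>Entropies under kernels with an invariant density\<close>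

text \<open>Young's inequality for y and a^(p-1) with the conjugate exponents p and p/(p-1),
  rearranged; it includes the endpoints a = 0 and y = 0.\<close>

lemma powr_ge_tangent:
  fixes p :: real
  assumes p: "p > 1" and a: "a \<ge> 0" and y: "y \<ge> 0"
  shows "a powr p + p * a powr (p - 1) * (y - a) \<le> y powr p"
proof -
  have "y * a powr (p - 1) \<le> y powr p / p + (a powr (p - 1)) powr (p / (p - 1)) / (p / (p - 1))"
    using p y by (intro Youngs_inequality) (auto simp: field_simps)
  also have "(a powr (p - 1)) powr (p / (p - 1)) = a powr p"
    using p by (simp add: powr_powr)
  finally have "p * (y * a powr (p - 1)) \<le> p * (y powr p / p + a powr p / (p / (p - 1)))"
    using p by (intro mult_left_mono) auto
  also have "\<dots> = y powr p + (p - 1) * a powr p"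
    using p by (simp add: field_simps)
  finally have "p * (y * a powr (p - 1)) \<le> y powr p + (p - 1) * a powr p" .
  moreover have "a * a powr (p - 1) = a powr p"
    using a powr_mult_base[of a "p - 1"] by simp
  ultimately show ?thesis
    by (simp add: algebra_simps)
qed

text \<open>The slope is the derivative of \<open>psi p\<close> at a. This supporting line is the
  form of convexity that Jensen's inequality uses.\<close>

lemma psi_ge_tangent:
  assumes p: "p > 1" and a: "a \<ge> 0" and y: "y \<ge> 0"
  shows "psi p a + (a powr (p - 1) - 1) / (p - 1) * (y - a) \<le> psi p y"
proof -
  have "psi p a + (a powr (p - 1) - 1) / (p - 1) * (y - a)
      = (a powr p + p * a powr (p - 1) * (y - a) - p * (y - 1) - 1) / (p * (p - 1))"
    using p by (simp add: psi_def divide_simps) (simp add: algebra_simps)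
  also have "\<dots> \<le> psi p y"
    unfolding psi_def using powr_ge_tangent[OF assms] p
    by (intro divide_right_mono) auto
  finally show ?thesis .
qed

lemma psi_nonneg: "p > 1 \<Longrightarrow> y \<ge> 0 \<Longrightarrow> psi p y \<ge> 0"
  using psi_ge_tangent[of p 1 y] by (simp add: psi_def)

lemma psi_2: "y \<ge> 0 \<Longrightarrow> psi 2 y = (y - 1)\<^sup>2 / 2"
  by (simp add: psi_def power2_eq_square algebra_simps)

text \<open>Bernoulli's inequality for the exponent p - 1 in (0, 1] bounds y^(p-1), and
  multiplication by y yields y^p - p(y-1) - 1 \<le> (p-1)(y-1)^2, which is at most (y-1)^2.\<close>

lemma psi_le_square:
  assumes p: "1 < p" "p \<le> 2" and y: "y \<ge> 0"
  shows "psi p y \<le> (y - 1)\<^sup>2 / (p * (p - 1))"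
proof -
  have bern: "y powr (p - 1) \<le> 1 + (p - 1) * (y - 1)"
  proof (cases "p = 2")
    case True
    then show ?thesis using y by simp
  next
    case False
    \<comment> \<open>Bernoulli for the exponent p - 1 < 1 is the tangent inequality at 1 for the
      inverse power r > 1.\<close>
    define r where "r = 1 / (p - 1)"
    have r: "r > 1" using p False by (simp add: r_def)
    have "(y powr (p - 1)) powr r = y"
      using p y by (simp add: powr_powr r_def)
    then have "1 + r * (y powr (p - 1) - 1) \<le> y"
      using powr_ge_tangent[OF r, of 1 "y powr (p - 1)"] by simp
    then show ?thesis
      using p by (simp add: r_def field_simps)
  qed
  have "y powr p = y * y powr (p - 1)"
    using y powr_mult_base[of y "p - 1"] by simp
  also have "\<dots> \<le> y * (1 + (p - 1) * (y - 1))"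
    using y bern by (rule mult_left_mono[rotated])
  finally have "y powr p \<le> y * (1 + (p - 1) * (y - 1))" .
  moreover have "0 \<le> (2 - p) * (y - 1)\<^sup>2" using p by simp
  ultimately have "y powr p - p * (y - 1) - 1 \<le> (y - 1)\<^sup>2"
    by (simp add: power2_eq_square algebra_simps)
  then show ?thesis
    using p unfolding psi_def by (intro divide_right_mono) auto
qed

lemma measurable_psi [measurable]: "psi p \<in> borel_measurable borel"
  unfolding psi_def by measurable

text \<open>Hoelder's inequality with the crude constant 1 + Z: Young is applied pointwise to G and
  u / N^(1/p), whose p-th power integrates to at most 1 against \<gamma>. If N = 0, then u vanishes
  almost everywhere.\<close>

lemma nn_integral_mult_le_powr:
  fixes G u \<gamma> :: "'a \<Rightarrow> real"
  assumes p: "p > 1" and [measurable]: "G \<in> borel_measurable M" "u \<in> borel_measurable M" "\<gamma> \<in> borel_measurable M"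
    and G: "\<And>x. G x \<ge> 0" and u: "\<And>x. u x \<ge> 0" and \<gamma>: "\<And>x. \<gamma> x > 0"
    and N: "(\<integral>\<^sup>+x. ennreal (u x powr p * \<gamma> x) \<partial>M) \<le> ennreal N"
    and Z: "(\<integral>\<^sup>+x. ennreal (G x powr (p / (p - 1)) * \<gamma> x) \<partial>M) \<le> ennreal Z"
    and nonneg: "N \<ge> 0" "Z \<ge> 0"
  shows "(\<integral>\<^sup>+x. ennreal (G x * u x * \<gamma> x) \<partial>M) \<le> ennreal ((1 + Z) * N powr (1 / p))"
proof (cases "N = 0")
  case True
  then have "AE x in M. ennreal (u x powr p * \<gamma> x) = 0"
    using N by (subst nn_integral_0_iff_AE[symmetric]) auto
  then have "AE x in M. ennreal (G x * u x * \<gamma> x) = 0"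
  proof eventually_elim
    case (elim x)
    then show ?case using \<gamma>[of x] by (simp add: ennreal_eq_0_iff mult_le_0_iff)
  qed
  then have "(\<integral>\<^sup>+x. ennreal (G x * u x * \<gamma> x) \<partial>M) = 0"
    by (subst nn_integral_0_iff_AE) auto
  then show ?thesis by simp
next
  case False
  with nonneg have N0: "N > 0" by simp
  let ?c = "N powr (1 / p)"
  have c: "?c > 0" using N0 by simp
  have young: "g * w \<le> g powr (p / (p - 1)) + w powr p" if "g \<ge> 0" "w \<ge> 0" for g w :: real
  proof -
    have "w * g \<le> w powr p / p + g powr (p / (p - 1)) / (p / (p - 1))"
      using p that by (intro Youngs_inequality) (auto simp: field_simps)
    also have "\<dots> \<le> w powr p / 1 + g powr (p / (p - 1)) / 1"
      using p by (intro add_mono divide_left_mono) (auto simp: field_simps)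
    finally show ?thesis by (simp add: mult.commute add.commute)
  qed
  have pt: "G x * u x * \<gamma> x \<le> ?c * (G x powr (p / (p - 1)) * \<gamma> x) + ?c / N * (u x powr p * \<gamma> x)" for x
  proof -
    have "(u x / ?c) powr p = u x powr p / N"
      using p N0 u[of x] by (simp add: powr_divide powr_powr)
    then have "G x * (u x / ?c) \<le> G x powr (p / (p - 1)) + u x powr p / N"
      using young[of "G x" "u x / ?c"] G[of x] u[of x] c by simp
    then have "?c * \<gamma> x * (G x * (u x / ?c)) \<le> ?c * \<gamma> x * (G x powr (p / (p - 1)) + u x powr p / N)"
      using c \<gamma>[of x] by (intro mult_left_mono) auto
    then show ?thesis using c by (simp add: field_simps)
  qed
  have "(\<integral>\<^sup>+x. ennreal (G x * u x * \<gamma> x) \<partial>M)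
      \<le> (\<integral>\<^sup>+x. ennreal ?c * ennreal (G x powr (p / (p - 1)) * \<gamma> x)
            + ennreal (?c / N) * ennreal (u x powr p * \<gamma> x) \<partial>M)"
  proof (rule nn_integral_mono)
    fix x
    have "ennreal ?c * ennreal (G x powr (p / (p - 1)) * \<gamma> x) + ennreal (?c / N) * ennreal (u x powr p * \<gamma> x)
        = ennreal (?c * (G x powr (p / (p - 1)) * \<gamma> x) + ?c / N * (u x powr p * \<gamma> x))"
      using N0 less_imp_le[OF \<gamma>[of x]] by (simp add: ennreal_mult[symmetric] ennreal_plus[symmetric] del: ennreal_plus)
    then show "ennreal (G x * u x * \<gamma> x) \<le> ennreal ?c * ennreal (G x powr (p / (p - 1)) * \<gamma> x)
            + ennreal (?c / N) * ennreal (u x powr p * \<gamma> x)"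
      using pt[of x] by (simp add: ennreal_leI)
  qed
  also have "\<dots> = ennreal ?c * (\<integral>\<^sup>+x. ennreal (G x powr (p / (p - 1)) * \<gamma> x) \<partial>M)
      + ennreal (?c / N) * (\<integral>\<^sup>+x. ennreal (u x powr p * \<gamma> x) \<partial>M)"
    by (simp add: nn_integral_add nn_integral_cmult)
  also have "\<dots> \<le> ennreal ?c * ennreal Z + ennreal (?c / N) * ennreal N"
    by (intro add_mono mult_left_mono N Z) auto
  also have "\<dots> = ennreal ((1 + Z) * ?c)"
    using N0 nonneg by (simp add: ennreal_mult[symmetric] ennreal_plus[symmetric] algebra_simps del: ennreal_plus)
  finally show ?thesis .
qed

text \<open>P x y is a transition density from y to x with invariant density \<gamma>; hence y |-> P
  x y \<gamma> y / \<gamma> x is a probability density as well. Boundedness in y makes P x y f y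
  integrable for every integrable f.\<close>

locale invariant_kernel =
  fixes P :: "'a::euclidean_space \<Rightarrow> 'a \<Rightarrow> real" and \<gamma> :: "'a \<Rightarrow> real"
  assumes P_measurable [measurable]: "(\<lambda>(x, y). P x y) \<in> borel_measurable (borel \<Otimes>\<^sub>M borel)"
    and \<gamma>_measurable [measurable]: "\<gamma> \<in> borel_measurable borel"
    and P_nonneg: "\<And>x y. P x y \<ge> 0"
    and P_bounded: "\<And>x. \<exists>b. \<forall>y. P x y \<le> b"
    and \<gamma>_pos: "\<And>x. \<gamma> x > 0"
    and P_mass: "\<And>y. (\<integral>\<^sup>+x. ennreal (P x y) \<partial>lborel) = 1"
    and P_invariant: "\<And>x. (\<integral>\<^sup>+y. ennreal (P x y * \<gamma> y) \<partial>lborel) = ennreal (\<gamma> x)"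
    and \<gamma>_mass: "(\<integral>\<^sup>+x. ennreal (\<gamma> x) \<partial>lborel) = 1"
begin

section \<open>Jensen and Hoelder estimates for the evolution\<close>

definition evolve :: "('a \<Rightarrow> real) \<Rightarrow> 'a \<Rightarrow> real" where
  "evolve f x = (\<integral>y. P x y * f y \<partial>lborel)"

lemma evolve_measurable [measurable]:
  assumes [measurable]: "f \<in> borel_measurable borel"
  shows "evolve f \<in> borel_measurable borel"
  unfolding evolve_def by measurable

lemma integrable_P_mult:
  assumes f: "integrable lborel f"
  shows "integrable lborel (\<lambda>y. P x y * f y)"
proof -
  obtain b where b: "\<And>y. P x y \<le> b" using P_bounded by blast
  have [measurable]: "f \<in> borel_measurable borel" using f by simp
  show ?thesis
  proof (rule Bochner_Integration.integrable_bound)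
    show "integrable lborel (\<lambda>y. b * f y)" using f by simp
    show "AE y in lborel. norm (P x y * f y) \<le> norm (b * f y)"
    proof (rule AE_I2)
      fix y
      have "\<bar>P x y\<bar> \<le> \<bar>b\<bar>" using b[of y] P_nonneg[of x y] by simp
      then show "norm (P x y * f y) \<le> norm (b * f y)" by (simp add: abs_mult mult_right_mono)
    qed
  qed simp
qed

lemma integrable_gamma: "integrable lborel \<gamma>" and integral_gamma: "(\<integral>x. \<gamma> x \<partial>lborel) = 1"
proof -
  show "integrable lborel \<gamma>"
    using \<gamma>_mass less_imp_le[OF \<gamma>_pos] by (intro integrableI_nonneg) auto
  show "(\<integral>x. \<gamma> x \<partial>lborel) = 1"
    using \<gamma>_mass less_imp_le[OF \<gamma>_pos] by (simp add: integral_eq_nn_integral)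
qed

lemma integral_P_gamma: "(\<integral>y. P x y * \<gamma> y \<partial>lborel) = \<gamma> x"
  using P_invariant[of x] less_imp_le[OF \<gamma>_pos] P_nonneg by (simp add: integral_eq_nn_integral)

lemma evolve_nonneg: "(\<And>y. f y \<ge> 0) \<Longrightarrow> evolve f x \<ge> 0"
  unfolding evolve_def using P_nonneg by (intro Bochner_Integration.integral_nonneg) auto

text \<open>Jensen: \<open>evolve f x / \<gamma> x\<close> is the mean of f / \<gamma> under the
  probability density P x y \<gamma> y / \<gamma> x in y, and the supporting line of
  \<open>psi p\<close> at this mean is integrated. An infinite right-hand side is trivial; otherwise
  Bochner integrals are available, which the signed slope m calls for.\<close>

lemma psi_evolve_le:
  assumes p: "p > 1" and f: "integrable lborel f" "\<And>y. f y \<ge> 0"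
  shows "ennreal (psi p (evolve f x / \<gamma> x) * \<gamma> x)
    \<le> (\<integral>\<^sup>+y. ennreal (P x y * (psi p (f y / \<gamma> y) * \<gamma> y)) \<partial>lborel)"
proof (cases "(\<integral>\<^sup>+y. ennreal (P x y * (psi p (f y / \<gamma> y) * \<gamma> y)) \<partial>lborel) = \<infinity>")
  case False
  have [measurable]: "f \<in> borel_measurable borel" using f(1) by simp
  have \<gamma>0: "\<gamma> y \<ge> 0" "\<gamma> y \<noteq> 0" for y using \<gamma>_pos[of y] by auto
  let ?g = "\<lambda>y. P x y * (psi p (f y / \<gamma> y) * \<gamma> y)"
  have g0: "?g y \<ge> 0" for y
    using p f(2) P_nonneg \<gamma>0 by (intro mult_nonneg_nonneg psi_nonneg divide_nonneg_nonneg) auto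
  have g: "integrable lborel ?g"
    using False g0 by (intro integrableI_nonneg) (auto simp: top.not_eq_extremum)
  define a where "a = evolve f x / \<gamma> x"
  define m where "m = (a powr (p - 1) - 1) / (p - 1)"
  have a: "a \<ge> 0" using evolve_nonneg[OF f(2)] \<gamma>0 by (simp add: a_def)
  have int: "integrable lborel (\<lambda>y. (psi p a - m * a) * (P x y * \<gamma> y) + m * (P x y * f y))"
    by (intro Bochner_Integration.integrable_add integrable_mult_right integrable_P_mult integrable_gamma f)
  have "psi p a * \<gamma> x = (psi p a - m * a) * \<gamma> x + m * evolve f x"
    using \<gamma>0[of x] by (simp add: a_def field_simps)
  also have "\<dots> = (\<integral>y. (psi p a - m * a) * (P x y * \<gamma> y) + m * (P x y * f y) \<partial>lborel)"
    using integrable_P_mult[OF f(1), of x] integrable_P_mult[OF integrable_gamma, of x]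
    by (simp add: integral_P_gamma evolve_def)
  also have "\<dots> \<le> (\<integral>y. ?g y \<partial>lborel)"
  proof (rule integral_mono[OF int g])
    fix y
    have "psi p a + m * (f y / \<gamma> y - a) \<le> psi p (f y / \<gamma> y)"
      unfolding m_def using p a f(2)[of y] \<gamma>0 by (intro psi_ge_tangent) auto
    then have "(P x y * \<gamma> y) * (psi p a + m * (f y / \<gamma> y - a)) \<le> (P x y * \<gamma> y) * psi p (f y / \<gamma> y)"
      using P_nonneg \<gamma>0 by (intro mult_left_mono) auto
    moreover have "(P x y * \<gamma> y) * (psi p a + m * (f y / \<gamma> y - a))
        = (psi p a - m * a) * (P x y * \<gamma> y) + m * (P x y * f y)"
      using \<gamma>0[of y] by (simp add: field_simps)
    ultimately show "(psi p a - m * a) * (P x y * \<gamma> y) + m * (P x y * f y) \<le> ?g y"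
      by (simp add: mult_ac)
  qed
  finally have "ennreal (psi p a * \<gamma> x) \<le> ennreal (\<integral>y. ?g y \<partial>lborel)" by (rule ennreal_leI)
  also have "\<dots> = (\<integral>\<^sup>+y. ennreal (?g y) \<partial>lborel)"
    using g g0 by (intro nn_integral_eq_integral[symmetric]) auto
  finally show ?thesis by (simp add: a_def)
qed simp

text \<open>Jensen is integrated in x; after exchanging the integrals, the kernel contributes mass 1
  for each y.\<close>

lemma entropy_evolve_le:
  assumes p: "p > 1" and f: "integrable lborel f" "\<And>y. f y \<ge> 0"
  shows "(\<integral>\<^sup>+x. ennreal (psi p (evolve f x / \<gamma> x) * \<gamma> x) \<partial>lborel)
    \<le> (\<integral>\<^sup>+x. ennreal (psi p (f x / \<gamma> x) * \<gamma> x) \<partial>lborel)"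
proof -
  have [measurable]: "f \<in> borel_measurable borel" using f(1) by simp
  have 0: "psi p (f y / \<gamma> y) * \<gamma> y \<ge> 0" for y
    using p f(2) less_imp_le[OF \<gamma>_pos] by (intro mult_nonneg_nonneg psi_nonneg divide_nonneg_nonneg) auto
  have "(\<integral>\<^sup>+x. ennreal (psi p (evolve f x / \<gamma> x) * \<gamma> x) \<partial>lborel)
      \<le> (\<integral>\<^sup>+x. \<integral>\<^sup>+y. ennreal (P x y * (psi p (f y / \<gamma> y) * \<gamma> y)) \<partial>lborel \<partial>lborel)"
    by (intro nn_integral_mono psi_evolve_le p f)
  also have "\<dots> = (\<integral>\<^sup>+y. \<integral>\<^sup>+x. ennreal (P x y * (psi p (f y / \<gamma> y) * \<gamma> y)) \<partial>lborel \<partial>lborel)"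
    by (rule lborel_pair.Fubini') measurable
  also have "\<dots> = (\<integral>\<^sup>+y. ennreal (psi p (f y / \<gamma> y) * \<gamma> y) \<partial>lborel)"
  proof (rule nn_integral_cong)
    fix y
    have "(\<integral>\<^sup>+x. ennreal (P x y * (psi p (f y / \<gamma> y) * \<gamma> y)) \<partial>lborel)
        = (\<integral>\<^sup>+x. ennreal (P x y) * ennreal (psi p (f y / \<gamma> y) * \<gamma> y) \<partial>lborel)"
      using 0 P_nonneg by (simp add: ennreal_mult)
    also have "\<dots> = (\<integral>\<^sup>+x. ennreal (P x y) \<partial>lborel) * ennreal (psi p (f y / \<gamma> y) * \<gamma> y)"
      by (rule nn_integral_multc) measurable
    finally show "(\<integral>\<^sup>+x. ennreal (P x y * (psi p (f y / \<gamma> y) * \<gamma> y)) \<partial>lborel) = ennreal (psi p (f y / \<gamma> y) * \<gamma> y)"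
      by (simp add: P_mass)
  qed
  finally show ?thesis .
qed

text \<open>The choice of v serves both parts of the theorem: v = f for general p, v = f - \<gamma>
  for p = 2. The deviation at x is at most \<kappa> G x times the integral of G |v|, which Hoelder
  turns into a multiple of N^(1/p); it remains to square and to integrate G^2 against
  \<gamma>.\<close>

lemma square_evolve_le:
  assumes p: "1 < p" "p \<le> 2"
    and f: "integrable lborel f" "(\<integral>x. f x \<partial>lborel) = 1"
    and v: "v = f \<or> v = (\<lambda>x. f x - \<gamma> x)"
    and [measurable]: "G \<in> borel_measurable borel" and G: "\<And>x. G x \<ge> 1"
    and P: "\<And>x y. \<bar>P x y / \<gamma> x - 1\<bar> \<le> \<kappa> * G x * G y" and \<kappa>: "\<kappa> \<ge> 0"
    and N: "(\<integral>\<^sup>+x. ennreal ((\<bar>v x\<bar> / \<gamma> x) powr p * \<gamma> x) \<partial>lborel) \<le> ennreal N" "N \<ge> 0"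
    and Z: "(\<integral>\<^sup>+x. ennreal (G x powr (p / (p - 1)) * \<gamma> x) \<partial>lborel) \<le> ennreal Z" "Z \<ge> 0"
  shows "(\<integral>\<^sup>+x. ennreal ((evolve f x / \<gamma> x - 1)\<^sup>2 * \<gamma> x) \<partial>lborel)
    \<le> ennreal (\<kappa>\<^sup>2 * (Z * (1 + Z)\<^sup>2) * N powr (2 / p))"
proof -
  have [measurable]: "f \<in> borel_measurable borel" using f(1) by simp
  have v_int: "integrable lborel v" using v f(1) integrable_gamma by auto
  then have [measurable]: "v \<in> borel_measurable borel" by simp
  have \<gamma>0: "\<gamma> y \<ge> 0" "\<gamma> y \<noteq> 0" for y using \<gamma>_pos[of y] by auto
  let ?J = "(1 + Z) * N powr (1 / p)"
  have G0: "G x \<ge> 0" for x using G[of x] by simp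
  have J: "(\<integral>\<^sup>+x. ennreal (G x * \<bar>v x\<bar>) \<partial>lborel) \<le> ennreal ?J"
  proof -
    have "(\<integral>\<^sup>+x. ennreal (G x * (\<bar>v x\<bar> / \<gamma> x) * \<gamma> x) \<partial>lborel) \<le> ennreal ?J"
      using p N Z \<gamma>_pos G0 \<gamma>0 by (intro nn_integral_mult_le_powr) auto
    then show ?thesis using \<gamma>0 by simp
  qed
  have Gv: "integrable lborel (\<lambda>y. G y * \<bar>v y\<bar>)"
    using J G0 by (intro integrableI_nonneg) (auto simp: le_less_trans)
  have Gv_le: "(\<integral>y. G y * \<bar>v y\<bar> \<partial>lborel) \<le> ?J"
  proof -
    have "ennreal (\<integral>y. G y * \<bar>v y\<bar> \<partial>lborel) \<le> ennreal ?J"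
      using J nn_integral_eq_integral[OF Gv] G0 by simp
    then show ?thesis using Z(2) N(2) by (subst (asm) ennreal_le_iff) auto
  qed
  have dev: "\<bar>evolve f x / \<gamma> x - 1\<bar> \<le> \<kappa> * G x * ?J" for x
  proof -
    have intP: "integrable lborel (\<lambda>y. (P x y / \<gamma> x - 1) * w y)"
      "(\<integral>y. (P x y / \<gamma> x - 1) * w y \<partial>lborel) = evolve w x / \<gamma> x - (\<integral>y. w y \<partial>lborel)"
      if "integrable lborel w" for w
    proof -
      have eq: "(P x y / \<gamma> x - 1) * w y = P x y * w y / \<gamma> x - w y" for y
        by (simp add: algebra_simps)
      show "integrable lborel (\<lambda>y. (P x y / \<gamma> x - 1) * w y)"
        unfolding eq using that integrable_P_mult[OF that, of x] by auto
      show "(\<integral>y. (P x y / \<gamma> x - 1) * w y \<partial>lborel) = evolve w x / \<gamma> x - (\<integral>y. w y \<partial>lborel)"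
        unfolding eq evolve_def using that integrable_P_mult[OF that, of x] by simp
    qed
    have "evolve f x / \<gamma> x - 1 = (\<integral>y. (P x y / \<gamma> x - 1) * v y \<partial>lborel)"
    proof -
      have 1: "(\<integral>y. (P x y / \<gamma> x - 1) * f y \<partial>lborel) = evolve f x / \<gamma> x - 1"
        using intP(2)[OF f(1)] f(2) by simp
      have 2: "(\<integral>y. (P x y / \<gamma> x - 1) * \<gamma> y \<partial>lborel) = 0"
        using intP(2)[OF integrable_gamma] \<gamma>0 by (simp add: integral_gamma evolve_def integral_P_gamma)
      have "(\<integral>y. (P x y / \<gamma> x - 1) * (f y - \<gamma> y) \<partial>lborel) = evolve f x / \<gamma> x - 1"
        using intP(1)[OF f(1)] intP(1)[OF integrable_gamma] 1 2 by (simp add: right_diff_distrib)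
      then show ?thesis using v 1 by auto
    qed
    also have "\<bar>\<dots>\<bar> \<le> (\<integral>y. \<bar>(P x y / \<gamma> x - 1) * v y\<bar> \<partial>lborel)"
      by (rule integral_abs_bound)
    also have "\<dots> \<le> (\<integral>y. \<kappa> * G x * (G y * \<bar>v y\<bar>) \<partial>lborel)"
    proof (rule integral_mono)
      show "integrable lborel (\<lambda>y. \<bar>(P x y / \<gamma> x - 1) * v y\<bar>)"
        using intP(1)[OF v_int] by (rule integrable_abs)
      show "integrable lborel (\<lambda>y. \<kappa> * G x * (G y * \<bar>v y\<bar>))"
        using Gv by simp
      show "\<bar>(P x y / \<gamma> x - 1) * v y\<bar> \<le> \<kappa> * G x * (G y * \<bar>v y\<bar>)" for y
        using mult_right_mono[OF P[of x y], of "\<bar>v y\<bar>"] by (simp add: abs_mult mult_ac)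
    qed
    also have "\<dots> = \<kappa> * G x * (\<integral>y. G y * \<bar>v y\<bar> \<partial>lborel)" by simp
    also have "\<dots> \<le> \<kappa> * G x * ?J"
      using Gv_le \<kappa> G0 by (intro mult_left_mono) auto
    finally show ?thesis .
  qed
  \<comment> \<open>For p \<le> 2 the conjugate exponent is at least 2. As G \<ge> 1, the moment Z
    from Hoelder in y therefore also bounds the integral of G^2 in x.\<close>
  have G2: "(G x)\<^sup>2 \<le> G x powr (p / (p - 1))" for x
  proof -
    have "2 \<le> p / (p - 1)" using p by (simp add: field_simps)
    then have "G x powr 2 \<le> G x powr (p / (p - 1))" using G[of x] by (intro powr_mono) auto
    then show ?thesis using G[of x] by simp
  qed
  have "(\<integral>\<^sup>+x. ennreal ((evolve f x / \<gamma> x - 1)\<^sup>2 * \<gamma> x) \<partial>lborel)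
      \<le> (\<integral>\<^sup>+x. ennreal ((\<kappa> * ?J)\<^sup>2) * ennreal (G x powr (p / (p - 1)) * \<gamma> x) \<partial>lborel)"
  proof (rule nn_integral_mono)
    fix x
    have "(evolve f x / \<gamma> x - 1)\<^sup>2 \<le> (\<kappa> * G x * ?J)\<^sup>2"
      using power_mono[OF dev[of x], of 2] by simp
    also have "\<dots> = (\<kappa> * ?J)\<^sup>2 * (G x)\<^sup>2" by (simp add: power_mult_distrib)
    also have "\<dots> \<le> (\<kappa> * ?J)\<^sup>2 * G x powr (p / (p - 1))"
      using G2 by (intro mult_left_mono) auto
    finally have "(evolve f x / \<gamma> x - 1)\<^sup>2 * \<gamma> x \<le> (\<kappa> * ?J)\<^sup>2 * G x powr (p / (p - 1)) * \<gamma> x"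
      using \<gamma>0(1) by (rule mult_right_mono)
    then show "ennreal ((evolve f x / \<gamma> x - 1)\<^sup>2 * \<gamma> x)
        \<le> ennreal ((\<kappa> * ?J)\<^sup>2) * ennreal (G x powr (p / (p - 1)) * \<gamma> x)"
      using \<gamma>0(1) by (simp add: ennreal_mult[symmetric] ennreal_leI mult.assoc)
  qed
  also have "\<dots> = ennreal ((\<kappa> * ?J)\<^sup>2) * (\<integral>\<^sup>+x. ennreal (G x powr (p / (p - 1)) * \<gamma> x) \<partial>lborel)"
    by (rule nn_integral_cmult) measurable
  also have "\<dots> \<le> ennreal ((\<kappa> * ?J)\<^sup>2) * ennreal Z"
    by (intro mult_left_mono Z) simp
  also have "\<dots> = ennreal (\<kappa>\<^sup>2 * (Z * (1 + Z)\<^sup>2) * N powr (2 / p))"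
  proof -
    have "(N powr (1 / p))\<^sup>2 = N powr (2 / p)"
      using N(2) by (simp add: power2_eq_square powr_add[symmetric])
    then show ?thesis using Z(2) by (simp add: ennreal_mult[symmetric] power_mult_distrib mult_ac)
  qed
  finally show ?thesis .
qed

text \<open>Solving the definition of \<psi> for the power gives (f/\<gamma>)^p \<gamma> = p(p-1)
  \<psi>(f/\<gamma>) \<gamma> + p f - (p-1) \<gamma>, and the last two terms together integrate to
  1.\<close>

lemma nn_integral_powr_eq:
  assumes p: "p > 1" and f: "integrable lborel f" "\<And>y. f y \<ge> 0" "(\<integral>x. f x \<partial>lborel) = 1"
    and e: "(\<integral>\<^sup>+x. ennreal (psi p (f x / \<gamma> x) * \<gamma> x) \<partial>lborel) = ennreal e" "e \<ge> 0"
  shows "(\<integral>\<^sup>+x. ennreal ((f x / \<gamma> x) powr p * \<gamma> x) \<partial>lborel) = ennreal (p * (p - 1) * e + 1)"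
proof -
  have [measurable]: "f \<in> borel_measurable borel" using f(1) by simp
  have \<gamma>0: "\<gamma> y \<ge> 0" "\<gamma> y \<noteq> 0" for y using \<gamma>_pos[of y] by auto
  let ?\<psi> = "\<lambda>x. psi p (f x / \<gamma> x) * \<gamma> x"
  have 0: "?\<psi> x \<ge> 0" for x
    using p f(2) \<gamma>0 by (intro mult_nonneg_nonneg psi_nonneg divide_nonneg_nonneg) auto
  have int: "integrable lborel ?\<psi>"
    using e 0 by (intro integrableI_nonneg) auto
  have val: "(\<integral>x. ?\<psi> x \<partial>lborel) = e"
    using e 0 by (simp add: integral_eq_nn_integral)
  have eq: "(f x / \<gamma> x) powr p * \<gamma> x = p * (p - 1) * ?\<psi> x + (p * f x - (p - 1) * \<gamma> x)" for x
    using p \<gamma>0[of x] by (simp add: psi_def divide_simps) (simp add: algebra_simps)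
  have "integrable lborel (\<lambda>x. (f x / \<gamma> x) powr p * \<gamma> x)"
    unfolding eq using int f(1) integrable_gamma by auto
  moreover have "(\<integral>x. (f x / \<gamma> x) powr p * \<gamma> x \<partial>lborel) = p * (p - 1) * e + 1"
    unfolding eq using int f integrable_gamma val by (simp add: integral_gamma)
  ultimately show ?thesis
    using \<gamma>0 by (subst nn_integral_eq_integral) auto
qed

text \<open>The entropy is at most the squared L^2 distance divided by p(p-1). For general p the L^p
  norm of v = f is fixed by e; for p = 2 the squared norm of v = f - \<gamma> is 2 e, so that the
  bound is linear in e.\<close>

lemma entropy_evolve_decay:
  assumes p: "1 < p" "p \<le> 2"
    and f: "integrable lborel f" "\<And>y. f y \<ge> 0" "(\<integral>x. f x \<partial>lborel) = 1"
    and e: "(\<integral>\<^sup>+x. ennreal (psi p (f x / \<gamma> x) * \<gamma> x) \<partial>lborel) = ennreal e" "e \<ge> 0"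
    and [measurable]: "G \<in> borel_measurable borel" and G: "\<And>x. G x \<ge> 1"
    and P: "\<And>x y. \<bar>P x y / \<gamma> x - 1\<bar> \<le> \<kappa> * G x * G y" and \<kappa>: "\<kappa> \<ge> 0"
    and Z: "(\<integral>\<^sup>+x. ennreal (G x powr (p / (p - 1)) * \<gamma> x) \<partial>lborel) \<le> ennreal Z" "Z \<ge> 0"
  shows "(\<integral>\<^sup>+x. ennreal (psi p (evolve f x / \<gamma> x) * \<gamma> x) \<partial>lborel)
      \<le> ennreal (\<kappa>\<^sup>2 * (Z * (1 + Z)\<^sup>2) / (p * (p - 1)) * (p * (p - 1) * e + 1) powr (2 / p))"
    and "p = 2 \<Longrightarrow> (\<integral>\<^sup>+x. ennreal (psi p (evolve f x / \<gamma> x) * \<gamma> x) \<partial>lborel)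
      \<le> ennreal (\<kappa>\<^sup>2 * (Z * (1 + Z)\<^sup>2) * e)"
proof -
  have [measurable]: "f \<in> borel_measurable borel" using f(1) by simp
  have \<gamma>0: "\<gamma> y \<ge> 0" "\<gamma> y \<noteq> 0" for y using \<gamma>_pos[of y] by auto
  have bound: "(\<integral>\<^sup>+x. ennreal (psi p (evolve f x / \<gamma> x) * \<gamma> x) \<partial>lborel)
      \<le> ennreal (B / (p * (p - 1)))"
    if B: "(\<integral>\<^sup>+x. ennreal ((evolve f x / \<gamma> x - 1)\<^sup>2 * \<gamma> x) \<partial>lborel) \<le> ennreal B" "B \<ge> 0" for B
  proof -
    have "(\<integral>\<^sup>+x. ennreal (psi p (evolve f x / \<gamma> x) * \<gamma> x) \<partial>lborel)
        \<le> (\<integral>\<^sup>+x. ennreal (1 / (p * (p - 1))) * ennreal ((evolve f x / \<gamma> x - 1)\<^sup>2 * \<gamma> x) \<partial>lborel)"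
    proof (rule nn_integral_mono)
      fix x
      have "psi p (evolve f x / \<gamma> x) \<le> (evolve f x / \<gamma> x - 1)\<^sup>2 / (p * (p - 1))"
        using p evolve_nonneg[OF f(2)] \<gamma>0 by (intro psi_le_square) auto
      then have "psi p (evolve f x / \<gamma> x) * \<gamma> x \<le> 1 / (p * (p - 1)) * ((evolve f x / \<gamma> x - 1)\<^sup>2 * \<gamma> x)"
        using mult_right_mono[OF _ \<gamma>0(1)[of x]] by fastforce
      then show "ennreal (psi p (evolve f x / \<gamma> x) * \<gamma> x)
          \<le> ennreal (1 / (p * (p - 1))) * ennreal ((evolve f x / \<gamma> x - 1)\<^sup>2 * \<gamma> x)"
        using p \<gamma>0(1) by (subst ennreal_mult[symmetric]) (auto intro: ennreal_leI)
    qed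
    also have "\<dots> = ennreal (1 / (p * (p - 1))) * (\<integral>\<^sup>+x. ennreal ((evolve f x / \<gamma> x - 1)\<^sup>2 * \<gamma> x) \<partial>lborel)"
      by (rule nn_integral_cmult) measurable
    also have "\<dots> \<le> ennreal (1 / (p * (p - 1))) * ennreal B"
      by (intro mult_left_mono B) simp
    also have "\<dots> = ennreal (B / (p * (p - 1)))"
      using p B by (simp add: ennreal_mult[symmetric])
    finally show ?thesis .
  qed
  have N: "(\<integral>\<^sup>+x. ennreal ((\<bar>f x\<bar> / \<gamma> x) powr p * \<gamma> x) \<partial>lborel) \<le> ennreal (p * (p - 1) * e + 1)"
    using nn_integral_powr_eq[OF p(1) f e] f(2) by simp
  have N0: "p * (p - 1) * e + 1 \<ge> 0" using p e by simp
  have "(\<integral>\<^sup>+x. ennreal (psi p (evolve f x / \<gamma> x) * \<gamma> x) \<partial>lborel)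
      \<le> ennreal (\<kappa>\<^sup>2 * (Z * (1 + Z)\<^sup>2) * (p * (p - 1) * e + 1) powr (2 / p) / (p * (p - 1)))"
  proof (rule bound)
    show "(\<integral>\<^sup>+x. ennreal ((evolve f x / \<gamma> x - 1)\<^sup>2 * \<gamma> x) \<partial>lborel)
        \<le> ennreal (\<kappa>\<^sup>2 * (Z * (1 + Z)\<^sup>2) * (p * (p - 1) * e + 1) powr (2 / p))"
      by (rule square_evolve_le[OF p f(1,3) _ _ G P \<kappa> N N0 Z]) auto
  qed (use Z in auto)
  then show "(\<integral>\<^sup>+x. ennreal (psi p (evolve f x / \<gamma> x) * \<gamma> x) \<partial>lborel)
      \<le> ennreal (\<kappa>\<^sup>2 * (Z * (1 + Z)\<^sup>2) / (p * (p - 1)) * (p * (p - 1) * e + 1) powr (2 / p))"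
    by simp
  show "(\<integral>\<^sup>+x. ennreal (psi p (evolve f x / \<gamma> x) * \<gamma> x) \<partial>lborel)
      \<le> ennreal (\<kappa>\<^sup>2 * (Z * (1 + Z)\<^sup>2) * e)" if "p = 2"
  proof -
    have "(\<integral>\<^sup>+x. ennreal ((\<bar>f x - \<gamma> x\<bar> / \<gamma> x) powr p * \<gamma> x) \<partial>lborel)
        = (\<integral>\<^sup>+x. ennreal 2 * ennreal (psi p (f x / \<gamma> x) * \<gamma> x) \<partial>lborel)"
    proof (rule nn_integral_cong)
      fix x
      have "(\<bar>f x - \<gamma> x\<bar> / \<gamma> x) powr p = \<bar>f x / \<gamma> x - 1\<bar>\<^sup>2"
      proof -
        have "f x / \<gamma> x - 1 = (f x - \<gamma> x) / \<gamma> x" using \<gamma>0[of x] by (simp add: diff_divide_distrib)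
        then have "\<bar>f x - \<gamma> x\<bar> / \<gamma> x = \<bar>f x / \<gamma> x - 1\<bar>"
          using \<gamma>0(1)[of x] by (simp add: abs_divide)
        then show ?thesis using that by simp
      qed
      also have "\<dots> = 2 * psi p (f x / \<gamma> x)"
        using that f(2)[of x] \<gamma>0[of x] by (simp add: psi_2)
      finally show "ennreal ((\<bar>f x - \<gamma> x\<bar> / \<gamma> x) powr p * \<gamma> x) = ennreal 2 * ennreal (psi p (f x / \<gamma> x) * \<gamma> x)"
        by (subst ennreal_mult'[symmetric]) (simp_all add: mult.assoc)
    qed
    also have "\<dots> = ennreal 2 * ennreal e"
      by (subst nn_integral_cmult) (simp_all add: e)
    also have "\<dots> = ennreal (2 * e)" using e by (simp add: ennreal_mult)
    finally have N2: "(\<integral>\<^sup>+x. ennreal ((\<bar>f x - \<gamma> x\<bar> / \<gamma> x) powr p * \<gamma> x) \<partial>lborel) \<le> ennreal (2 * e)"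
      by simp
    have "(\<integral>\<^sup>+x. ennreal ((evolve f x / \<gamma> x - 1)\<^sup>2 * \<gamma> x) \<partial>lborel)
        \<le> ennreal (\<kappa>\<^sup>2 * (Z * (1 + Z)\<^sup>2) * (2 * e) powr (2 / p))"
      using e by (intro square_evolve_le[OF p f(1,3) _ _ G P \<kappa> N2 _ Z]) auto
    then have "(\<integral>\<^sup>+x. ennreal ((evolve f x / \<gamma> x - 1)\<^sup>2 * \<gamma> x) \<partial>lborel)
        \<le> ennreal (\<kappa>\<^sup>2 * (Z * (1 + Z)\<^sup>2) * (2 * e))"
      using that e by simp
    from bound[OF this] show ?thesis using that e Z by (simp add: mult.assoc)
  qed
qed

end

section \<open>Gaussian transition kernels\<close>

lemma pos_def_matrix_lower_bound:
  fixes A :: "real^'n^'n"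
  assumes A: "pos_def_matrix A"
  obtains k where "k > 0" "\<And>x. k * (norm x)\<^sup>2 \<le> x \<bullet> (A *v x)"
proof -
  let ?S = "sphere (0 :: real^'n) 1"
  have "axis undefined 1 \<in> ?S" by simp
  then have "?S \<noteq> {}" by blast
  moreover have "continuous_on ?S (\<lambda>x. x \<bullet> (A *v x))"
    by (intro continuous_intros linear_continuous_on matrix_vector_mul_bounded_linear)
  ultimately obtain u where u: "u \<in> ?S" "\<And>x. x \<in> ?S \<Longrightarrow> u \<bullet> (A *v u) \<le> x \<bullet> (A *v x)"
    using continuous_attains_inf[OF compact_sphere] by blast
  have "u \<noteq> 0" using u(1) by auto
  then have "u \<bullet> (A *v u) > 0" using A by (simp add: pos_def_matrix_def)
  moreover have "(u \<bullet> (A *v u)) * (norm x)\<^sup>2 \<le> x \<bullet> (A *v x)" for x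
  proof (cases "x = 0")
    case False
    let ?y = "(1 / norm x) *\<^sub>R x"
    have "u \<bullet> (A *v u) \<le> ?y \<bullet> (A *v ?y)" using False by (intro u(2)) simp
    also have "\<dots> = (x \<bullet> (A *v x)) / (norm x)\<^sup>2"
      by (simp add: matrix_vector_mult_scaleR power2_eq_square)
    finally show ?thesis using False by (simp add: field_simps)
  qed simp
  ultimately show ?thesis using that by blast
qed

lemma norm_matrix_inv_le:
  assumes W: "pos_def_matrix W" and k: "k > 0" "\<And>x. k * (norm x)\<^sup>2 \<le> x \<bullet> (W *v x)"
  shows "norm (matrix_inv W *v z) \<le> norm z / k"
proof -
  let ?v = "matrix_inv W *v z"
  have Wv: "W *v ?v = z" by (simp add: matrix_vector_mul_assoc pos_def_matrix_inverse[OF W])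
  have "k * (norm ?v)\<^sup>2 \<le> norm ?v * norm z"
    using k(2)[of ?v] norm_cauchy_schwarz[of ?v z] by (simp only: Wv)
  then have "k * norm ?v \<le> norm z"
    by (cases "?v = 0") (auto simp: power2_eq_square mult.left_commute)
  then show ?thesis using k(1) by (simp add: field_simps)
qed

lemma gaussian_weight_pos [simp]: "gaussian_weight M x > 0"
  by (simp add: gaussian_weight_def)

lemma gaussian_weight_le_1: "pos_def_matrix M \<Longrightarrow> gaussian_weight M x \<le> 1"
  using pos_def_matrix_nonneg[OF pos_def_matrix_inverse(3)] by (simp add: gaussian_weight_def)

lemma gaussian_weight_measurable [measurable]: "gaussian_weight M \<in> borel_measurable borel"
  unfolding gaussian_weight_def[abs_def] by measurable

definition gaussian_mass :: "real^'n^'n \<Rightarrow> real" where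
  "gaussian_mass M = (2 * pi) powr (real CARD('n) / 2) * sqrt (det M)"

lemma gaussian_mass_pos: "pos_def_matrix M \<Longrightarrow> gaussian_mass M > 0"
  using nn_integral_gaussian(1)[of M] by (simp add: gaussian_mass_def)

lemma nn_integral_gaussian_mass:
  "pos_def_matrix M \<Longrightarrow> (\<integral>\<^sup>+x. ennreal (gaussian_weight M x) \<partial>lborel) = ennreal (gaussian_mass M)"
  by (simp add: nn_integral_gaussian_weight gaussian_mass_def)

text \<open>With k a lower bound for the form of M^-1, the weight decays at least like
  exp(-(k/2)|y|^2). For \<delta> \<le> k/4 half of this decay is left, which is the Gaussian
  belonging to \<open>?A\<close>.\<close>

lemma exp_square_gaussian_finite:
  fixes M :: "real^'n^'n"
  assumes M: "pos_def_matrix M"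
  obtains \<delta>0 where "\<delta>0 > 0"
    "\<And>\<delta>. \<delta> \<le> \<delta>0 \<Longrightarrow> (\<integral>\<^sup>+y. ennreal (exp (\<delta> * (norm y)\<^sup>2) * gaussian_weight M y) \<partial>lborel) < \<infinity>"
proof -
  obtain k where k: "k > 0" "\<And>x. k * (norm x)\<^sup>2 \<le> x \<bullet> (matrix_inv M *v x)"
    using pos_def_matrix_lower_bound[OF pos_def_matrix_inverse(3)[OF M]] by blast
  let ?A = "(k / 2) *\<^sub>R (mat 1 :: real^'n^'n)"
  have A: "?A *v x = (k / 2) *\<^sub>R x" for x
    by (metis matrix_vector_mul_lid scaleR_matrix_vector_assoc)
  have "pos_def_matrix ?A"
    using k(1) unfolding pos_def_matrix_def A by (auto simp: transpose_def mat_def vec_eq_iff)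
  then have fin: "(\<integral>\<^sup>+x. ennreal (exp (- (1/2) * (x \<bullet> (?A *v x)))) \<partial>lborel) < \<infinity>"
    by (simp only: nn_integral_gaussian(2)) simp
  have "(\<integral>\<^sup>+y. ennreal (exp (\<delta> * (norm y)\<^sup>2) * gaussian_weight M y) \<partial>lborel) < \<infinity>" if "\<delta> \<le> k / 4" for \<delta>
  proof (rule order.strict_trans1[OF nn_integral_mono fin])
    fix y :: "real^'n"
    have "\<delta> * (norm y)\<^sup>2 \<le> k / 4 * (norm y)\<^sup>2" using that by (intro mult_right_mono) auto
    then have "\<delta> * (norm y)\<^sup>2 - 1/2 * (y \<bullet> (matrix_inv M *v y)) \<le> - (1/2) * (y \<bullet> (?A *v y))"
      using k(2)[of y] by (simp add: A power2_norm_eq_inner)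
    then have "exp (\<delta> * (norm y)\<^sup>2 - 1/2 * (y \<bullet> (matrix_inv M *v y))) \<le> exp (- (1/2) * (y \<bullet> (?A *v y)))"
      by (simp only: exp_le_cancel_iff)
    then show "ennreal (exp (\<delta> * (norm y)\<^sup>2) * gaussian_weight M y) \<le> ennreal (exp (- (1/2) * (y \<bullet> (?A *v y))))"
    proof (intro ennreal_leI)
      have "exp (\<delta> * (norm y)\<^sup>2) * gaussian_weight M y = exp (\<delta> * (norm y)\<^sup>2 - 1/2 * (y \<bullet> (matrix_inv M *v y)))"
        by (simp add: gaussian_weight_def mult_exp_exp)
      then show "exp (\<delta> * (norm y)\<^sup>2) * gaussian_weight M y \<le> exp (- (1/2) * (y \<bullet> (?A *v y)))"
        using \<open>exp _ \<le> exp _\<close> by (simp only:)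
    qed
  qed
  then show ?thesis using that[of "k / 4"] k(1) by auto
qed

text \<open>Transition density of the linear map \<open>B\<close> followed by centred Gaussian noise with covariance
  \<open>W\<close>; it preserves the centred Gaussian with covariance \<open>K\<close> if \<open>W = K - B K B\<^sup>T\<close>.\<close>

locale gaussian_transition =
  fixes K W B :: "real^'d^'d"
  assumes K: "pos_def_matrix K" and W: "pos_def_matrix W"
    and W_eq: "W = K - B ** K ** transpose B"
begin

abbreviation "Ki \<equiv> matrix_inv K"
abbreviation "Wi \<equiv> matrix_inv W"

definition density :: "real^'d \<Rightarrow> real" where
  "density x = gaussian_weight K x / gaussian_mass K"

definition kernel :: "real^'d \<Rightarrow> real^'d \<Rightarrow> real" where
  "kernel x y = gaussian_weight W (x - B *v y) / gaussian_mass W"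

lemma K_Ki: "K *v (Ki *v x) = x" "Ki *v (K *v x) = x"
  by (simp_all add: matrix_vector_mul_assoc pos_def_matrix_inverse[OF K])

lemma W_Wi: "W *v (Wi *v x) = x" "Wi *v (W *v x) = x"
  by (simp_all add: matrix_vector_mul_assoc pos_def_matrix_inverse[OF W])

lemma W_mult: "W *v x = K *v x - B *v (K *v (transpose B *v x))"
  by (simp only: W_eq matrix_vector_mult_diff_rdistrib matrix_vector_mul_assoc matrix_mul_assoc)

lemma density_pos [simp]: "density x > 0"
  by (simp add: density_def gaussian_mass_pos[OF K])

lemma mass_pos: "gaussian_mass K > 0" "gaussian_mass W > 0"
  by (rule gaussian_mass_pos[OF K], rule gaussian_mass_pos[OF W])

text \<open>K B^T K^-1 x is the conditional mean of y given x, when y has covariance K and x is B y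
  plus noise of covariance W. Centring y there cancels the terms linear in z, and W = K - B K B^T
  collects the rest into x . K^-1 x.\<close>

lemma complete_square:
  fixes x z :: "real^'d"
  defines "c \<equiv> transpose B *v (Ki *v x)"
  shows "gaussian_weight W (x - B *v (z + K *v c)) * gaussian_weight K (z + K *v c)
     = gaussian_weight K x * exp (- (1/2) * ((B *v z) \<bullet> (Wi *v (B *v z)) + z \<bullet> (Ki *v z)))"
proof -
  define a where "a = Ki *v x"
  define b where "b = B *v z"
  have Ka: "K *v a = x" by (simp add: a_def K_Ki)
  have c: "c = transpose B *v a" by (simp add: c_def a_def)
  have f1: "x - B *v (z + K *v c) = W *v a - b"
    by (simp add: W_mult Ka c b_def matrix_vector_right_distrib)
  have f3: "(W *v a) \<bullet> (Wi *v b) = a \<bullet> b"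
    using pos_def_matrix_inner_commute[OF W, of a "Wi *v b"] by (simp add: W_Wi inner_commute)
  have f4: "(K *v c) \<bullet> (Ki *v z) = c \<bullet> z"
    using pos_def_matrix_inner_commute[OF K, of c "Ki *v z"] by (simp add: K_Ki inner_commute)
  have cz: "c \<bullet> z = a \<bullet> b"
    by (simp only: c b_def inner_matrix_vector_mult)
  have f5: "a \<bullet> (W *v a) + (K *v c) \<bullet> c = x \<bullet> a"
  proof -
    have "a \<bullet> (B *v (K *v c)) = c \<bullet> (K *v c)" by (simp only: c inner_matrix_vector_mult)
    moreover have "W *v a = x - B *v (K *v c)" by (simp only: W_mult Ka c)
    ultimately show ?thesis by (simp add: inner_diff_right inner_commute)
  qed
  have q1: "(W *v a - b) \<bullet> (Wi *v (W *v a - b)) = a \<bullet> (W *v a) - 2 * (a \<bullet> b) + b \<bullet> (Wi *v b)"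
    by (simp add: matrix_vector_mult_diff_distrib W_Wi inner_diff_left inner_diff_right f3 inner_commute)
  have q2: "(z + K *v c) \<bullet> (Ki *v (z + K *v c)) = z \<bullet> (Ki *v z) + 2 * (a \<bullet> b) + (K *v c) \<bullet> c"
    using cz f4 by (simp add: matrix_vector_right_distrib K_Ki inner_add_left inner_add_right inner_commute)
  have "(x - B *v (z + K *v c)) \<bullet> (Wi *v (x - B *v (z + K *v c))) + (z + K *v c) \<bullet> (Ki *v (z + K *v c))
      = x \<bullet> (Ki *v x) + (b \<bullet> (Wi *v b) + z \<bullet> (Ki *v z))"
    unfolding f1 q1 q2 using f5 by (simp add: a_def)
  then show ?thesis
    unfolding gaussian_weight_def exp_add[symmetric] b_def by (simp add: algebra_simps)
qed

lemma nn_integral_shifted_weight: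
  "(\<integral>\<^sup>+x. ennreal (gaussian_weight W (x - y)) \<partial>lborel) = ennreal (gaussian_mass W)"
  using nn_integral_lborel_add[of "\<lambda>x. ennreal (gaussian_weight W x)" "- y"]
  by (simp add: nn_integral_gaussian_mass[OF W])

text \<open>After the shift the integral over y is the weight of x times a number g independent of
  x. Integrating over x in both orders identifies g as \<open>gaussian_mass W\<close>.\<close>

lemma kernel_invariant_unnormalized:
  "(\<integral>\<^sup>+y. ennreal (gaussian_weight W (x - B *v y) * gaussian_weight K y) \<partial>lborel)
     = ennreal (gaussian_weight K x) * ennreal (gaussian_mass W)"
proof -
  let ?h = "\<lambda>z. ennreal (exp (- (1/2) * ((B *v z) \<bullet> (Wi *v (B *v z)) + z \<bullet> (Ki *v z))))"
  define g where "g = (\<integral>\<^sup>+z. ?h z \<partial>lborel)"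
  have *: "(\<integral>\<^sup>+y. ennreal (gaussian_weight W (x - B *v y) * gaussian_weight K y) \<partial>lborel)
     = ennreal (gaussian_weight K x) * g" for x
  proof -
    let ?s = "K *v (transpose B *v (Ki *v x))"
    have "(\<integral>\<^sup>+y. ennreal (gaussian_weight W (x - B *v y) * gaussian_weight K y) \<partial>lborel)
        = (\<integral>\<^sup>+z. ennreal (gaussian_weight W (x - B *v (z + ?s)) * gaussian_weight K (z + ?s)) \<partial>lborel)"
      by (rule nn_integral_lborel_add[symmetric]) measurable
    also have "\<dots> = (\<integral>\<^sup>+z. ennreal (gaussian_weight K x) * ?h z \<partial>lborel)"
      by (simp only: complete_square) (simp add: ennreal_mult' less_imp_le)
    also have "\<dots> = ennreal (gaussian_weight K x) * g"
      unfolding g_def by (rule nn_integral_cmult) measurable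
    finally show ?thesis .
  qed
  have "ennreal (gaussian_mass K) * g
      = (\<integral>\<^sup>+x. ennreal (gaussian_weight K x) * g \<partial>lborel)"
    by (simp add: nn_integral_multc nn_integral_gaussian_mass[OF K])
  also have "\<dots> = (\<integral>\<^sup>+x. \<integral>\<^sup>+y. ennreal (gaussian_weight W (x - B *v y) * gaussian_weight K y) \<partial>lborel \<partial>lborel)"
    by (simp only: *)
  also have "\<dots> = (\<integral>\<^sup>+y. \<integral>\<^sup>+x. ennreal (gaussian_weight W (x - B *v y) * gaussian_weight K y) \<partial>lborel \<partial>lborel)"
    by (rule lborel_pair.Fubini') measurable
  also have "\<dots> = (\<integral>\<^sup>+y. ennreal (gaussian_mass W) * ennreal (gaussian_weight K y) \<partial>lborel)"
  proof (rule nn_integral_cong)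
    fix y
    have "(\<integral>\<^sup>+x. ennreal (gaussian_weight W (x - B *v y) * gaussian_weight K y) \<partial>lborel)
        = (\<integral>\<^sup>+x. ennreal (gaussian_weight W (x - B *v y)) * ennreal (gaussian_weight K y) \<partial>lborel)"
      by (simp add: ennreal_mult less_imp_le)
    also have "\<dots> = ennreal (gaussian_mass W) * ennreal (gaussian_weight K y)"
      by (simp add: nn_integral_multc nn_integral_shifted_weight)
    finally show "(\<integral>\<^sup>+x. ennreal (gaussian_weight W (x - B *v y) * gaussian_weight K y) \<partial>lborel)
        = ennreal (gaussian_mass W) * ennreal (gaussian_weight K y)" .
  qed
  also have "\<dots> = ennreal (gaussian_mass K) * ennreal (gaussian_mass W)"
    by (simp add: nn_integral_cmult nn_integral_gaussian_mass[OF K] mult.commute)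
  finally have "g = ennreal (gaussian_mass W)"
    using mass_pos(1) by (simp add: ennreal_mult_cancel_left)
  then show ?thesis using * by simp
qed

sublocale invariant_kernel kernel density
proof
  show "(\<lambda>(x, y). kernel x y) \<in> borel_measurable (borel \<Otimes>\<^sub>M borel)"
    unfolding kernel_def by measurable
  show "density \<in> borel_measurable borel"
    unfolding density_def[abs_def] by measurable
  show "kernel x y \<ge> 0" for x y
    using mass_pos(2) by (simp add: kernel_def less_imp_le)
  show "\<exists>b. \<forall>y. kernel x y \<le> b" for x
    using mass_pos(2) gaussian_weight_le_1[OF W]
    by (intro exI[of _ "1 / gaussian_mass W"]) (auto simp: kernel_def intro!: divide_right_mono)
  show "density x > 0" for x by simp
  show "(\<integral>\<^sup>+x. ennreal (kernel x y) \<partial>lborel) = 1" for y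
  proof -
    have "(\<integral>\<^sup>+x. ennreal (kernel x y) \<partial>lborel)
        = (\<integral>\<^sup>+x. ennreal (1 / gaussian_mass W) * ennreal (gaussian_weight W (x - B *v y)) \<partial>lborel)"
      using mass_pos(2) by (simp add: kernel_def ennreal_mult'[symmetric])
    also have "\<dots> = ennreal (1 / gaussian_mass W) * ennreal (gaussian_mass W)"
      by (simp add: nn_integral_cmult nn_integral_shifted_weight)
    also have "\<dots> = 1"
      using mass_pos(2) by (simp add: ennreal_mult[symmetric])
    finally show ?thesis .
  qed
  show "(\<integral>\<^sup>+x. ennreal (density x) \<partial>lborel) = 1"
  proof -
    have "(\<integral>\<^sup>+x. ennreal (density x) \<partial>lborel)
        = (\<integral>\<^sup>+x. ennreal (1 / gaussian_mass K) * ennreal (gaussian_weight K x) \<partial>lborel)"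
      using mass_pos(1) by (simp add: density_def ennreal_mult'[symmetric])
    also have "\<dots> = ennreal (1 / gaussian_mass K) * ennreal (gaussian_mass K)"
      by (simp add: nn_integral_cmult nn_integral_gaussian_mass[OF K])
    also have "\<dots> = 1"
      using mass_pos(1) by (simp add: ennreal_mult[symmetric])
    finally show ?thesis .
  qed
  show "(\<integral>\<^sup>+y. ennreal (kernel x y * density y) \<partial>lborel) = ennreal (density x)" for x
  proof -
    let ?c = "1 / (gaussian_mass W * gaussian_mass K)"
    have "(\<integral>\<^sup>+y. ennreal (kernel x y * density y) \<partial>lborel)
        = (\<integral>\<^sup>+y. ennreal ?c * ennreal (gaussian_weight W (x - B *v y) * gaussian_weight K y) \<partial>lborel)"
      using mass_pos by (simp add: kernel_def density_def ennreal_mult'[symmetric])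
    also have "\<dots> = ennreal ?c * (ennreal (gaussian_weight K x) * ennreal (gaussian_mass W))"
      by (subst nn_integral_cmult) (simp_all add: kernel_invariant_unnormalized)
    also have "\<dots> = ennreal (density x)"
      using mass_pos by (simp add: ennreal_mult[symmetric] less_imp_le density_def)
    finally show ?thesis .
  qed
qed

text \<open>The quotient is c exp(e x y), where c is the ratio of the masses and e a quadratic form
  of size M b. In M, the term (2/k)^2 ku stems from W^-1 - K^-1 and the term 2/k from the parts with
  B y. The three conditions in \<open>small\<close> give, in this order, W \<ge> k/2, |e| \<le>
  (\<delta>/2)(|x|^2 + |y|^2) and c \<le> 2.\<close>

lemma kernel_deviation:
  fixes k ku b \<delta> Z :: real
  defines "M \<equiv> (2 / k)\<^sup>2 * ku + 2 / k"
  assumes k: "k > 0" "\<And>x. k * (norm x)\<^sup>2 \<le> x \<bullet> (K *v x)"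
    and ku: "ku > 0" "\<And>x. norm (K *v x) \<le> ku * norm x"
    and b: "0 \<le> b" "b \<le> 1" "\<And>v. norm (B *v v) \<le> b * norm v" "\<And>v. norm (transpose B *v v) \<le> b * norm v"
    and small: "ku * b \<le> k / 2" "M * b \<le> \<delta> / 2" "2 * M * b / \<delta> * Z \<le> 1 / 2"
    and \<delta>: "\<delta> > 0"
    and Z: "(\<integral>\<^sup>+y. ennreal (exp (\<delta> * (norm y)\<^sup>2) * density y) \<partial>lborel) \<le> ennreal Z" "Z \<ge> 0"
  shows "\<bar>kernel x y / density x - 1\<bar>
    \<le> (4 * M / \<delta> * (1 + Z) * b) * exp (\<delta> * (norm x)\<^sup>2) * exp (\<delta> * (norm y)\<^sup>2)"
proof -
  have M: "M > 0" using k ku by (simp add: M_def add_pos_pos)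
  have bb: "b * b \<le> b" using b by (simp add: mult_left_le)
  have KBt: "norm (K *v (transpose B *v v)) \<le> ku * (b * norm v)" for v
    by (rule order_trans[OF ku(2) mult_left_mono]) (use b(4) ku(1) in auto)
  have W_lower: "(k / 2) * (norm x)\<^sup>2 \<le> x \<bullet> (W *v x)" for x
  proof -
    have "x \<bullet> (B *v (K *v (transpose B *v x))) = (transpose B *v x) \<bullet> (K *v (transpose B *v x))"
      by (rule inner_matrix_vector_mult)
    also have "\<dots> \<le> norm (transpose B *v x) * norm (K *v (transpose B *v x))"
      by (rule norm_cauchy_schwarz)
    also have "\<dots> \<le> (b * norm x) * (ku * (b * norm x))"
      using b KBt by (intro mult_mono) auto
    also have "\<dots> = (ku * (b * b)) * (norm x)\<^sup>2" by (simp add: power2_eq_square)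
    also have "\<dots> \<le> (k / 2) * (norm x)\<^sup>2"
    proof (rule mult_right_mono)
      show "ku * (b * b) \<le> k / 2"
        using small(1) mult_left_mono[OF bb less_imp_le[OF ku(1)]] by linarith
    qed simp
    finally show ?thesis using k(2)[of x] by (simp add: W_mult inner_diff_right)
  qed
  have Wi: "norm (Wi *v z) \<le> 2 / k * norm z" for z
    using norm_matrix_inv_le[OF W _ W_lower, of z] k(1) by (simp add: field_simps)
  have Ki: "norm (Ki *v z) \<le> 2 / k * norm z" for z
  proof -
    have "norm z / k \<le> 2 / k * norm z" using k(1) by (simp add: divide_right_mono)
    then show ?thesis using norm_matrix_inv_le[OF K k, of z] by linarith
  qed
  define e where "e x y = (1/2) * (x \<bullet> (Ki *v x)) - (1/2) * ((x - B *v y) \<bullet> (Wi *v (x - B *v y)))" for x y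
  define c where "c = gaussian_mass K / gaussian_mass W"
  have c: "c > 0" using mass_pos by (simp add: c_def)
  have ratio: "kernel x y = c * exp (e x y) * density x" for x y
  proof -
    have "gaussian_weight W (x - B *v y) = exp (e x y) * gaussian_weight K x"
      by (simp add: gaussian_weight_def e_def mult_exp_exp)
    then show ?thesis using mass_pos by (simp add: kernel_def density_def c_def)
  qed
  have e_bound: "\<bar>e x y\<bar> \<le> M * b * ((norm x)\<^sup>2 + (norm y)\<^sup>2)" for x y
  proof -
    \<comment> \<open>W^-1 - K^-1 = W^-1 (K - W) K^-1 with K - W = B K B^T.\<close>
    have diff: "Wi *v x - Ki *v x = Wi *v (B *v (K *v (transpose B *v (Ki *v x))))"
    proof -
      have "W *v (Ki *v x) = x - B *v (K *v (transpose B *v (Ki *v x)))"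
        by (simp only: W_mult K_Ki)
      then have "Wi *v (W *v (Ki *v x)) = Wi *v x - Wi *v (B *v (K *v (transpose B *v (Ki *v x))))"
        by (simp only: matrix_vector_mult_diff_distrib)
      then have "Ki *v x = Wi *v x - Wi *v (B *v (K *v (transpose B *v (Ki *v x))))"
        by (simp only: W_Wi)
      moreover have "u = w - v \<Longrightarrow> w - u = v" for u v w :: "real^'d" by simp
      ultimately show ?thesis by blast
    qed
    have n: "norm (Wi *v (B *v (K *v (transpose B *v (Ki *v x))))) \<le> (2 / k)\<^sup>2 * ku * b * norm x"
    proof -
      have "norm (Wi *v (B *v (K *v (transpose B *v (Ki *v x)))))
          \<le> 2 / k * (b * (ku * (b * (2 / k * norm x))))"
      proof -
        have "norm (B *v (K *v (transpose B *v (Ki *v x)))) \<le> b * (ku * (b * (2 / k * norm x)))"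
          by (rule order_trans[OF b(3) mult_left_mono[OF order_trans[OF KBt mult_left_mono[OF mult_left_mono[OF Ki]]]]])
             (use b ku in auto)
        then show ?thesis
          by (intro order_trans[OF Wi mult_left_mono]) (use k in auto)
      qed
      also have "\<dots> = ((2 / k)\<^sup>2 * ku * norm x) * (b * b)" by (simp add: power2_eq_square)
      also have "\<dots> \<le> ((2 / k)\<^sup>2 * ku * norm x) * b"
        using ku(1) by (intro mult_left_mono bb) auto
      finally show ?thesis by (simp add: mult_ac)
    qed
    have 1: "\<bar>x \<bullet> (Wi *v x) - x \<bullet> (Ki *v x)\<bar> \<le> ((2 / k)\<^sup>2 * ku * b) * (norm x)\<^sup>2"
    proof -
      have "\<bar>x \<bullet> (Wi *v x) - x \<bullet> (Ki *v x)\<bar> = \<bar>x \<bullet> (Wi *v x - Ki *v x)\<bar>"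
        by (simp only: inner_diff_right)
      also have "\<dots> \<le> norm x * norm (Wi *v x - Ki *v x)" by (rule Cauchy_Schwarz_ineq2)
      also have "\<dots> \<le> norm x * ((2 / k)\<^sup>2 * ku * b * norm x)"
        unfolding diff by (intro mult_left_mono n) simp
      finally show ?thesis by (simp add: power2_eq_square mult_ac)
    qed
    have WiB: "norm (Wi *v (B *v y)) \<le> 2 / k * (b * norm y)"
      using k(1) by (intro order_trans[OF Wi mult_left_mono] b(3)) simp
    have 2: "\<bar>x \<bullet> (Wi *v (B *v y))\<bar> \<le> (2 / k * b) * ((norm x)\<^sup>2 / 2 + (norm y)\<^sup>2 / 2)"
    proof -
      have "\<bar>x \<bullet> (Wi *v (B *v y))\<bar> \<le> norm x * (2 / k * (b * norm y))"
        by (rule order_trans[OF Cauchy_Schwarz_ineq2 mult_left_mono[OF WiB]]) simp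
      also have "\<dots> = (2 / k * b) * (norm x * norm y)" by simp
      also have "\<dots> \<le> (2 / k * b) * ((norm x)\<^sup>2 / 2 + (norm y)\<^sup>2 / 2)"
      proof (rule mult_left_mono)
        show "norm x * norm y \<le> (norm x)\<^sup>2 / 2 + (norm y)\<^sup>2 / 2"
          using sum_squares_bound[of "norm x" "norm y"] by simp
      qed (use k(1) b(1) in simp)
      finally show ?thesis .
    qed
    have 3: "\<bar>(B *v y) \<bullet> (Wi *v (B *v y))\<bar> \<le> (2 / k * b) * (norm y)\<^sup>2"
    proof -
      have "\<bar>(B *v y) \<bullet> (Wi *v (B *v y))\<bar> \<le> norm (B *v y) * norm (Wi *v (B *v y))"
        by (rule Cauchy_Schwarz_ineq2)
      also have "\<dots> \<le> (1 * norm y) * (2 / k * (b * norm y))"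
        using b k WiB by (intro mult_mono order_trans[OF b(3)]) (auto simp: mult_right_mono)
      finally show ?thesis by (simp add: power2_eq_square mult_ac)
    qed
    have "(x - B *v y) \<bullet> (Wi *v (x - B *v y))
        = x \<bullet> (Wi *v x) - 2 * (x \<bullet> (Wi *v (B *v y))) + (B *v y) \<bullet> (Wi *v (B *v y))"
      using pos_def_matrix_inner_commute[OF pos_def_matrix_inverse(3)[OF W], of "B *v y" x]
      by (simp add: matrix_vector_mult_diff_distrib inner_diff_left inner_diff_right)
    moreover have "\<bar>(1/2) * r - (1/2) * s\<bar> \<le> (1/2) * \<bar>w - r\<bar> + \<bar>m\<bar> + (1/2) * \<bar>q\<bar>"
      if "s = w - 2 * m + q" for s w r m q :: real
    proof -
      have "\<bar>r - s\<bar> \<le> \<bar>w - r\<bar> + 2 * \<bar>m\<bar> + \<bar>q\<bar>" using that by arith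
      moreover have "(1/2) * r - (1/2) * s = (r - s) / 2" by simp
      ultimately show ?thesis by (simp only: abs_divide) simp
    qed
    ultimately have "\<bar>e x y\<bar> \<le> (1/2) * \<bar>x \<bullet> (Wi *v x) - x \<bullet> (Ki *v x)\<bar> + \<bar>x \<bullet> (Wi *v (B *v y))\<bar>
        + (1/2) * \<bar>(B *v y) \<bullet> (Wi *v (B *v y))\<bar>"
      unfolding e_def by blast
    also have "\<dots> \<le> (1/2) * (((2 / k)\<^sup>2 * ku * b) * (norm x)\<^sup>2) + (2 / k * b) * ((norm x)\<^sup>2 / 2 + (norm y)\<^sup>2 / 2)
        + (1/2) * ((2 / k * b) * (norm y)\<^sup>2)"
      by (intro add_mono mult_left_mono 1 2 3) simp_all
    also have "\<dots> \<le> M * b * ((norm x)\<^sup>2 + (norm y)\<^sup>2)"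
    proof -
      have "0 \<le> (1/2) * ((2 / k)\<^sup>2 * ku * b) * (norm x)\<^sup>2 + (1 / k * b) * (norm x)\<^sup>2
          + ((2 / k)\<^sup>2 * ku * b) * (norm y)\<^sup>2"
        using k(1) ku(1) b(1) by (intro add_nonneg_nonneg mult_nonneg_nonneg) auto
      moreover have "M * b * ((norm x)\<^sup>2 + (norm y)\<^sup>2)
        - ((1/2) * (((2 / k)\<^sup>2 * ku * b) * (norm x)\<^sup>2) + (2 / k * b) * ((norm x)\<^sup>2 / 2 + (norm y)\<^sup>2 / 2)
          + (1/2) * ((2 / k * b) * (norm y)\<^sup>2))
        = (1/2) * ((2 / k)\<^sup>2 * ku * b) * (norm x)\<^sup>2 + (1 / k * b) * (norm x)\<^sup>2
          + ((2 / k)\<^sup>2 * ku * b) * (norm y)\<^sup>2"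
        using k(1) by (simp add: M_def field_simps)
      ultimately show ?thesis by (metis diff_ge_0_iff_ge)
    qed
    finally show ?thesis .
  qed
  \<comment> \<open>Chosen so that M b s = \<rho> (\<delta>/2) s. Half of the final exponent
    \<delta> s is spent on exp |e|, the other half absorbs the linear factor s.\<close>
  define \<rho> where "\<rho> = 2 * M * b / \<delta>"
  have \<rho>: "\<rho> \<ge> 0" using M b \<delta> by (simp add: \<rho>_def)
  have exp_bound: "\<bar>exp (e x y) - 1\<bar> \<le> \<rho> * exp (\<delta> * ((norm x)\<^sup>2 + (norm y)\<^sup>2))" for x y
  proof -
    let ?e = "e x y" and ?s = "(norm x)\<^sup>2 + (norm y)\<^sup>2"
    have s: "?s \<ge> 0" by simp
    have "\<bar>exp ?e - 1\<bar> \<le> \<bar>?e\<bar> * exp \<bar>?e\<bar>"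
    proof (cases "?e \<ge> 0")
      case True
      have "(1 - ?e) * exp ?e \<le> exp (- ?e) * exp ?e"
        using exp_ge_add_one_self[of "- ?e"] by (intro mult_right_mono) auto
      then show ?thesis using True by (simp add: exp_minus algebra_simps)
    next
      case False
      have "1 - exp ?e \<le> - ?e" using exp_ge_add_one_self[of ?e] by linarith
      also have "\<dots> \<le> - ?e * exp (- ?e)" using False mult_left_mono[of 1 "exp (- ?e)" "- ?e"] by simp
      finally show ?thesis using False by simp
    qed
    also have "\<dots> \<le> (M * b * ?s) * exp (\<delta> / 2 * ?s)"
    proof (intro mult_mono e_bound)
      have "M * b * ?s \<le> \<delta> / 2 * ?s" using small(2) s by (rule mult_right_mono)
      then show "exp \<bar>?e\<bar> \<le> exp (\<delta> / 2 * ?s)" using e_bound[of x y] by simp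
    qed (use M b in auto)
    also have "\<dots> = \<rho> * (\<delta> / 2 * ?s) * exp (\<delta> / 2 * ?s)"
      using \<delta> by (simp add: \<rho>_def)
    also have "\<dots> \<le> \<rho> * exp (\<delta> / 2 * ?s) * exp (\<delta> / 2 * ?s)"
    proof (intro mult_right_mono mult_left_mono \<rho>)
      show "\<delta> / 2 * ?s \<le> exp (\<delta> / 2 * ?s)"
        using exp_ge_add_one_self[of "\<delta> / 2 * ?s"] by linarith
    qed simp
    also have "\<dots> = \<rho> * exp (\<delta> * ?s)"
      by (simp only: mult.assoc exp_add[symmetric]) (simp add: algebra_simps)
    finally show ?thesis .
  qed
  \<comment> \<open>The constant c is estimated through invariance at x = 0: reproducing the
    equilibrium there means c I = 1, and I is close to 1 because e is small.\<close>
  define I where "I = (\<integral>y. exp (e 0 y) * density y \<partial>lborel)"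
  have k0: "kernel 0 y * density y = c * density 0 * (exp (e 0 y) * density y)" for y
    by (simp add: ratio)
  have int_e: "integrable lborel (\<lambda>y. exp (e 0 y) * density y)"
  proof -
    have "integrable lborel (\<lambda>y. c * density 0 * (exp (e 0 y) * density y))"
      using integrable_P_mult[OF integrable_gamma, of 0] by (simp only: k0)
    then show ?thesis using c less_imp_neq[OF density_pos[of 0]] by simp
  qed
  have "c * density 0 * I = density 0"
    using integral_P_gamma[of 0] by (simp only: k0 I_def integral_mult_right_zero)
  then have cI: "c * I = 1" using less_imp_neq[OF density_pos[of 0]] by simp
  have int_Z: "integrable lborel (\<lambda>y. exp (\<delta> * (norm y)\<^sup>2) * density y)"
    "(\<integral>y. exp (\<delta> * (norm y)\<^sup>2) * density y \<partial>lborel) \<le> Z"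
  proof -
    have 0: "exp (\<delta> * (norm y)\<^sup>2) * density y \<ge> 0" for y
      using less_imp_le[OF density_pos[of y]] by simp
    show 1: "integrable lborel (\<lambda>y. exp (\<delta> * (norm y)\<^sup>2) * density y)"
      using Z 0 by (intro integrableI_nonneg) (auto simp: le_less_trans)
    have "ennreal (\<integral>y. exp (\<delta> * (norm y)\<^sup>2) * density y \<partial>lborel) \<le> ennreal Z"
      using Z(1) nn_integral_eq_integral[OF 1] 0 by simp
    then show "(\<integral>y. exp (\<delta> * (norm y)\<^sup>2) * density y \<partial>lborel) \<le> Z"
      using Z(2) by (simp add: ennreal_le_iff)
  qed
  have I1: "\<bar>I - 1\<bar> \<le> \<rho> * Z"
  proof -
    have "I - 1 = (\<integral>y. exp (e 0 y) * density y - density y \<partial>lborel)"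
      using int_e integrable_gamma by (simp add: I_def integral_gamma)
    also have "\<bar>\<dots>\<bar> \<le> (\<integral>y. \<bar>exp (e 0 y) * density y - density y\<bar> \<partial>lborel)"
      by (rule integral_abs_bound)
    also have "\<dots> \<le> (\<integral>y. \<rho> * (exp (\<delta> * (norm y)\<^sup>2) * density y) \<partial>lborel)"
    proof (rule integral_mono)
      show "integrable lborel (\<lambda>y. \<bar>exp (e 0 y) * density y - density y\<bar>)"
        using int_e integrable_gamma by auto
      show "integrable lborel (\<lambda>y. \<rho> * (exp (\<delta> * (norm y)\<^sup>2) * density y))"
        using int_Z(1) by simp
      fix y
      have "\<bar>exp (e 0 y) * density y - density y\<bar> = \<bar>exp (e 0 y) - 1\<bar> * density y"
      proof -
        have "exp (e 0 y) * density y - density y = (exp (e 0 y) - 1) * density y"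
          by (simp add: algebra_simps)
        then show ?thesis using density_pos[of y] by (simp add: abs_mult del: density_pos)
      qed
      also have "\<dots> \<le> \<rho> * exp (\<delta> * ((norm (0 :: real^'d))\<^sup>2 + (norm y)\<^sup>2)) * density y"
        using exp_bound[of 0 y] less_imp_le[OF density_pos[of y]] by (rule mult_right_mono)
      finally show "\<bar>exp (e 0 y) * density y - density y\<bar> \<le> \<rho> * (exp (\<delta> * (norm y)\<^sup>2) * density y)"
        by (simp add: mult.assoc)
    qed
    also have "\<dots> \<le> \<rho> * Z"
      using int_Z(2) \<rho> by (simp add: mult_left_mono)
    finally show ?thesis .
  qed
  have "I \<ge> 1 / 2" using I1 small(3) by (simp add: \<rho>_def)
  then have c2: "c \<le> 2"
    using cI c mult_left_mono[of "1/2" I c] by simp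
  have c1: "\<bar>c - 1\<bar> \<le> 2 * (\<rho> * Z)"
  proof -
    have "c - 1 = - (c * (I - 1))" using cI by (simp add: algebra_simps)
    then have "\<bar>c - 1\<bar> = c * \<bar>I - 1\<bar>" using c by (simp add: abs_mult)
    also have "\<dots> \<le> 2 * (\<rho> * Z)" using c c2 I1 by (intro mult_mono) auto
    finally show ?thesis .
  qed
  let ?E = "exp (\<delta> * ((norm x)\<^sup>2 + (norm y)\<^sup>2))"
  have E1: "?E \<ge> 1" using \<delta> by simp
  have "kernel x y / density x - 1 = c * (exp (e x y) - 1) + (c - 1)"
    using less_imp_neq[OF density_pos[of x]] by (simp add: ratio algebra_simps)
  then have "\<bar>kernel x y / density x - 1\<bar> \<le> c * \<bar>exp (e x y) - 1\<bar> + \<bar>c - 1\<bar>"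
    using c by (metis abs_mult abs_of_pos abs_triangle_ineq)
  also have "\<dots> \<le> 2 * (\<rho> * ?E) + 2 * (\<rho> * Z) * ?E"
  proof (intro add_mono)
    show "c * \<bar>exp (e x y) - 1\<bar> \<le> 2 * (\<rho> * ?E)"
      using c c2 exp_bound by (intro mult_mono) auto
    have "2 * (\<rho> * Z) * 1 \<le> 2 * (\<rho> * Z) * ?E"
      using \<rho> Z(2) E1 by (intro mult_left_mono) auto
    then show "\<bar>c - 1\<bar> \<le> 2 * (\<rho> * Z) * ?E" using c1 by simp
  qed
  also have "\<dots> = (4 * M / \<delta> * (1 + Z) * b) * ?E"
    by (simp add: \<rho>_def algebra_simps add_divide_distrib)
  also have "?E = exp (\<delta> * (norm x)\<^sup>2) * exp (\<delta> * (norm y)\<^sup>2)"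
    by (simp add: exp_add[symmetric] algebra_simps)
  finally show ?thesis by (simp only: mult.assoc)
qed

end

section \<open>Entropy decay\<close>

context fokker_planck
begin

section \<open>The transition kernels of the equation\<close>

lemma transition: "t > 0 \<Longrightarrow> gaussian_transition K (fp_W D C t) (E t)"
  using fp_W_pos_def[of t] fp_W_eq[of t] by (simp add: gaussian_transition_def K_pos_def)

abbreviation equilibrium :: "real^'d \<Rightarrow> real" where
  "equilibrium \<equiv> gaussian_transition.density K"

definition transition_kernel :: "real \<Rightarrow> real^'d \<Rightarrow> real^'d \<Rightarrow> real" where
  "transition_kernel t = gaussian_transition.kernel (fp_W D C t) (E t)"

lemma invariant: "t > 0 \<Longrightarrow> invariant_kernel (transition_kernel t) equilibrium"
proof -
  assume "t > 0"
  then interpret gaussian_transition K "fp_W D C t" "E t" by (rule transition)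
  show ?thesis unfolding transition_kernel_def by (rule invariant_kernel_axioms)
qed

text \<open>The density depends on K alone, but its defining equation lives in the locale; the
  transition at time 1 supplies an instance.\<close>

lemma equilibrium_eq: "equilibrium x = gaussian_weight K x / gaussian_mass K"
  by (rule gaussian_transition.density_def[OF transition[OF zero_less_one]])

lemma equilibrium_exp_moment:
  obtains \<delta>0 where "\<delta>0 > 0"
    "\<And>\<delta>. \<delta> \<le> \<delta>0 \<Longrightarrow> \<exists>Z\<ge>0. (\<integral>\<^sup>+y. ennreal (exp (\<delta> * (norm y)\<^sup>2) * equilibrium y) \<partial>lborel) \<le> ennreal Z"
proof -
  obtain \<delta>0 where \<delta>0: "\<delta>0 > 0"
    "\<And>\<delta>. \<delta> \<le> \<delta>0 \<Longrightarrow> (\<integral>\<^sup>+y. ennreal (exp (\<delta> * (norm y)\<^sup>2) * gaussian_weight K y) \<partial>lborel) < \<infinity>"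
    using exp_square_gaussian_finite[OF K_pos_def] by blast
  have "\<exists>Z\<ge>0. (\<integral>\<^sup>+y. ennreal (exp (\<delta> * (norm y)\<^sup>2) * equilibrium y) \<partial>lborel) \<le> ennreal Z"
    if "\<delta> \<le> \<delta>0" for \<delta>
  proof -
    let ?J = "\<integral>\<^sup>+y. ennreal (exp (\<delta> * (norm y)\<^sup>2) * gaussian_weight K y) \<partial>lborel"
    have "(\<integral>\<^sup>+y. ennreal (exp (\<delta> * (norm y)\<^sup>2) * equilibrium y) \<partial>lborel)
        = (\<integral>\<^sup>+y. ennreal (1 / gaussian_mass K) * ennreal (exp (\<delta> * (norm y)\<^sup>2) * gaussian_weight K y) \<partial>lborel)"
      using gaussian_mass_pos[OF K_pos_def] by (simp add: equilibrium_eq ennreal_mult'[symmetric])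
    also have "\<dots> = ennreal (1 / gaussian_mass K) * ?J"
      by (rule nn_integral_cmult) measurable
    also have "\<dots> < \<infinity>"
      using \<delta>0(2)[OF that] by (simp add: ennreal_mult_less_top)
    finally have "(\<integral>\<^sup>+y. ennreal (exp (\<delta> * (norm y)\<^sup>2) * equilibrium y) \<partial>lborel) < \<infinity>" .
    then show ?thesis
      by (intro exI[of _ "enn2real (\<integral>\<^sup>+y. ennreal (exp (\<delta> * (norm y)\<^sup>2) * equilibrium y) \<partial>lborel)"]) simp
  qed
  with \<delta>0(1) show ?thesis using that by blast
qed

lemma transition_deviation:
  assumes \<delta>: "\<delta> > 0"
    and Z: "(\<integral>\<^sup>+y. ennreal (exp (\<delta> * (norm y)\<^sup>2) * equilibrium y) \<partial>lborel) \<le> ennreal Z" "Z \<ge> 0"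
  shows "\<exists>A\<ge>0. \<exists>t0>0. \<forall>t\<ge>t0. \<forall>x y. \<bar>transition_kernel t x y / equilibrium x - 1\<bar>
     \<le> (A * rate t) * exp (\<delta> * (norm x)\<^sup>2) * exp (\<delta> * (norm y)\<^sup>2)"
proof -
  obtain c where c: "c > 0" and decay: "\<forall>t\<ge>0. \<forall>v. norm (E t *v v) \<le> c * rate t * norm v \<and>
     norm (transpose (E t) *v v) \<le> c * rate t * norm v"
    using E_decay by blast
  obtain k where k: "k > 0" "\<And>x. k * (norm x)\<^sup>2 \<le> x \<bullet> (K *v x)"
    using pos_def_matrix_lower_bound[OF K_pos_def] by blast
  obtain ku where ku: "ku > 0" "\<And>x. norm (K *v x) \<le> norm x * ku"
    using bounded_linear.pos_bounded[OF matrix_vector_mul_bounded_linear[of K]] by blast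
  define M where "M = (2 / k)\<^sup>2 * ku + 2 / k"
  have M: "M > 0" using k ku by (simp add: M_def add_pos_pos)
  \<comment> \<open>A threshold for b = c * rate t, from b \<le> 1 and the three smallness
    conditions of \<open>kernel_deviation\<close>; Z + 1 in place of Z keeps the last denominator
    positive.\<close>
  define b0 where "b0 = Min {1, k / (2 * ku), \<delta> / (2 * M), \<delta> / (4 * M * (Z + 1))}"
  have b0: "b0 > 0" using k ku M \<delta> Z(2) by (simp add: b0_def)
  have b0_le: "b0 \<le> 1" "b0 \<le> k / (2 * ku)" "b0 \<le> \<delta> / (2 * M)" "b0 \<le> \<delta> / (4 * M * (Z + 1))"
    by (simp_all add: b0_def)
  have "((\<lambda>t. c * rate t) \<longlongrightarrow> c * 0) at_top"
    by (intro tendsto_mult tendsto_const rate_tendsto_0)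
  then have "\<forall>\<^sub>F t in at_top. c * rate t < b0"
    using b0 by (intro order_tendstoD(2)) auto
  then obtain t1 where t1: "\<And>t. t \<ge> t1 \<Longrightarrow> c * rate t < b0"
    by (auto simp: eventually_at_top_linorder)
  \<comment> \<open>The 1 guarantees t > 0, as the transition requires.\<close>
  define t0 where "t0 = max t1 1"
  have "\<bar>transition_kernel t x y / equilibrium x - 1\<bar>
     \<le> (4 * M / \<delta> * (1 + Z) * c * rate t) * exp (\<delta> * (norm x)\<^sup>2) * exp (\<delta> * (norm y)\<^sup>2)"
    if t: "t \<ge> t0" for t x y
  proof -
    have t': "t > 0" using t by (simp add: t0_def)
    let ?b = "c * rate t"
    interpret gaussian_transition K "fp_W D C t" "E t" using t' by (rule transition)
    have b: "0 \<le> ?b" using c t' by (simp add: rate_nonneg)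
    have bb: "?b \<le> b0" using t1[of t] t by (simp add: t0_def)
    have 1: "ku * ?b \<le> k / 2"
      using order_trans[OF bb b0_le(2)] ku(1) by (simp add: field_simps)
    have 2: "M * ?b \<le> \<delta> / 2"
      using order_trans[OF bb b0_le(3)] M by (simp add: field_simps)
    have 3: "2 * M * ?b / \<delta> * Z \<le> 1 / 2"
    proof -
      have "?b * (4 * M * (Z + 1)) \<le> \<delta>"
        using order_trans[OF bb b0_le(4)] M Z(2) by (subst (asm) pos_le_divide_eq) auto
      moreover have "?b * (4 * M * Z) \<le> ?b * (4 * M * (Z + 1))"
        using b M by (intro mult_left_mono) auto
      ultimately have "4 * M * ?b * Z \<le> \<delta>" by (simp add: mult_ac)
      then show ?thesis using \<delta> by (simp add: field_simps)
    qed
    have "\<bar>kernel x y / density x - 1\<bar>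
      \<le> (4 * ((2 / k)\<^sup>2 * ku + 2 / k) / \<delta> * (1 + Z) * ?b) * exp (\<delta> * (norm x)\<^sup>2) * exp (\<delta> * (norm y)\<^sup>2)"
      using k ku b bb b0_le(1) decay t' 1 2 3 \<delta> Z
      by (intro kernel_deviation[where k = k and ku = ku and b = ?b]) (auto simp: M_def mult.commute)
    then show ?thesis by (simp only: transition_kernel_def M_def mult.assoc)
  qed
  moreover have "4 * M / \<delta> * (1 + Z) * c \<ge> 0" using M \<delta> Z(2) c by simp
  moreover have "t0 > 0" by (simp add: t0_def)
  ultimately show ?thesis by blast
qed

definition evolution :: "real \<Rightarrow> (real^'d \<Rightarrow> real) \<Rightarrow> real^'d \<Rightarrow> real" where
  "evolution t = invariant_kernel.evolve (transition_kernel t)"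

definition entropy :: "real \<Rightarrow> (real^'d \<Rightarrow> real) \<Rightarrow> ennreal" where
  "entropy p f = (\<integral>\<^sup>+x. ennreal (psi p (f x / equilibrium x) * equilibrium x) \<partial>lborel)"

lemma entropy_nonincreasing:
  assumes "t > 0" "p > 1" "integrable lborel f" "\<And>y. f y \<ge> 0"
  shows "entropy p (evolution t f) \<le> entropy p f"
  unfolding entropy_def evolution_def
  using invariant_kernel.entropy_evolve_le[OF invariant[OF assms(1)] assms(2-4)] .

text \<open>The weight is exp(\<delta>|x|^2) with \<delta> = \<delta>0 / q for the conjugate
  exponent q, so that its q-th power exp(\<delta>0 |x|^2) is integrable against the equilibrium. A
  and t0 are fixed before f and e, as the constant of the theorem has to be.\<close>

lemma entropy_long_time:
  assumes p: "1 < p" "p \<le> 2"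
  shows "\<exists>A\<ge>0. \<exists>t0>0. \<forall>t\<ge>t0. \<forall>f e. integrable lborel f \<longrightarrow> (\<forall>y. f y \<ge> 0) \<longrightarrow> (\<integral>x. f x \<partial>lborel) = 1 \<longrightarrow>
    e \<ge> 0 \<longrightarrow> entropy p f = ennreal e \<longrightarrow>
      entropy p (evolution t f) \<le> ennreal (A * (rate t)\<^sup>2 * (p * (p - 1) * e + 1) powr (2 / p)) \<and>
      (p = 2 \<longrightarrow> entropy p (evolution t f) \<le> ennreal (A * (rate t)\<^sup>2 * e))"
proof -
  let ?q = "p / (p - 1)"
  have q: "?q \<ge> 1" using p by (simp add: field_simps)
  obtain \<delta>0 where \<delta>0: "\<delta>0 > 0"
    "\<And>\<delta>. \<delta> \<le> \<delta>0 \<Longrightarrow> \<exists>Z\<ge>0. (\<integral>\<^sup>+y. ennreal (exp (\<delta> * (norm y)\<^sup>2) * equilibrium y) \<partial>lborel) \<le> ennreal Z"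
    using equilibrium_exp_moment by blast
  define \<delta> where "\<delta> = \<delta>0 / ?q"
  have \<delta>: "\<delta> > 0" "?q * \<delta> = \<delta>0" using \<delta>0(1) p by (simp_all add: \<delta>_def)
  obtain Z where Z: "Z \<ge> 0" "(\<integral>\<^sup>+y. ennreal (exp (\<delta>0 * (norm y)\<^sup>2) * equilibrium y) \<partial>lborel) \<le> ennreal Z"
    using \<delta>0(2)[of \<delta>0] by blast
  have eq_nonneg: "equilibrium y \<ge> 0" for y
    using gaussian_mass_pos[OF K_pos_def] by (simp add: equilibrium_eq less_imp_le)
  \<comment> \<open>Since q \<ge> 1, the moment Z for \<delta>0 also serves for \<delta>, which the
    kernel estimate asks for.\<close>
  have "\<delta> \<le> \<delta>0" using \<delta> q mult_right_mono[of 1 ?q \<delta>] by simp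
  then have "(\<integral>\<^sup>+y. ennreal (exp (\<delta> * (norm y)\<^sup>2) * equilibrium y) \<partial>lborel)
      \<le> (\<integral>\<^sup>+y. ennreal (exp (\<delta>0 * (norm y)\<^sup>2) * equilibrium y) \<partial>lborel)"
    by (intro nn_integral_mono ennreal_leI mult_right_mono eq_nonneg) (simp add: mult_right_mono)
  then have Z\<delta>: "(\<integral>\<^sup>+y. ennreal (exp (\<delta> * (norm y)\<^sup>2) * equilibrium y) \<partial>lborel) \<le> ennreal Z"
    using Z(2) by (rule order_trans)
  obtain A t0 where A: "A \<ge> 0" and t0: "t0 > 0"
    and dev: "\<And>t x y. t \<ge> t0 \<Longrightarrow> \<bar>transition_kernel t x y / equilibrium x - 1\<bar>
     \<le> (A * rate t) * exp (\<delta> * (norm x)\<^sup>2) * exp (\<delta> * (norm y)\<^sup>2)"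
    using transition_deviation[OF \<delta>(1) Z\<delta> Z(1)] by blast
  \<comment> \<open>The sum of the constants of both estimates, so that a single A serves
    them.\<close>
  let ?A = "A\<^sup>2 * (Z * (1 + Z)\<^sup>2) / (p * (p - 1)) + A\<^sup>2 * (Z * (1 + Z)\<^sup>2)"
  have "entropy p (evolution t f) \<le> ennreal (?A * (rate t)\<^sup>2 * (p * (p - 1) * e + 1) powr (2 / p)) \<and>
      (p = 2 \<longrightarrow> entropy p (evolution t f) \<le> ennreal (?A * (rate t)\<^sup>2 * e))"
    if t: "t \<ge> t0" and f: "integrable lborel f" "\<And>y. f y \<ge> 0" "(\<integral>x. f x \<partial>lborel) = 1"
      and e: "e \<ge> 0" "entropy p f = ennreal e" for t f e
  proof -
    have t': "t > 0" using t t0 by simp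
    interpret invariant_kernel "transition_kernel t" equilibrium using t' by (rule invariant)
    have \<kappa>: "A * rate t \<ge> 0" using A t' by (simp add: rate_nonneg)
    have G: "(\<lambda>x :: real^'d. exp (\<delta> * (norm x)\<^sup>2)) \<in> borel_measurable borel" by measurable
    have G1: "exp (\<delta> * (norm x)\<^sup>2) \<ge> 1" for x :: "real^'d" using \<delta>(1) by simp
    have GZ: "(\<integral>\<^sup>+x. ennreal (exp (\<delta> * (norm x)\<^sup>2) powr ?q * equilibrium x) \<partial>lborel) \<le> ennreal Z"
    proof -
      have "exp (\<delta> * (norm x)\<^sup>2) powr ?q = exp (\<delta>0 * (norm x)\<^sup>2)" for x :: "real^'d"
        unfolding \<delta>(2)[symmetric] by (simp add: exp_powr_real mult_ac)
      then show ?thesis using Z(2) by simp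
    qed
    note bounds = entropy_evolve_decay[OF p f e(2)[unfolded entropy_def] e(1) G G1 dev[OF t] \<kappa> GZ Z(1)]
    have pos: "0 \<le> A\<^sup>2 * (Z * (1 + Z)\<^sup>2) / (p * (p - 1))" "0 \<le> A\<^sup>2 * (Z * (1 + Z)\<^sup>2)"
      using p Z(1) by simp_all
    have "entropy p (evolution t f) \<le> ennreal ((A * rate t)\<^sup>2 * (Z * (1 + Z)\<^sup>2) / (p * (p - 1)) * (p * (p - 1) * e + 1) powr (2 / p))"
      using bounds(1) by (simp add: entropy_def evolution_def)
    also have "(A * rate t)\<^sup>2 * (Z * (1 + Z)\<^sup>2) / (p * (p - 1))
        = A\<^sup>2 * (Z * (1 + Z)\<^sup>2) / (p * (p - 1)) * (rate t)\<^sup>2"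
      by (simp add: power_mult_distrib)
    also have "ennreal (A\<^sup>2 * (Z * (1 + Z)\<^sup>2) / (p * (p - 1)) * (rate t)\<^sup>2 * (p * (p - 1) * e + 1) powr (2 / p))
        \<le> ennreal (?A * (rate t)\<^sup>2 * (p * (p - 1) * e + 1) powr (2 / p))"
      using pos by (intro ennreal_leI mult_right_mono) auto
    finally have 1: "entropy p (evolution t f) \<le> ennreal (?A * (rate t)\<^sup>2 * (p * (p - 1) * e + 1) powr (2 / p))" .
    have 2: "entropy p (evolution t f) \<le> ennreal (?A * (rate t)\<^sup>2 * e)" if "p = 2"
    proof -
      have "entropy p (evolution t f) \<le> ennreal ((A * rate t)\<^sup>2 * (Z * (1 + Z)\<^sup>2) * e)"
        using bounds(2)[OF that] by (simp add: entropy_def evolution_def)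
      also have "(A * rate t)\<^sup>2 * (Z * (1 + Z)\<^sup>2) = A\<^sup>2 * (Z * (1 + Z)\<^sup>2) * (rate t)\<^sup>2"
        by (simp add: power_mult_distrib)
      also have "ennreal (A\<^sup>2 * (Z * (1 + Z)\<^sup>2) * (rate t)\<^sup>2 * e) \<le> ennreal (?A * (rate t)\<^sup>2 * e)"
        using pos e(1) by (intro ennreal_leI mult_right_mono) auto
      finally show ?thesis .
    qed
    show ?thesis using 1 2 by blast
  qed
  moreover have "?A \<ge> 0" using p Z(1) by simp
  ultimately show ?thesis using t0 by blast
qed

section \<open>From the explicit solution to the kernel evolution\<close>

lemma fp_equilibrium_eq: "fp_equilibrium D C = equilibrium"
proof
  fix x
  have "(\<integral>y. gaussian_weight K y \<partial>lebesgue) = (\<integral>y. gaussian_weight K y \<partial>lborel)"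
    by (rule integral_completion) measurable
  also have "\<dots> = gaussian_mass K"
    using nn_integral_gaussian_mass[OF K_pos_def] gaussian_mass_pos[OF K_pos_def]
    by (subst integral_eq_nn_integral) (auto simp: less_imp_le)
  finally show "fp_equilibrium D C x = equilibrium x"
    by (simp add: fp_equilibrium_def fp_K_eq equilibrium_eq)
qed

lemma fp_solution_eq_evolution:
  assumes t: "t > 0" and f0: "f0 \<in> borel_measurable lebesgue" and ae: "AE y in lebesgue. f0 y = f y"
    and f [measurable]: "f \<in> borel_measurable borel"
  shows "fp_solution D C f0 t x = evolution t f x"
proof -
  let ?g = "\<lambda>y. gaussian_weight (fp_W D C t) (x - E t *v y)"
  have g: "?g \<in> borel_measurable lebesgue"
    by (rule measurable_completion) measurable
  have f': "f \<in> borel_measurable lebesgue"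
    by (rule measurable_completion) measurable
  have "fp_solution D C f0 t x = 1 / gaussian_mass (fp_W D C t) * (\<integral>y. ?g y * f0 y \<partial>lebesgue)"
    using t by (simp add: fp_solution_def gaussian_mass_def gaussian_weight_def E_def)
  also have "(\<integral>y. ?g y * f0 y \<partial>lebesgue) = (\<integral>y. ?g y * f y \<partial>lebesgue)"
    using ae f0 g f' by (intro integral_cong_AE) auto
  also have "\<dots> = (\<integral>y. ?g y * f y \<partial>lborel)"
    by (rule integral_completion) measurable
  also have "1 / gaussian_mass (fp_W D C t) * \<dots> = evolution t f x"
    unfolding evolution_def invariant_kernel.evolve_def[OF invariant[OF t]]
    by (simp add: transition_kernel_def gaussian_transition.kernel_def[OF transition[OF t]])
  finally show ?thesis .
qed

text \<open>The data are only Lebesgue measurable and nonnegative almost everywhere, whereas the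
  kernel estimates work with Borel functions that are nonnegative everywhere. Changing f0 on a null
  set alters neither its entropy nor the solution for t > 0.\<close>

lemma Borel_representative:
  assumes f0: "f0 \<in> L1_plus" "unit_mass f0"
  obtains f where "integrable lborel f" "\<And>y. f y \<ge> 0" "(\<integral>x. f x \<partial>lborel) = 1"
    "\<And>p. p_entropy p f0 (fp_equilibrium D C) = entropy p f"
    "\<And>p t. t > 0 \<Longrightarrow> p_entropy p (fp_solution D C f0 t) (fp_equilibrium D C) = entropy p (evolution t f)"
proof -
  have int: "integrable lebesgue f0" and nonneg: "AE x in lebesgue. 0 \<le> f0 x"
    using f0(1) by (auto simp: L1_plus_def)
  have meas: "f0 \<in> borel_measurable lebesgue" using int by simp
  then obtain g where g: "g \<in> borel_measurable lborel" "AE x in lborel. f0 x = g x"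
    using completion_ex_borel_measurable_real[of f0 lborel] by blast
  define f where "f x = max 0 (g x)" for x
  have f [measurable]: "f \<in> borel_measurable borel" using g(1) by (simp add: f_def[abs_def])
  have ae: "AE x in lebesgue. f0 x = f x"
    using AE_completion[OF g(2)] nonneg by eventually_elim (simp add: f_def)
  have f': "f \<in> borel_measurable lebesgue"
    by (rule measurable_completion) measurable
  have "integrable lebesgue f"
    using integrable_cong_AE[OF meas f' ae] int by simp
  then have 1: "integrable lborel f"
    using integrable_completion[of f lborel] by simp
  have 2: "(\<integral>x. f x \<partial>lborel) = 1"
    using integral_cong_AE[OF meas f' ae] integral_completion[of f lborel] f0(2)
    by (simp add: unit_mass_def)
  have 3: "p_entropy p f0 (fp_equilibrium D C) = entropy p f" for p
  proof -
    have "p_entropy p f0 (fp_equilibrium D C) = p_entropy p f (fp_equilibrium D C)"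
      unfolding p_entropy_def using ae by (intro nn_integral_cong_AE) (auto elim: eventually_mono)
    then show ?thesis
      by (simp add: p_entropy_def fp_equilibrium_eq nn_integral_completion entropy_def)
  qed
  have 4: "p_entropy p (fp_solution D C f0 t) (fp_equilibrium D C) = entropy p (evolution t f)"
    if "t > 0" for p t
    by (simp add: p_entropy_def fp_equilibrium_eq nn_integral_completion entropy_def
        fp_solution_eq_evolution[OF that meas ae f])
  show ?thesis by (rule that[OF 1 _ 2 3 4]) (simp_all add: f_def)
qed

text \<open>From (1 + u)^2 \<le> 2 (1 + u^2) with u = t^n; this is where the t^(2n) of the theorem
  arises.\<close>

lemma rate_square_le:
  assumes "t \<ge> 0"
  shows "(rate t)\<^sup>2 \<le> 2 * (1 + t ^ (2 * max_defect C)) * exp (- 2 * min_real_part C * t)"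
proof -
  have "(1 + u)\<^sup>2 \<le> 2 * (1 + u\<^sup>2)" for u :: real
    using zero_le_power2[of "1 - u"] by (simp add: power2_eq_square algebra_simps)
  from this[of "t ^ max_defect C"] have "(1 + t ^ max_defect C)\<^sup>2 \<le> 2 * (1 + t ^ (2 * max_defect C))"
    by (simp add: power_mult[symmetric] mult.commute)
  moreover have "(exp (- min_real_part C * t))\<^sup>2 = exp (- 2 * min_real_part C * t)"
    by (simp add: exp_double[symmetric] mult_ac)
  ultimately show ?thesis
    unfolding rate_def power_mult_distrib by (simp add: mult_right_mono)
qed

text \<open>X stands for the initial term of the claim and dominates both e, used for t < t0, and Q,
  used for t \<ge> t0. Before t0 the factor exp(2 \<mu> t0) exp(-2 \<mu> t) is at least 1, so that
  monotonicity of the entropy suffices.\<close>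

lemma entropy_decay_combine:
  assumes t: "t \<ge> 0" and t0: "t0 > 0" and A: "A \<ge> 0" and X: "e \<le> X" "Q \<le> X" "0 \<le> X"
    and short: "\<epsilon>t \<le> ennreal e"
    and long: "t \<ge> t0 \<Longrightarrow> \<epsilon>t \<le> ennreal (A * (rate t)\<^sup>2 * Q)"
  shows "\<epsilon>t \<le> ennreal ((2 * A + exp (2 * min_real_part C * t0)) * X *
     (1 + t ^ (2 * max_defect C)) * exp (- 2 * min_real_part C * t))"
proof -
  let ?\<mu> = "min_real_part C" and ?T = "1 + t ^ (2 * max_defect C)"
  have T: "?T \<ge> 1" using t by simp
  show ?thesis
  proof (cases "t \<ge> t0")
    case True
    have "A * (rate t)\<^sup>2 * Q \<le> A * (rate t)\<^sup>2 * X"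
      using A X by (intro mult_left_mono) auto
    also have "\<dots> \<le> A * (2 * ?T * exp (- 2 * ?\<mu> * t)) * X"
      using A X rate_square_le[OF t] by (intro mult_right_mono mult_left_mono) auto
    also have "\<dots> = (2 * A) * X * ?T * exp (- 2 * ?\<mu> * t)" by simp
    also have "\<dots> \<le> (2 * A + exp (2 * ?\<mu> * t0)) * X * ?T * exp (- 2 * ?\<mu> * t)"
      using X T by (intro mult_right_mono) auto
    finally show ?thesis
      using long[OF True] by (meson ennreal_leI order_trans)
  next
    case False
    have "1 \<le> exp (2 * ?\<mu> * t0) * exp (- 2 * ?\<mu> * t)"
      using False min_real_part_pos by (simp add: mult_exp_exp mult_left_mono)
    also have "\<dots> \<le> exp (2 * ?\<mu> * t0) * exp (- 2 * ?\<mu> * t) * ?T"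
      using mult_left_mono[OF T, of "exp (2 * ?\<mu> * t0) * exp (- 2 * ?\<mu> * t)"] by simp
    finally have "X * 1 \<le> X * (exp (2 * ?\<mu> * t0) * exp (- 2 * ?\<mu> * t) * ?T)"
      using X by (intro mult_left_mono) auto
    also have "\<dots> = exp (2 * ?\<mu> * t0) * X * ?T * exp (- 2 * ?\<mu> * t)" by simp
    also have "\<dots> \<le> (2 * A + exp (2 * ?\<mu> * t0)) * X * ?T * exp (- 2 * ?\<mu> * t)"
      using X T A by (intro mult_right_mono) auto
    finally have "e \<le> (2 * A + exp (2 * ?\<mu> * t0)) * X * ?T * exp (- 2 * ?\<mu> * t)"
      using X by simp
    then show ?thesis
      using short by (meson ennreal_leI order_trans)
  qed
qed

text \<open>X is left free so that both parts of the theorem are instances: it is the maximum in the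
  first part and the entropy itself in the second, where the alternative p = 2 discharges the
  condition on the power.\<close>

lemma solution_entropy_decay:
  assumes p: "1 < p" "p \<le> 2"
  obtains c where "c > 0"
    "\<And>f0 t X. f0 \<in> L1_plus \<Longrightarrow> unit_mass f0 \<Longrightarrow> p_entropy p f0 (fp_equilibrium D C) < \<infinity> \<Longrightarrow> t \<ge> 0 \<Longrightarrow>
      enn2real (p_entropy p f0 (fp_equilibrium D C)) \<le> X \<Longrightarrow>
      (p = 2 \<or> (p * (p - 1) * enn2real (p_entropy p f0 (fp_equilibrium D C)) + 1) powr (2 / p) \<le> X) \<Longrightarrow>
      p_entropy p (fp_solution D C f0 t) (fp_equilibrium D C) \<le>
        ennreal (c * X * (1 + t ^ (2 * max_defect C)) * exp (- 2 * min_real_part C * t))"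
proof -
  obtain A t0 where A: "A \<ge> 0" and t0: "t0 > 0" and long: "\<And>t f e. t \<ge> t0 \<Longrightarrow> integrable lborel f \<Longrightarrow>
    (\<And>y. f y \<ge> 0) \<Longrightarrow> (\<integral>x. f x \<partial>lborel) = 1 \<Longrightarrow> e \<ge> 0 \<Longrightarrow> entropy p f = ennreal e \<Longrightarrow>
      entropy p (evolution t f) \<le> ennreal (A * (rate t)\<^sup>2 * (p * (p - 1) * e + 1) powr (2 / p)) \<and>
      (p = 2 \<longrightarrow> entropy p (evolution t f) \<le> ennreal (A * (rate t)\<^sup>2 * e))"
    using entropy_long_time[OF p] by blast
  show ?thesis
  proof (rule that[of "2 * A + exp (2 * min_real_part C * t0)"])
    show "2 * A + exp (2 * min_real_part C * t0) > 0" using A by (simp add: add_nonneg_pos)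
    fix f0 :: "real^'d \<Rightarrow> real" and t X :: real
    let ?e0 = "p_entropy p f0 (fp_equilibrium D C)"
    assume f0: "f0 \<in> L1_plus" "unit_mass f0" and fin: "?e0 < \<infinity>" and t: "t \<ge> 0"
      and X: "enn2real ?e0 \<le> X" "p = 2 \<or> (p * (p - 1) * enn2real ?e0 + 1) powr (2 / p) \<le> X"
    define e where "e = enn2real ?e0"
    have e: "e \<ge> 0" "?e0 = ennreal e" using fin by (simp_all add: e_def)
    obtain f where f: "integrable lborel f" "\<And>y. f y \<ge> 0" "(\<integral>x. f x \<partial>lborel) = 1"
      "\<And>p. p_entropy p f0 (fp_equilibrium D C) = entropy p f"
      "\<And>p t. t > 0 \<Longrightarrow> p_entropy p (fp_solution D C f0 t) (fp_equilibrium D C) = entropy p (evolution t f)"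
      using Borel_representative[OF f0] by blast
    have ef: "entropy p f = ennreal e" using e(2) f(4) by simp
    define Q where "Q = (if p = 2 then e else (p * (p - 1) * e + 1) powr (2 / p))"
    show "p_entropy p (fp_solution D C f0 t) (fp_equilibrium D C) \<le>
        ennreal ((2 * A + exp (2 * min_real_part C * t0)) * X *
          (1 + t ^ (2 * max_defect C)) * exp (- 2 * min_real_part C * t))"
    proof (rule entropy_decay_combine[OF t t0 A, where e = e and Q = Q])
      show "e \<le> X" using X(1) by (simp add: e_def)
      then show "0 \<le> X" using e(1) by simp
      show "Q \<le> X" using X by (auto simp: Q_def e_def)
      show "p_entropy p (fp_solution D C f0 t) (fp_equilibrium D C) \<le> ennreal e"
      \<comment> \<open>At t = 0 the solution is f0 itself and not a kernel integral.\<close>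
      proof (cases "t = 0")
        case True
        then have "fp_solution D C f0 t = f0" by (simp add: fp_solution_def fun_eq_iff)
        then show ?thesis using e(2) by simp
      next
        case False
        then show ?thesis
          using t f(5)[of t p] ef entropy_nonincreasing[OF _ p(1) f(1,2), of t] by simp
      qed
      show "p_entropy p (fp_solution D C f0 t) (fp_equilibrium D C) \<le> ennreal (A * (rate t)\<^sup>2 * Q)"
        if "t \<ge> t0"
        using long[OF that f(1-3) e(1) ef] f(5)[of t p] that t0 by (simp add: Q_def)
    qed
  qed
qed

end

theorem theorem1p4:
  fixes D C :: "real^'d^'d"
  assumes "pos_def_matrix D" and "positive_stable C"
  defines "finf \<equiv> fp_equilibrium D C"
    and "mu \<equiv> min_real_part C"
    and "n \<equiv> max_defect C"
  shows
    "(\<forall>p \<in> {1<..2}. \<forall>\<epsilon>>0. \<exists>Cpe>0. \<forall>f0 \<in> L1_plus.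
        unit_mass f0 \<longrightarrow> p_entropy p f0 finf < \<infinity> \<longrightarrow>
        (\<forall>t\<ge>0. p_entropy p (fp_solution D C f0 t) finf \<le>
           ennreal (Cpe *
             max (enn2real (p_entropy p f0 finf))
                 ((p * (p - 1) * enn2real (p_entropy p f0 finf) + 1)
                    powr (2 / p * (1 + \<epsilon> * (2 - p)))) *
             (1 + t ^ (2 * n)) * exp (- 2 * mu * t))))
     \<and> (\<exists>C2>0. \<forall>f0 \<in> L1_plus.
        unit_mass f0 \<longrightarrow> p_entropy 2 f0 finf < \<infinity> \<longrightarrow>
        (\<forall>t\<ge>0. p_entropy 2 (fp_solution D C f0 t) finf \<le>
           ennreal (C2 * enn2real (p_entropy 2 f0 finf) *
             (1 + t ^ (2 * n)) * exp (- 2 * mu * t))))"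
proof -
  interpret fokker_planck D C using assms(1,2) by unfold_locales
  have part1: "\<exists>Cpe>0. \<forall>f0 \<in> L1_plus. unit_mass f0 \<longrightarrow> p_entropy p f0 finf < \<infinity> \<longrightarrow>
        (\<forall>t\<ge>0. p_entropy p (fp_solution D C f0 t) finf \<le>
           ennreal (Cpe *
             max (enn2real (p_entropy p f0 finf))
                 ((p * (p - 1) * enn2real (p_entropy p f0 finf) + 1)
                    powr (2 / p * (1 + \<epsilon> * (2 - p)))) *
             (1 + t ^ (2 * n)) * exp (- 2 * mu * t)))"
    if p: "1 < p" "p \<le> 2" and \<epsilon>: "\<epsilon> > 0" for p \<epsilon>
  proof -
    obtain c where c: "c > 0"
      "\<And>f0 t X. f0 \<in> L1_plus \<Longrightarrow> unit_mass f0 \<Longrightarrow> p_entropy p f0 finf < \<infinity> \<Longrightarrow> t \<ge> 0 \<Longrightarrow>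
        enn2real (p_entropy p f0 finf) \<le> X \<Longrightarrow>
        (p = 2 \<or> (p * (p - 1) * enn2real (p_entropy p f0 finf) + 1) powr (2 / p) \<le> X) \<Longrightarrow>
        p_entropy p (fp_solution D C f0 t) finf \<le> ennreal (c * X * (1 + t ^ (2 * n)) * exp (- 2 * mu * t))"
      using solution_entropy_decay[OF p] unfolding finf_def mu_def n_def by blast
    \<comment> \<open>The base is at least 1 and so is 1 + \<epsilon>(2 - p); passing from the
      proved exponent 2/p to the stated one therefore only enlarges the bound.\<close>
    have "N powr (2 / p) \<le> N powr (2 / p * (1 + \<epsilon> * (2 - p)))" if "N \<ge> 1" for N :: real
      using that p \<epsilon> mult_left_mono[of 1 "1 + \<epsilon> * (2 - p)" "2 / p"] by (intro powr_mono) auto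
    moreover have "p * (p - 1) * enn2real e + 1 \<ge> 1" for e using p by simp
    ultimately have "(p * (p - 1) * enn2real e + 1) powr (2 / p) \<le> max (enn2real e)
        ((p * (p - 1) * enn2real e + 1) powr (2 / p * (1 + \<epsilon> * (2 - p))))" for e
      by (simp add: le_max_iff_disj)
    then show ?thesis
      using c by (intro exI[of _ c] conjI ballI impI allI c(2)) auto
  qed
  obtain c2 where c2: "c2 > 0"
      "\<And>f0 t X. f0 \<in> L1_plus \<Longrightarrow> unit_mass f0 \<Longrightarrow> p_entropy 2 f0 finf < \<infinity> \<Longrightarrow> t \<ge> 0 \<Longrightarrow>
        enn2real (p_entropy 2 f0 finf) \<le> X \<Longrightarrow> 2 = (2 :: real) \<or>
          (2 * (2 - 1) * enn2real (p_entropy 2 f0 finf) + 1) powr (2 / 2) \<le> X \<Longrightarrow>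
        p_entropy 2 (fp_solution D C f0 t) finf \<le> ennreal (c2 * X * (1 + t ^ (2 * n)) * exp (- 2 * mu * t))"
  proof -
    have "1 < (2 :: real)" "(2 :: real) \<le> 2" by simp_all
    from solution_entropy_decay[OF this] that show thesis
      unfolding finf_def mu_def n_def by blast
  qed
  show ?thesis
  proof (intro conjI ballI allI impI)
    fix p \<epsilon> :: real assume "p \<in> {1<..2}" "\<epsilon> > 0"
    then show "\<exists>Cpe>0. \<forall>f0 \<in> L1_plus. unit_mass f0 \<longrightarrow> p_entropy p f0 finf < \<infinity> \<longrightarrow>
        (\<forall>t\<ge>0. p_entropy p (fp_solution D C f0 t) finf \<le>
           ennreal (Cpe *
             max (enn2real (p_entropy p f0 finf))
                 ((p * (p - 1) * enn2real (p_entropy p f0 finf) + 1)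
                    powr (2 / p * (1 + \<epsilon> * (2 - p)))) *
             (1 + t ^ (2 * n)) * exp (- 2 * mu * t)))"
      by (intro part1) auto
  next
    show "\<exists>C2>0. \<forall>f0 \<in> L1_plus.
        unit_mass f0 \<longrightarrow> p_entropy 2 f0 finf < \<infinity> \<longrightarrow>
        (\<forall>t\<ge>0. p_entropy 2 (fp_solution D C f0 t) finf \<le>
           ennreal (C2 * enn2real (p_entropy 2 f0 finf) *
             (1 + t ^ (2 * n)) * exp (- 2 * mu * t)))"
      using c2(1) by (intro exI[of _ c2] conjI ballI impI allI c2(2)) auto
  qed
qed

end
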